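(* Consider a discrete memoryless 3-receiver broadcast channel $p(y_1,y_2,z|x)$ in which a confidential message is to be sent to receivers $Y_1$ and $Y_2$ and kept asymptotically secret from the eavesdropper $Z$. Its secrecy capacity satisfies $$C_{\rm S}\ge\min\{I(V_0,V_1;Y_1|Q)-I(V_0,V_1;Z|Q),\ I(V_0,V_2;Y_2|Q)-I(V_0,V_2;Z|Q)\}$$ for every joint pmf of the form $p(q,v_0,v_1,v_2,x)=p(q,v_0)p(v_1,v_2|v_0)p(x|v_1,v_2,v_0)$ such that $I(V_1,V_2;Z|V_0)\le I(V_1;Z|V_0)+I(V_2;Z|V_0)-I(V_1;V_2|V_0)$, where all mutual informations are computed under $p(q,v_0,v_1,v_2,x)p(y_1,y_2,z|x)$.
   Context: The channel has finite input alphabet $\mathcal{X}$, finite output alphabets, and is used memorylessly: $p(y_1^n,y_2^n,z^n|x^n)=\prod_i p(y_{1i},y_{2i},z_i|x_i)$. A $(2^{nR},n)$ code consists of a message $M$ uniformly distributed on $[1:2^{nR}]$, a stochastic encoder that generates $X^n$ according to a conditional pmf $p(x^n|m)$, and two decoders: decoder $j\in\{1,2\}$ maps $y_j^n$ to an estimate $\hat M_j$ (or an error). The error probability is $P_e^{(n)}=\mathbb{P}\{\hat M_1\ne M\text{ or }\hat M_2\ne M\}$. A rate $R$ is achievable if there is a sequence of $(2^{nR},n)$ codes with $P_e^{(n)}\to0$ and $\liminf_{n\to\infty}\frac1n H(M|Z^n)\ge R$. The secrecy capacity $C_{\rm S}$ is the supremum of achievable rates. *)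

theory Defs
  imports "HOL-Analysis.Analysis"
begin

text \<open>A joint pmf p on a finite sample space S (given as a real-valued function);
random variables are functions on the sample space. Logarithms are base 2.\<close>

definition marg :: "'s set \<Rightarrow> ('s \<Rightarrow> real) \<Rightarrow> ('s \<Rightarrow> 'b) \<Rightarrow> 's \<Rightarrow> real" where
  "marg S p f a = (\<Sum>b\<in>{b\<in>S. f b = f a}. p b)"

definition cmi :: "'s set \<Rightarrow> ('s \<Rightarrow> real) \<Rightarrow> ('s \<Rightarrow> 'f) \<Rightarrow> ('s \<Rightarrow> 'g) \<Rightarrow> ('s \<Rightarrow> 'h) \<Rightarrow> real" where
  "cmi S p f g h = (\<Sum>a\<in>S. p a * log 2
      (marg S p (\<lambda>b. (f b, g b, h b)) a * marg S p h a /
       (marg S p (\<lambda>b. (f b, h b)) a * marg S p (\<lambda>b. (g b, h b)) a)))"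

definition cent :: "'s set \<Rightarrow> ('s \<Rightarrow> real) \<Rightarrow> ('s \<Rightarrow> 'f) \<Rightarrow> ('s \<Rightarrow> 'g) \<Rightarrow> real" where
  "cent S p f g = - (\<Sum>a\<in>S. p a * log 2 (marg S p (\<lambda>b. (f b, g b)) a / marg S p g a))"

definition pmf_on :: "('a::finite \<Rightarrow> real) \<Rightarrow> bool" where
  "pmf_on p \<longleftrightarrow> (\<forall>a. 0 \<le> p a) \<and> (\<Sum>a\<in>UNIV. p a) = 1"

definition dmc :: "('x::finite \<Rightarrow> ('y1::finite \<times> 'y2::finite \<times> 'z::finite) \<Rightarrow> real) \<Rightarrow> bool" where
  "dmc W \<longleftrightarrow> (\<forall>x. pmf_on (W x))"

definition lists_n :: "nat \<Rightarrow> 'a list set" where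
  "lists_n n = {xs. length xs = n}"

definition num_msgs :: "nat \<Rightarrow> real \<Rightarrow> nat" where
  "num_msgs n R = nat \<lceil>2 powr (real n * R)\<rceil>"

definition msgs :: "nat \<Rightarrow> real \<Rightarrow> nat set" where
  "msgs n R = {1..num_msgs n R}"

definition is_encoder :: "nat \<Rightarrow> real \<Rightarrow> (nat \<Rightarrow> 'x list \<Rightarrow> real) \<Rightarrow> bool" where
  "is_encoder n R enc \<longleftrightarrow>
     (\<forall>m\<in>msgs n R. (\<forall>xs. 0 \<le> enc m xs) \<and> (\<Sum>xs\<in>lists_n n. enc m xs) = 1)"

definition code_space :: "nat \<Rightarrow> real \<Rightarrow>
    (nat \<times> 'x list \<times> 'y1 list \<times> 'y2 list \<times> 'z list) set" where
  "code_space n R = msgs n R \<times> lists_n n \<times> lists_n n \<times> lists_n n \<times> lists_n n"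

definition code_joint :: "('x \<Rightarrow> ('y1 \<times> 'y2 \<times> 'z) \<Rightarrow> real) \<Rightarrow> nat \<Rightarrow> real \<Rightarrow>
    (nat \<Rightarrow> 'x list \<Rightarrow> real) \<Rightarrow> (nat \<times> 'x list \<times> 'y1 list \<times> 'y2 list \<times> 'z list) \<Rightarrow> real" where
  "code_joint W n R enc = (\<lambda>(m, xs, ys1, ys2, zs).
     enc m xs / real (num_msgs n R) * (\<Prod>i<n. W (xs ! i) (ys1 ! i, ys2 ! i, zs ! i)))"

text \<open>Decoders return None for an error declaration.\<close>
definition err_prob :: "('x \<Rightarrow> ('y1 \<times> 'y2 \<times> 'z) \<Rightarrow> real) \<Rightarrow> nat \<Rightarrow> real \<Rightarrow>
    (nat \<Rightarrow> 'x list \<Rightarrow> real) \<Rightarrow> ('y1 list \<Rightarrow> nat option) \<Rightarrow> ('y2 list \<Rightarrow> nat option) \<Rightarrow> real" where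
  "err_prob W n R enc dec1 dec2 =
     (\<Sum>s\<in>code_space n R. code_joint W n R enc s *
        (case s of (m, xs, ys1, ys2, zs) \<Rightarrow>
           (if dec1 ys1 \<noteq> Some m \<or> dec2 ys2 \<noteq> Some m then 1 else 0)))"

definition equivocation :: "('x \<Rightarrow> ('y1 \<times> 'y2 \<times> 'z) \<Rightarrow> real) \<Rightarrow> nat \<Rightarrow> real \<Rightarrow>
    (nat \<Rightarrow> 'x list \<Rightarrow> real) \<Rightarrow> real" where
  "equivocation W n R enc =
     cent (code_space n R) (code_joint W n R enc)
          (\<lambda>(m, xs, ys1, ys2, zs). m) (\<lambda>(m, xs, ys1, ys2, zs). zs)"

definition achievable :: "('x::finite \<Rightarrow> ('y1::finite \<times> 'y2::finite \<times> 'z::finite) \<Rightarrow> real) \<Rightarrow> real \<Rightarrow> bool" where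
  "achievable W R \<longleftrightarrow>
     (\<exists>(enc :: nat \<Rightarrow> nat \<Rightarrow> 'x list \<Rightarrow> real)
       (dec1 :: nat \<Rightarrow> 'y1 list \<Rightarrow> nat option) (dec2 :: nat \<Rightarrow> 'y2 list \<Rightarrow> nat option).
        (\<forall>n. is_encoder n R (enc n)) \<and>
        (\<lambda>n. err_prob W n R (enc n) (dec1 n) (dec2 n)) \<longlonglongrightarrow> 0 \<and>
        ereal R \<le> liminf (\<lambda>n. ereal (equivocation W n R (enc n) / real n)))"

definition secrecy_capacity :: "('x::finite \<Rightarrow> ('y1::finite \<times> 'y2::finite \<times> 'z::finite) \<Rightarrow> real) \<Rightarrow> ereal" where
  "secrecy_capacity W = Sup (ereal ` {R. achievable W R})"

type_synonym ('q,'v0,'v1,'v2,'x,'y1,'y2,'z) aux_outcome =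
  "'q \<times> 'v0 \<times> 'v1 \<times> 'v2 \<times> 'x \<times> 'y1 \<times> 'y2 \<times> 'z"

definition aux_joint ::
  "('q \<times> 'v0 \<Rightarrow> real) \<Rightarrow> ('v0 \<Rightarrow> 'v1 \<times> 'v2 \<Rightarrow> real) \<Rightarrow> ('v1 \<times> 'v2 \<times> 'v0 \<Rightarrow> 'x \<Rightarrow> real) \<Rightarrow>
   ('x \<Rightarrow> ('y1 \<times> 'y2 \<times> 'z) \<Rightarrow> real) \<Rightarrow> ('q,'v0,'v1,'v2,'x,'y1,'y2,'z) aux_outcome \<Rightarrow> real" where
  "aux_joint pqv0 pv px W = (\<lambda>(q, v0, v1, v2, x, y1, y2, z).
     pqv0 (q, v0) * pv v0 (v1, v2) * px (v1, v2, v0) x * W x (y1, y2, z))"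

definition rvQ :: "('q,'v0,'v1,'v2,'x,'y1,'y2,'z) aux_outcome \<Rightarrow> 'q" where
  "rvQ = (\<lambda>(q, v0, v1, v2, x, y1, y2, z). q)"
definition rvV0 :: "('q,'v0,'v1,'v2,'x,'y1,'y2,'z) aux_outcome \<Rightarrow> 'v0" where
  "rvV0 = (\<lambda>(q, v0, v1, v2, x, y1, y2, z). v0)"
definition rvV1 :: "('q,'v0,'v1,'v2,'x,'y1,'y2,'z) aux_outcome \<Rightarrow> 'v1" where
  "rvV1 = (\<lambda>(q, v0, v1, v2, x, y1, y2, z). v1)"
definition rvV2 :: "('q,'v0,'v1,'v2,'x,'y1,'y2,'z) aux_outcome \<Rightarrow> 'v2" where
  "rvV2 = (\<lambda>(q, v0, v1, v2, x, y1, y2, z). v2)"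
definition rvY1 :: "('q,'v0,'v1,'v2,'x,'y1,'y2,'z) aux_outcome \<Rightarrow> 'y1" where
  "rvY1 = (\<lambda>(q, v0, v1, v2, x, y1, y2, z). y1)"
definition rvY2 :: "('q,'v0,'v1,'v2,'x,'y1,'y2,'z) aux_outcome \<Rightarrow> 'y2" where
  "rvY2 = (\<lambda>(q, v0, v1, v2, x, y1, y2, z). y2)"
definition rvZ :: "('q,'v0,'v1,'v2,'x,'y1,'y2,'z) aux_outcome \<Rightarrow> 'z" where
  "rvZ = (\<lambda>(q, v0, v1, v2, x, y1, y2, z). z)"

end

theory Submission
  imports Defs "HOL-Real_Asymp.Real_Asymp"
begin

text \<open>Fix a time-sharing sequence \<open>q\<^sup>n\<close>. A super-codeword consists of one \<open>v\<^sub>0\<^sup>n\<close> together with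
  \<open>2\<^bsup>nT\<^sub>1\<^esup>\<close> sequences \<open>v\<^sub>1\<^sup>n\<close> and \<open>2\<^bsup>nT\<^sub>2\<^esup>\<close> sequences \<open>v\<^sub>2\<^sup>n\<close>; each message owns \<open>2\<^bsup>nT\<^sub>0\<^esup>\<close>
  super-codewords. Instead of searching for a jointly typical pair, the encoder chooses \<open>(v\<^sub>1\<^sup>n, v\<^sub>2\<^sup>n)\<close>
  at random with probability proportional to \<open>p(v\<^sub>1,v\<^sub>2|v\<^sub>0) / (p(v\<^sub>1|v\<^sub>0) p(v\<^sub>2|v\<^sub>0))\<close>. If the codebook
  law is tilted by the normalising constant \<open>S\<close> of this choice, then the transmitted triple has exactly
  the joint law \<open>p(v\<^sub>0) p(v\<^sub>1,v\<^sub>2|v\<^sub>0)\<close> and all other sequences are independent of it given \<open>v\<^sub>0\<^sup>n\<close>,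
  so no mutual covering argument is needed.

  Receiver \<open>Y\<^sub>j\<close> decodes the message indirectly, through a threshold test on
  \<open>p(y\<^sub>j|v\<^sub>0,v\<^sub>j) / p(y\<^sub>j|q)\<close>. For secrecy, the divergence of \<open>p(z\<^sup>n|m)\<close> from \<open>p(z\<^sup>n|q\<^sup>n)\<close>
  is averaged over the codebook; Jensen's inequality replaces the interfering codewords by their means
  and leaves only the positive parts of four sums of independent variables, each of mean at most 0 when
  \<open>T\<^sub>0 = I(V\<^sub>0;Z|Q)\<close> and \<open>T\<^sub>j = I(V\<^sub>j;Z|V\<^sub>0)\<close>. For the sum that compares all three codebooks this is
  the hypothesis of the theorem. By the second moment bound the leakage is \<open>O(\<surd>n)\<close>.\<close>

section \<open>Product measures and soft covering\<close>

text \<open>A joint typicality encoder picks its pair as a function of the whole codebook, so the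
  interfering sequences would no longer be independent of the transmitted ones. The random choice
  has its own defect, the random denominator \<open>S\<close>. The factor \<open>S\<close> in the
  codebook law cancels it, and the error terms become linear in the pairs. Only the leakage still
  sees \<open>S\<close>, inside the logarithm, at the cost of a constant.

  The rates fit as follows. Receiver j can tell super-codewords apart if R + T_0 + T_j <
  I(V_0,V_j;Y_j|Q). Since T_0 + T_j = I(V_0,V_j;Z|Q), the room left for R is the difference in the
  theorem. The covering conditions may hold with equality, because the positive part of a centred
  sum has order sqrt n and the leakage is divided by n.

  Both error probabilities and 1/n times the leakage are added before a codebook or a time-sharing
  sequence is selected, so one selection serves all three terminals. The equivocation then follows
  from H(M|Z) \<ge> log |M| - average divergence.\<close>

definition is_pmf :: "'a set \<Rightarrow> ('a \<Rightarrow> real) \<Rightarrow> bool" where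
  "is_pmf A p \<longleftrightarrow> finite A \<and> (\<forall>a\<in>A. 0 \<le> p a) \<and> sum p A = 1"

lemma is_pmfD:
  assumes "is_pmf A p"
  shows "finite A" "\<And>a. a \<in> A \<Longrightarrow> 0 \<le> p a" "sum p A = 1"
  using assms by (auto simp: is_pmf_def)

definition iid :: "('a \<Rightarrow> real) \<Rightarrow> 'i set \<Rightarrow> ('i \<Rightarrow> 'a) \<Rightarrow> real" where
  "iid p I f = (\<Prod>i\<in>I. p (f i))"

lemma is_pmf_iid:
  assumes "is_pmf A p" "finite I"
  shows "is_pmf (I \<rightarrow>\<^sub>E A) (iid p I)"
proof -
  note p = is_pmfD[OF assms(1)]
  have "(\<Sum>f\<in>I \<rightarrow>\<^sub>E A. iid p I f) = (\<Prod>i\<in>I. \<Sum>a\<in>A. p a)"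
    unfolding iid_def using assms p by (subst prod_sum_PiE) auto
  then show ?thesis
    using p assms by (auto simp: is_pmf_def iid_def finite_PiE intro!: prod_nonneg)
qed

text \<open>Used to condition on the transmitted codeword: the draw at \<open>j\<close> is separated
  from the others, which keep their product law.\<close>

lemma sum_iid_coord:
  fixes p :: "'a \<Rightarrow> real"
  assumes "finite I" "finite A" "j \<in> I"
  shows "(\<Sum>f\<in>I \<rightarrow>\<^sub>E A. iid p I f * F f)
    = (\<Sum>a\<in>A. p a * (\<Sum>g\<in>(I - {j}) \<rightarrow>\<^sub>E A. iid p (I - {j}) g * F (g(j := a))))"
proof -
  let ?J = "I - {j}"
  have I: "I = insert j ?J" using assms by auto
  have iid: "iid p I (g(j := a)) = p a * iid p ?J g" for g a
    using assms by (auto simp: iid_def prod.remove[of I j] intro!: prod.cong)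
  have "(\<Sum>f\<in>I \<rightarrow>\<^sub>E A. iid p I f * F f)
    = (\<Sum>f\<in>(\<lambda>(y, g). g(j := y)) ` (A \<times> (?J \<rightarrow>\<^sub>E A)). iid p I f * F f)"
    by (subst I, subst PiE_insert_eq) simp
  also have "\<dots> = (\<Sum>(a, g)\<in>A \<times> (?J \<rightarrow>\<^sub>E A). iid p I (g(j := a)) * F (g(j := a)))"
    using inj_combinator[of j ?J "\<lambda>_. A"] by (subst sum.reindex) (auto simp: case_prod_unfold)
  also have "\<dots> = (\<Sum>a\<in>A. \<Sum>g\<in>?J \<rightarrow>\<^sub>E A. iid p I (g(j := a)) * F (g(j := a)))"
    by (simp add: sum.cartesian_product)
  finally show ?thesis
    by (simp add: iid sum_distrib_left mult.assoc)
qed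

lemma sum_iid_marginal:
  fixes p :: "'a \<Rightarrow> real"
  assumes "is_pmf A p" "finite I" "j \<in> I"
  shows "(\<Sum>f\<in>I \<rightarrow>\<^sub>E A. iid p I f * h (f j)) = (\<Sum>a\<in>A. p a * h a)"
proof -
  have "(\<Sum>g\<in>(I - {j}) \<rightarrow>\<^sub>E A. iid p (I - {j}) g) = 1"
    using is_pmf_iid[OF assms(1), of "I - {j}"] assms by (auto simp: is_pmf_def)
  then show ?thesis
    using assms by (subst sum_iid_coord[of _ _ j])
      (auto simp: is_pmf_def simp flip: sum_distrib_right)
qed

text \<open>The tangent of the logarithm at the mean \<open>m\<close> lies above its graph (ln t
  \<le> t - 1 at t = \<open>x a / m\<close>), and averaging the tangent with the weights
  \<open>w\<close> leaves \<open>log 2 m\<close>.\<close>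

lemma jensen_log:
  assumes w: "is_pmf A w" and x: "\<And>a. a \<in> A \<Longrightarrow> 0 < x a"
  shows "(\<Sum>a\<in>A. w a * log 2 (x a)) \<le> log 2 (\<Sum>a\<in>A. w a * x a)"
proof -
  note p = is_pmfD[OF w]
  define m where "m = (\<Sum>a\<in>A. w a * x a)"
  have "m \<noteq> 0"
  proof
    assume "m = 0"
    then have "\<forall>a\<in>A. w a * x a = 0"
      unfolding m_def using p x by (subst (asm) sum_nonneg_eq_0_iff) (auto simp: less_imp_le)
    then have "\<forall>a\<in>A. w a = 0" using x by fastforce
    then show False using p by simp
  qed
  moreover have "m \<ge> 0" unfolding m_def using p x by (intro sum_nonneg) (auto simp: less_imp_le)
  ultimately have m: "m > 0" by simp
  have "(\<Sum>a\<in>A. w a * log 2 (x a)) \<le> (\<Sum>a\<in>A. w a * (log 2 m + (x a / m - 1) / ln 2))"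
  proof (intro sum_mono mult_left_mono p)
    fix a assume "a \<in> A"
    then have "ln (x a / m) \<le> x a / m - 1" using x m by (intro ln_le_minus_one) auto
    moreover have "ln (x a / m) = ln (x a) - ln m" using x[OF \<open>a \<in> A\<close>] m by (simp add: ln_div)
    ultimately have "ln (x a) \<le> ln m + (x a / m - 1)" by simp
    then have "ln (x a) / ln 2 \<le> (ln m + (x a / m - 1)) / ln 2"
      by (intro divide_right_mono) auto
    then show "log 2 (x a) \<le> log 2 m + (x a / m - 1) / ln 2"
      by (simp add: log_def add_divide_distrib)
  qed
  also have "\<dots> = (log 2 m - 1 / ln 2) * (\<Sum>a\<in>A. w a) + (\<Sum>a\<in>A. w a * x a) / m / ln 2"
    unfolding sum_distrib_left sum_divide_distrib sum.distrib[symmetric]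
    by (intro sum.cong) (auto simp: algebra_simps diff_divide_distrib)
  also have "\<dots> = log 2 m" using p m by (simp flip: m_def)
  finally show ?thesis by (simp add: m_def)
qed

text \<open>Gibbs' inequality, from ln t \<le> t - 1 at t = \<open>q a / p a\<close>. Allowing
  \<open>q\<close> to have mass below 1 admits reference functions of the form
  \<open>P s * (v s / u s)\<close>. Positivity of \<open>q\<close> on the support of
  \<open>p\<close> excludes terms in which the convention for division by 0 would distort the
  sum.\<close>

lemma divergence_nonneg:
  assumes p: "is_pmf A p" and q: "\<And>a. a \<in> A \<Longrightarrow> 0 \<le> q a" "sum q A \<le> 1"
    and pos: "\<And>a. a \<in> A \<Longrightarrow> 0 < p a \<Longrightarrow> 0 < q a"
  shows "0 \<le> (\<Sum>a\<in>A. p a * log 2 (p a / q a))"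
proof -
  note p = is_pmfD[OF p]
  have "(\<Sum>a\<in>A. (p a - q a) / ln 2) \<le> (\<Sum>a\<in>A. p a * log 2 (p a / q a))"
  proof (intro sum_mono)
    fix a assume a: "a \<in> A"
    show "(p a - q a) / ln 2 \<le> p a * log 2 (p a / q a)"
    proof (cases "p a = 0")
      case True then show ?thesis using q a by simp
    next
      case False
      then have pa: "p a > 0" "q a > 0" using p pos a by (auto simp: order.strict_iff_order)
      then have "ln (q a / p a) \<le> q a / p a - 1" by (intro ln_le_minus_one) auto
      then have "p a * (1 - q a / p a) \<le> p a * ln (p a / q a)"
        using pa by (intro mult_left_mono) (auto simp: ln_div)
      moreover have "p a * (1 - q a / p a) = p a - q a" using pa by (simp add: field_simps)
      ultimately have "p a - q a \<le> p a * ln (p a / q a)" by simp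
      then have "(p a - q a) / ln 2 \<le> p a * ln (p a / q a) / ln 2"
        by (intro divide_right_mono) auto
      then show ?thesis by (simp add: log_def)
    qed
  qed
  moreover have "(\<Sum>a\<in>A. (p a - q a) / ln 2) \<ge> 0"
    using p q by (simp add: sum_divide_distrib[symmetric] sum_subtractf)
  ultimately show ?thesis by linarith
qed

text \<open>Besides meeting the bound, the chosen point has positive weight. For a codebook this
  means that each of its codewords has positive probability, so its output laws are dominated by the
  mean output law.\<close>

lemma is_pmf_le_average:
  assumes p: "is_pmf A p" and F: "(\<Sum>a\<in>A. p a * F a) \<le> B"
  obtains a where "a \<in> A" "0 < p a" "F a \<le> B"
proof -
  note p = is_pmfD[OF p]
  have "\<exists>a\<in>A. 0 < p a \<and> F a \<le> B"
  proof (rule ccontr)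
    assume neg: "\<not> ?thesis"
    obtain b where b: "b \<in> A" "p b > 0"
      using p by (metis less_eq_real_def sum.neutral zero_neq_one)
    have "(\<Sum>a\<in>A. p a * B) < (\<Sum>a\<in>A. p a * F a)"
    proof (rule sum_strict_mono_ex1)
      show "\<forall>a\<in>A. p a * B \<le> p a * F a"
        using neg p by (metis less_eq_real_def linorder_not_le mult_eq_0_iff mult_left_mono)
      show "\<exists>a\<in>A. p a * B < p a * F a"
        using neg b by (intro bexI[of _ b]) auto
    qed (use p in auto)
    then show False using F p by (simp flip: sum_distrib_right)
  qed
  then show thesis using that by blast
qed

text \<open>\<open>J\<close> is the bin of one message and \<open>P C\<close> the output law of a
  uniform choice from it. Given the codeword at \<open>j\<close>, the logarithm is concave in the
  contribution of the other codewords, so Jensen's inequality replaces each of them by its mean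
  \<open>Q\<close>. This leaves \<open>(k + (card J - 1) * Q) / (card J * Q)\<close>, which is at
  most 1 plus the term of the codeword itself.\<close>

lemma soft_covering:
  fixes \<mu> :: "'c \<Rightarrow> real" and k :: "'c \<Rightarrow> 'z \<Rightarrow> real" and Q :: "'z \<Rightarrow> real" and P :: "('i \<Rightarrow> 'c) \<Rightarrow> 'z \<Rightarrow> real"
  assumes mu: "is_pmf \<Gamma> \<mu>" and I: "finite I" and J: "J \<subseteq> I" "J \<noteq> {}" and Z: "finite Z"
    and k: "\<And>c z. c \<in> \<Gamma> \<Longrightarrow> z \<in> Z \<Longrightarrow> 0 \<le> k c z"
  defines "Q \<equiv> \<lambda>z. \<Sum>c\<in>\<Gamma>. \<mu> c * k c z"
    and "P \<equiv> \<lambda>C z. (\<Sum>j\<in>J. k (C j) z) / card J"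
  shows "(\<Sum>C\<in>I \<rightarrow>\<^sub>E \<Gamma>. iid \<mu> I C * (\<Sum>z\<in>Z. P C z * log 2 (P C z / Q z)))
    \<le> (\<Sum>c\<in>\<Gamma>. \<mu> c * (\<Sum>z\<in>Z. k c z * log 2 (1 + k c z / (card J * Q z))))"
proof -
  note m = is_pmfD[OF mu]
  have fJ: "finite J" using I J finite_subset by auto
  let ?K = "real (card J)"
  have K: "?K > 0" using J fJ by (simp add: card_gt_0_iff)
  have key: "(\<Sum>C\<in>I \<rightarrow>\<^sub>E \<Gamma>. iid \<mu> I C * (k (C j) z * log 2 (P C z / Q z)))
      \<le> (\<Sum>c\<in>\<Gamma>. \<mu> c * (k c z * log 2 (1 + k c z / (?K * Q z))))"
    if j: "j \<in> J" and z: "z \<in> Z" for j z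
  proof -
    let ?I = "I - {j}"
    have pI: "is_pmf (?I \<rightarrow>\<^sub>E \<Gamma>) (iid \<mu> ?I)" using mu I by (intro is_pmf_iid) auto
    have "(\<Sum>C\<in>I \<rightarrow>\<^sub>E \<Gamma>. iid \<mu> I C * (k (C j) z * log 2 (P C z / Q z)))
      = (\<Sum>a\<in>\<Gamma>. \<mu> a * (\<Sum>g\<in>?I \<rightarrow>\<^sub>E \<Gamma>. iid \<mu> ?I g *
           (k a z * log 2 (P (g(j := a)) z / Q z))))"
      using I m j J by (subst sum_iid_coord[of _ _ j]) auto
    also have "\<dots> \<le> (\<Sum>c\<in>\<Gamma>. \<mu> c * (k c z * log 2 (1 + k c z / (?K * Q z))))"
    proof (intro sum_mono)
      fix a assume a: "a \<in> \<Gamma>"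
      show "\<mu> a * (\<Sum>g\<in>?I \<rightarrow>\<^sub>E \<Gamma>. iid \<mu> ?I g * (k a z * log 2 (P (g(j := a)) z / Q z)))
        \<le> \<mu> a * (k a z * log 2 (1 + k a z / (?K * Q z)))"
      proof (cases "\<mu> a * k a z = 0")
        case True
        then show ?thesis by (auto simp: sum_distrib_left)
      next
        case False
        then have ma: "\<mu> a > 0" "k a z > 0" using m k a z by (auto simp: order.strict_iff_order)
        have "\<mu> a * k a z \<le> Q z" unfolding Q_def
          using m k z a by (intro member_le_sum[of a]) auto
        then have Qz: "Q z > 0" using ma by (meson mult_pos_pos order_less_le_trans)
        have P: "P (g(j := a)) z / Q z = (k a z + (\<Sum>i\<in>J - {j}. k (g i) z)) / (?K * Q z)" for g
          unfolding P_def using j fJ by (simp add: sum.remove[of J j])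
        have "(\<Sum>g\<in>?I \<rightarrow>\<^sub>E \<Gamma>. iid \<mu> ?I g * log 2 (P (g(j := a)) z / Q z))
          \<le> log 2 (\<Sum>g\<in>?I \<rightarrow>\<^sub>E \<Gamma>. iid \<mu> ?I g * (P (g(j := a)) z / Q z))"
        proof (intro jensen_log pI)
          fix g assume g: "g \<in> ?I \<rightarrow>\<^sub>E \<Gamma>"
          then have "g i \<in> \<Gamma>" if "i \<in> J - {j}" for i using that J by auto
          then have "(\<Sum>i\<in>J - {j}. k (g i) z) \<ge> 0" using k z by (intro sum_nonneg) auto
          then show "0 < P (g(j := a)) z / Q z" unfolding P using ma K Qz by auto
        qed
        also have "(\<Sum>g\<in>?I \<rightarrow>\<^sub>E \<Gamma>. iid \<mu> ?I g * (P (g(j := a)) z / Q z))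
          = (k a z + (\<Sum>i\<in>J - {j}. \<Sum>g\<in>?I \<rightarrow>\<^sub>E \<Gamma>. iid \<mu> ?I g * k (g i) z)) / (?K * Q z)"
        proof -
          have "(\<Sum>i\<in>J - {j}. \<Sum>g\<in>?I \<rightarrow>\<^sub>E \<Gamma>. iid \<mu> ?I g * k (g i) z)
            = (\<Sum>g\<in>?I \<rightarrow>\<^sub>E \<Gamma>. \<Sum>i\<in>J - {j}. iid \<mu> ?I g * k (g i) z)"
            by (rule sum.swap)
          moreover have "k a z = (\<Sum>g\<in>?I \<rightarrow>\<^sub>E \<Gamma>. iid \<mu> ?I g * k a z)"
            using is_pmfD[OF pI] by (simp flip: sum_distrib_right)
          ultimately show ?thesis unfolding P
            by (simp add: sum_divide_distrib[symmetric] sum_distrib_left distrib_left sum.distrib)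
        qed
        also have "\<dots> = (k a z + (?K - 1) * Q z) / (?K * Q z)"
        proof -
          have "(\<Sum>g\<in>?I \<rightarrow>\<^sub>E \<Gamma>. iid \<mu> ?I g * k (g i) z) = Q z" if "i \<in> J - {j}" for i
            using that J I unfolding Q_def
            by (intro sum_iid_marginal[OF mu, where h = "\<lambda>c. k c z"]) auto
          then show ?thesis using j fJ K by (simp add: of_nat_diff Suc_le_eq card_gt_0_iff J)
        qed
        also have "log 2 \<dots> \<le> log 2 (1 + k a z / (?K * Q z))"
        proof -
          have K1: "?K - 1 \<ge> 0" using K by (simp add: Suc_le_eq)
          have "0 < k a z + (?K - 1) * Q z"
            using ma(2) K1 Qz by (intro add_pos_nonneg mult_nonneg_nonneg) auto
          moreover have "(k a z + (?K - 1) * Q z) / (?K * Q z) \<le> 1 + k a z / (?K * Q z)"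
            using K Qz by (simp add: field_simps)
          ultimately show ?thesis using K Qz by (subst log_le_cancel_iff) (auto simp: add_pos_nonneg ma(2) less_imp_le)
        qed
        finally have "(\<Sum>g\<in>?I \<rightarrow>\<^sub>E \<Gamma>. iid \<mu> ?I g * log 2 (P (g(j := a)) z / Q z))
          \<le> log 2 (1 + k a z / (?K * Q z))" by (simp only: fun_upd_def)
        then have "k a z * (\<Sum>g\<in>?I \<rightarrow>\<^sub>E \<Gamma>. iid \<mu> ?I g * log 2 (P (g(j := a)) z / Q z))
          \<le> k a z * log 2 (1 + k a z / (?K * Q z))" using ma by (intro mult_left_mono) auto
        then have "(\<Sum>g\<in>?I \<rightarrow>\<^sub>E \<Gamma>. iid \<mu> ?I g * (k a z * log 2 (P (g(j := a)) z / Q z)))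
          \<le> k a z * log 2 (1 + k a z / (?K * Q z))"
          by (simp add: sum_distrib_left mult.left_commute)
        then show ?thesis using ma by (intro mult_left_mono) auto
      qed
    qed
    finally show ?thesis .
  qed
  have "(\<Sum>C\<in>I \<rightarrow>\<^sub>E \<Gamma>. iid \<mu> I C * (\<Sum>z\<in>Z. P C z * log 2 (P C z / Q z)))
    = (\<Sum>C\<in>I \<rightarrow>\<^sub>E \<Gamma>. \<Sum>z\<in>Z. \<Sum>j\<in>J. iid \<mu> I C * (k (C j) z * log 2 (P C z / Q z)) / ?K)"
    by (subst (1) P_def) (simp add: sum_distrib_left sum_distrib_right sum_divide_distrib)
  also have "\<dots> = (\<Sum>z\<in>Z. \<Sum>j\<in>J. (\<Sum>C\<in>I \<rightarrow>\<^sub>E \<Gamma>. iid \<mu> I C * (k (C j) z * log 2 (P C z / Q z))) / ?K)"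
    unfolding sum_divide_distrib by (subst sum.swap, rule sum.cong, rule refl, rule sum.swap)
  also have "\<dots> \<le> (\<Sum>z\<in>Z. \<Sum>j\<in>J. (\<Sum>c\<in>\<Gamma>. \<mu> c * (k c z * log 2 (1 + k c z / (?K * Q z)))) / ?K)"
    using K by (intro sum_mono divide_right_mono key) auto
  also have "\<dots> = (\<Sum>z\<in>Z. (\<Sum>c\<in>\<Gamma>. \<mu> c * (k c z * log 2 (1 + k c z / (?K * Q z)))))"
    using K by simp
  also have "\<dots> = (\<Sum>c\<in>\<Gamma>. \<mu> c * (\<Sum>z\<in>Z. k c z * log 2 (1 + k c z / (?K * Q z))))"
    unfolding sum_distrib_left by (rule sum.swap)
  finally show ?thesis .
qed

text \<open>Union bound: a wrong codeword is independent of the transmitted one, hence of the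
  output, whose law is then \<open>Q\<close>. The factor \<open>card I\<close> rounds up the number
  \<open>card I - 1\<close> of wrong codewords.\<close>

lemma packing:
  fixes \<mu> :: "'c \<Rightarrow> real" and k :: "'c \<Rightarrow> 'y \<Rightarrow> real" and Q :: "'y \<Rightarrow> real"
  assumes mu: "is_pmf \<Gamma> \<mu>" and I: "finite I" "j \<in> I" and Y: "finite Y"
    and k: "\<And>c y. c \<in> \<Gamma> \<Longrightarrow> y \<in> Y \<Longrightarrow> 0 \<le> k c y"
  defines "Q \<equiv> \<lambda>y. \<Sum>c\<in>\<Gamma>. \<mu> c * k c y"
  shows "(\<Sum>C\<in>I \<rightarrow>\<^sub>E \<Gamma>. iid \<mu> I C * (\<Sum>y\<in>Y. k (C j) y *
      of_bool (\<not> T (C j) y \<or> (\<exists>i\<in>I - {j}. T (C i) y))))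
    \<le> (\<Sum>c\<in>\<Gamma>. \<mu> c * (\<Sum>y\<in>Y. k c y * of_bool (\<not> T c y)))
      + card I * (\<Sum>y\<in>Y. Q y * (\<Sum>c\<in>\<Gamma>. \<mu> c * of_bool (T c y)))"
proof -
  note m = is_pmfD[OF mu]
  let ?I = "I - {j}"
  have pI: "is_pmf (?I \<rightarrow>\<^sub>E \<Gamma>) (iid \<mu> ?I)" using mu I by (intro is_pmf_iid) auto
  have wI: "iid \<mu> I C \<ge> 0" if "C \<in> I \<rightarrow>\<^sub>E \<Gamma>" for C
    using is_pmfD(2)[OF is_pmf_iid[OF mu I(1)] that] .
  have pair: "(\<Sum>C\<in>I \<rightarrow>\<^sub>E \<Gamma>. iid \<mu> I C * (k (C j) y * of_bool (T (C i) y)))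
    = Q y * (\<Sum>c\<in>\<Gamma>. \<mu> c * of_bool (T c y))" if "i \<in> ?I" for i y
  proof -
    have "(\<Sum>C\<in>I \<rightarrow>\<^sub>E \<Gamma>. iid \<mu> I C * (k (C j) y * of_bool (T (C i) y)))
      = (\<Sum>a\<in>\<Gamma>. \<mu> a * (\<Sum>g\<in>?I \<rightarrow>\<^sub>E \<Gamma>. iid \<mu> ?I g * (k a y * of_bool (T (g i) y))))"
      using I m that by (subst sum_iid_coord[of _ _ j]) auto
    also have "\<dots> = (\<Sum>a\<in>\<Gamma>. \<mu> a * (\<Sum>c\<in>\<Gamma>. \<mu> c * (k a y * of_bool (T c y))))"
      using I that
      by (subst sum_iid_marginal[OF mu, where h = "\<lambda>c. k _ y * of_bool (T c y)"]) auto
    also have "\<dots> = (\<Sum>c\<in>\<Gamma>. \<Sum>a\<in>\<Gamma>. \<mu> a * (\<mu> c * (k a y * of_bool (T c y))))"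
      unfolding sum_distrib_left by (rule sum.swap)
    finally show ?thesis unfolding Q_def
      by (simp add: sum_distrib_left sum_distrib_right ac_simps)
  qed
  have "(\<Sum>C\<in>I \<rightarrow>\<^sub>E \<Gamma>. iid \<mu> I C * (\<Sum>y\<in>Y. k (C j) y *
      of_bool (\<not> T (C j) y \<or> (\<exists>i\<in>I - {j}. T (C i) y))))
    \<le> (\<Sum>C\<in>I \<rightarrow>\<^sub>E \<Gamma>. iid \<mu> I C * (\<Sum>y\<in>Y. k (C j) y *
      (of_bool (\<not> T (C j) y) + (\<Sum>i\<in>?I. of_bool (T (C i) y)))))"
  proof (intro sum_mono mult_left_mono wI)
    fix C y assume C: "C \<in> I \<rightarrow>\<^sub>E \<Gamma>" and y: "y \<in> Y"
    show "0 \<le> k (C j) y" using C y I k by (auto simp: PiE_iff)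
    show "of_bool (\<not> T (C j) y \<or> (\<exists>i\<in>?I. T (C i) y))
      \<le> of_bool (\<not> T (C j) y) + (\<Sum>i\<in>?I. of_bool (T (C i) y) :: real)"
    proof (cases "\<exists>i\<in>?I. T (C i) y")
      case True
      then obtain i where i: "i \<in> ?I" "T (C i) y" by auto
      then have "(of_bool (T (C i) y) :: real) \<le> (\<Sum>i\<in>?I. of_bool (T (C i) y))"
        using I by (intro member_le_sum[of i ?I "\<lambda>i. of_bool (T (C i) y)"]) auto
      then show ?thesis using i by (auto simp: of_bool_def)
    next
      case False
      then show ?thesis by (auto intro!: sum_nonneg)
    qed
  qed
  also have "\<dots> = (\<Sum>C\<in>I \<rightarrow>\<^sub>E \<Gamma>. iid \<mu> I C * (\<Sum>y\<in>Y. k (C j) y * of_bool (\<not> T (C j) y)))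
    + (\<Sum>C\<in>I \<rightarrow>\<^sub>E \<Gamma>. \<Sum>y\<in>Y. \<Sum>i\<in>?I. iid \<mu> I C * (k (C j) y * of_bool (T (C i) y)))"
    by (simp add: distrib_left sum.distrib sum_distrib_left)
  also have "(\<Sum>C\<in>I \<rightarrow>\<^sub>E \<Gamma>. iid \<mu> I C * (\<Sum>y\<in>Y. k (C j) y * of_bool (\<not> T (C j) y)))
    = (\<Sum>c\<in>\<Gamma>. \<mu> c * (\<Sum>y\<in>Y. k c y * of_bool (\<not> T c y)))"
    using I by (intro sum_iid_marginal[OF mu, where h = "\<lambda>c. \<Sum>y\<in>Y. k c y * of_bool (\<not> T c y)"])
  also have "(\<Sum>C\<in>I \<rightarrow>\<^sub>E \<Gamma>. \<Sum>y\<in>Y. \<Sum>i\<in>?I. iid \<mu> I C * (k (C j) y * of_bool (T (C i) y)))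
    = (\<Sum>y\<in>Y. \<Sum>i\<in>?I. \<Sum>C\<in>I \<rightarrow>\<^sub>E \<Gamma>. iid \<mu> I C * (k (C j) y * of_bool (T (C i) y)))"
    by (subst sum.swap, rule sum.cong, rule refl, rule sum.swap)
  also have "\<dots> = card ?I * (\<Sum>y\<in>Y. Q y * (\<Sum>c\<in>\<Gamma>. \<mu> c * of_bool (T c y)))"
    by (simp add: pair sum_distrib_left)
  also have "\<dots> \<le> card I * (\<Sum>y\<in>Y. Q y * (\<Sum>c\<in>\<Gamma>. \<mu> c * of_bool (T c y)))"
  proof (intro mult_right_mono)
    show "0 \<le> (\<Sum>y\<in>Y. Q y * (\<Sum>c\<in>\<Gamma>. \<mu> c * of_bool (T c y)))"
      using m k unfolding Q_def by (intro sum_nonneg mult_nonneg_nonneg) auto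
    show "real (card ?I) \<le> card I" using I by (simp add: card_mono)
  qed
  finally show ?thesis by simp
qed

section \<open>Random codes\<close>

definition through :: "'x set \<Rightarrow> ('c \<Rightarrow> 'x \<Rightarrow> real) \<Rightarrow> ('x \<Rightarrow> 'y \<Rightarrow> real) \<Rightarrow> 'c \<Rightarrow> 'y \<Rightarrow> real" where
  "through X e U c y = (\<Sum>x\<in>X. e c x * U x y)"

lemma is_pmf_through:
  assumes e: "is_pmf X (e c)" and U: "\<And>x. x \<in> X \<Longrightarrow> is_pmf Y (U x)"
  shows "is_pmf Y (through X e U c)"
proof -
  have "X \<noteq> {}" using e by (auto simp: is_pmf_def)
  then have "finite Y" using U is_pmfD(1) by blast
  moreover have "(\<Sum>y\<in>Y. \<Sum>x\<in>X. e c x * U x y) = (\<Sum>x\<in>X. e c x * (\<Sum>y\<in>Y. U x y))"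
    unfolding sum_distrib_left by (rule sum.swap)
  ultimately show ?thesis
    using is_pmfD[OF e] is_pmfD[OF U]
    by (auto simp: is_pmf_def through_def intro!: sum_nonneg)
qed

definition avg_error ::
  "'m set \<Rightarrow> 'y set \<Rightarrow> ('m \<Rightarrow> 'y \<Rightarrow> real) \<Rightarrow> ('y \<Rightarrow> 'm option) \<Rightarrow> real" where
  "avg_error Ms Y P dec = (\<Sum>m\<in>Ms. \<Sum>y\<in>Y. P m y * of_bool (dec y \<noteq> Some m)) / card Ms"

definition avg_div :: "'m set \<Rightarrow> 'z set \<Rightarrow> ('m \<Rightarrow> 'z \<Rightarrow> real) \<Rightarrow> ('z \<Rightarrow> real) \<Rightarrow> real" where
  "avg_div Ms Z P Q = (\<Sum>m\<in>Ms. \<Sum>z\<in>Z. P m z * log 2 (P m z / Q z)) / card Ms"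

text \<open>The uniform choice within the bin of \<open>m\<close> is the local randomness that hides
  the message from the eavesdropper.\<close>

definition bin_enc :: "'l set \<Rightarrow> ('c \<Rightarrow> 'x \<Rightarrow> real) \<Rightarrow> ('m \<times> 'l \<Rightarrow> 'c) \<Rightarrow> 'm \<Rightarrow> 'x \<Rightarrow> real" where
  "bin_enc L e C m x = (\<Sum>l\<in>L. e (C (m, l)) x) / card L"

text \<open>Only the message has to be unique; several codewords of one bin may pass the
  test.\<close>

definition unique_dec :: "'m set \<Rightarrow> 'l set \<Rightarrow> ('c \<Rightarrow> 'y \<Rightarrow> bool) \<Rightarrow> ('m \<times> 'l \<Rightarrow> 'c) \<Rightarrow> 'y \<Rightarrow> 'm option" where
  "unique_dec Ms L T C y =
    (if \<exists>!m. m \<in> Ms \<and> (\<exists>l\<in>L. T (C (m, l)) y)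
     then Some (THE m. m \<in> Ms \<and> (\<exists>l\<in>L. T (C (m, l)) y)) else None)"

text \<open>Deliberately coarse: a second passing codeword in the bin of \<open>m\<close> is charged
  as well. In exchange all indices other than \<open>(m, l)\<close> play the same role, as in the
  packing bound.\<close>

lemma unique_dec_wrong:
  assumes "m \<in> Ms" "l \<in> L" "unique_dec Ms L T C y \<noteq> Some m"
  shows "\<not> T (C (m, l)) y \<or> (\<exists>i\<in>Ms \<times> L - {(m, l)}. T (C i) y)"
proof (rule ccontr)
  assume neg: "\<not> ?thesis"
  let ?R = "\<lambda>m. m \<in> Ms \<and> (\<exists>l\<in>L. T (C (m, l)) y)"
  have R: "?R m" using neg assms by auto
  moreover have "m' = m" if "?R m'" for m' using that neg by blast
  ultimately have "\<exists>!m. ?R m" "(THE m. ?R m) = m" by (blast, blast intro: the_equality)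
  then show False using assms(3) by (simp add: unique_dec_def)
qed

lemma through_bin_enc:
  "through X (bin_enc L e C) U m y = (\<Sum>l\<in>L. through X e U (C (m, l)) y) / card L"
  unfolding through_def bin_enc_def
  by (subst sum.swap) (simp add: sum_distrib_right sum_divide_distrib)

lemma is_pmf_bin_enc:
  assumes "finite L" "L \<noteq> {}" "finite X" "\<And>l. l \<in> L \<Longrightarrow> is_pmf X (e (C (m, l)))"
  shows "is_pmf X (bin_enc L e C m)"
proof -
  have "(\<Sum>x\<in>X. bin_enc L e C m x) = (\<Sum>l\<in>L. \<Sum>x\<in>X. e (C (m, l)) x) / card L"
    unfolding bin_enc_def sum_divide_distrib[symmetric] by (subst sum.swap) simp
  then show ?thesis using assms is_pmfD[OF assms(4)]
    by (auto simp: is_pmf_def bin_enc_def intro!: sum_nonneg divide_nonneg_nonneg)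
qed

definition miss :: "'c set \<Rightarrow> ('c \<Rightarrow> real) \<Rightarrow> 'y set \<Rightarrow> ('c \<Rightarrow> 'y \<Rightarrow> real) \<Rightarrow> ('c \<Rightarrow> 'y \<Rightarrow> bool) \<Rightarrow> real" where
  "miss \<Gamma> \<mu> Y k T = (\<Sum>c\<in>\<Gamma>. \<mu> c * (\<Sum>y\<in>Y. k c y * of_bool (\<not> T c y)))"

text \<open>The two separate averages over \<open>\<Gamma>\<close> express that the tested codeword
  is independent of the one that produced \<open>y\<close>.\<close>

definition false_alarm :: "'c set \<Rightarrow> ('c \<Rightarrow> real) \<Rightarrow> 'y set \<Rightarrow> ('c \<Rightarrow> 'y \<Rightarrow> real) \<Rightarrow> ('c \<Rightarrow> 'y \<Rightarrow> bool) \<Rightarrow> real" where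
  "false_alarm \<Gamma> \<mu> Y k T =
    (\<Sum>y\<in>Y. (\<Sum>c\<in>\<Gamma>. \<mu> c * k c y) * (\<Sum>c\<in>\<Gamma>. \<mu> c * of_bool (T c y)))"

definition cover :: "'c set \<Rightarrow> ('c \<Rightarrow> real) \<Rightarrow> 'z set \<Rightarrow> ('c \<Rightarrow> 'z \<Rightarrow> real) \<Rightarrow> real \<Rightarrow> real" where
  "cover \<Gamma> \<mu> Z k K = (\<Sum>c\<in>\<Gamma>. \<mu> c * (\<Sum>z\<in>Z. k c z *
     log 2 (1 + k c z / (K * (\<Sum>c\<in>\<Gamma>. \<mu> c * k c z)))))"

text \<open>The packing bound is the same for every transmitted index, so averaging over messages
  and bin positions leaves it unchanged.\<close>

lemma expected_error:
  fixes \<mu> :: "'c \<Rightarrow> real" and U :: "'x \<Rightarrow> 'y \<Rightarrow> real"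
  assumes mu: "is_pmf \<Gamma> \<mu>" and M: "finite Ms" "Ms \<noteq> {}" and L: "finite L" "L \<noteq> {}"
    and e: "\<And>c. c \<in> \<Gamma> \<Longrightarrow> is_pmf X (e c)" and U: "\<And>x. x \<in> X \<Longrightarrow> is_pmf Y (U x)"
    and Y: "finite Y"
  shows "(\<Sum>C\<in>(Ms \<times> L) \<rightarrow>\<^sub>E \<Gamma>. iid \<mu> (Ms \<times> L) C *
      avg_error Ms Y (through X (bin_enc L e C) U) (unique_dec Ms L T C))
    \<le> miss \<Gamma> \<mu> Y (through X e U) T
      + real (card Ms * card L) * false_alarm \<Gamma> \<mu> Y (through X e U) T" (is "?l \<le> ?B")
proof -
  let ?I = "Ms \<times> L" and ?k = "through X e U"
  let ?d = "\<lambda>C y m. of_bool (unique_dec Ms L T C y \<noteq> Some m) :: real"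
  have I: "finite ?I" using M L by auto
  have wI: "iid \<mu> ?I C \<ge> 0" if "C \<in> ?I \<rightarrow>\<^sub>E \<Gamma>" for C
    using is_pmfD(2)[OF is_pmf_iid[OF mu I] that] .
  have k: "0 \<le> ?k c y" if "c \<in> \<Gamma>" "y \<in> Y" for c y
    using is_pmf_through[of X e c Y U] e U that is_pmfD(2) by metis
  have "?l = (\<Sum>C\<in>?I \<rightarrow>\<^sub>E \<Gamma>. \<Sum>i\<in>?I. iid \<mu> ?I C * (\<Sum>y\<in>Y. ?k (C i) y * ?d C y (fst i)))
      / (card Ms * card L)"
  proof -
    have "avg_error Ms Y (through X (bin_enc L e C) U) (unique_dec Ms L T C)
      = (\<Sum>i\<in>?I. \<Sum>y\<in>Y. ?k (C i) y * ?d C y (fst i)) / (card Ms * card L)" for C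
    proof -
      have "(\<Sum>y\<in>Y. through X (bin_enc L e C) U m y * ?d C y m)
        = (\<Sum>l\<in>L. \<Sum>y\<in>Y. ?k (C (m, l)) y * ?d C y m) / card L" for m
        unfolding through_bin_enc
        by (subst sum.swap) (simp add: sum_distrib_right sum_divide_distrib)
      then show ?thesis
        unfolding avg_error_def
        by (simp add: sum.cartesian_product' sum_divide_distrib[symmetric] mult.commute)
    qed
    then show ?thesis by (simp add: sum_divide_distrib sum_distrib_left)
  qed
  also have "\<dots> = (\<Sum>i\<in>?I. \<Sum>C\<in>?I \<rightarrow>\<^sub>E \<Gamma>. iid \<mu> ?I C * (\<Sum>y\<in>Y. ?k (C i) y * ?d C y (fst i)))
      / (card Ms * card L)"
    by (subst sum.swap) simp
  also have "\<dots> \<le> (\<Sum>i\<in>?I. ?B) / (card Ms * card L)"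
  proof (intro divide_right_mono sum_mono)
    fix i assume i: "i \<in> ?I"
    have "(\<Sum>C\<in>?I \<rightarrow>\<^sub>E \<Gamma>. iid \<mu> ?I C * (\<Sum>y\<in>Y. ?k (C i) y * ?d C y (fst i)))
      \<le> (\<Sum>C\<in>?I \<rightarrow>\<^sub>E \<Gamma>. iid \<mu> ?I C * (\<Sum>y\<in>Y. ?k (C i) y *
          of_bool (\<not> T (C i) y \<or> (\<exists>i'\<in>?I - {i}. T (C i') y))))"
    proof (intro sum_mono mult_left_mono wI)
      fix C y assume C: "C \<in> ?I \<rightarrow>\<^sub>E \<Gamma>" and y: "y \<in> Y"
      show "0 \<le> ?k (C i) y" using C i y k by (auto simp: PiE_iff)
      show "?d C y (fst i) \<le> of_bool (\<not> T (C i) y \<or> (\<exists>i'\<in>?I - {i}. T (C i') y))"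
        using unique_dec_wrong[of "fst i" Ms "snd i" L T C y] i by (auto simp: of_bool_def)
    qed
    also have "\<dots> \<le> ?B"
      using packing[OF mu I i Y, of ?k T] k
      by (simp add: miss_def false_alarm_def card_cartesian_product)
    finally show "(\<Sum>C\<in>?I \<rightarrow>\<^sub>E \<Gamma>. iid \<mu> ?I C * (\<Sum>y\<in>Y. ?k (C i) y * ?d C y (fst i))) \<le> ?B" .
  qed auto
  also have "\<dots> = ?B" using M L by (simp add: card_cartesian_product card_gt_0_iff)
  finally show ?thesis .
qed

lemma expected_divergence:
  fixes \<mu> :: "'c \<Rightarrow> real" and U :: "'x \<Rightarrow> 'z \<Rightarrow> real"
  assumes mu: "is_pmf \<Gamma> \<mu>" and M: "finite Ms" "Ms \<noteq> {}" and L: "finite L" "L \<noteq> {}"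
    and e: "\<And>c. c \<in> \<Gamma> \<Longrightarrow> is_pmf X (e c)" and U: "\<And>x. x \<in> X \<Longrightarrow> is_pmf Z (U x)"
    and Z: "finite Z"
  shows "(\<Sum>C\<in>(Ms \<times> L) \<rightarrow>\<^sub>E \<Gamma>. iid \<mu> (Ms \<times> L) C *
      avg_div Ms Z (through X (bin_enc L e C) U) (\<lambda>z. \<Sum>c\<in>\<Gamma>. \<mu> c * through X e U c z))
    \<le> cover \<Gamma> \<mu> Z (through X e U) (card L)" (is "?l \<le> ?B")
proof -
  let ?I = "Ms \<times> L" and ?k = "through X e U"
  let ?Q = "\<lambda>z. \<Sum>c\<in>\<Gamma>. \<mu> c * through X e U c z"
  let ?P = "\<lambda>C. through X (bin_enc L e C) U"
  have I: "finite ?I" using M L by auto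
  have k: "0 \<le> ?k c y" if "c \<in> \<Gamma>" "y \<in> Z" for c y
    using is_pmf_through[of X e c Z U] e U that is_pmfD(2) by metis
  have "?l = (\<Sum>m\<in>Ms. \<Sum>C\<in>?I \<rightarrow>\<^sub>E \<Gamma>. iid \<mu> ?I C * (\<Sum>z\<in>Z. ?P C m z * log 2 (?P C m z / ?Q z)))
      / card Ms"
    unfolding avg_div_def by (subst sum.swap) (simp add: sum_distrib_left sum_divide_distrib)
  also have "\<dots> \<le> (\<Sum>m\<in>Ms. ?B) / card Ms"
  proof (intro divide_right_mono sum_mono)
    fix m assume m: "m \<in> Ms"
    have P: "?P C m z = (\<Sum>j\<in>{m} \<times> L. ?k (C j) z) / card ({m} \<times> L)" for C z
      unfolding through_bin_enc
      by (simp add: card_cartesian_product sum.cartesian_product')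
    have "{m} \<times> L \<subseteq> ?I" "{m} \<times> L \<noteq> {}" using m L by auto
    from soft_covering[OF mu I this Z, of ?k, OF k]
    show "(\<Sum>C\<in>?I \<rightarrow>\<^sub>E \<Gamma>. iid \<mu> ?I C *
        (\<Sum>z\<in>Z. ?P C m z * log 2 (?P C m z / ?Q z))) \<le> ?B"
      unfolding cover_def P by (simp add: card_cartesian_product)
  qed auto
  also have "\<dots> = ?B" using M by simp
  finally show ?thesis .
qed

text \<open>Divergence from \<open>Q\<close> is meaningful only under absolute continuity, because \<open>x / 0 = 0\<close>.\<close>
definition has_code :: "'m set \<Rightarrow> 'x set \<Rightarrow> 'y1 set \<Rightarrow> 'y2 set \<Rightarrow> 'z set \<Rightarrow> ('x \<Rightarrow> 'y1 \<Rightarrow> real)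
    \<Rightarrow> ('x \<Rightarrow> 'y2 \<Rightarrow> real) \<Rightarrow> ('x \<Rightarrow> 'z \<Rightarrow> real) \<Rightarrow> real \<Rightarrow> real \<Rightarrow> bool" where
  "has_code Ms X Y1 Y2 Z U1 U2 U3 \<theta> B \<longleftrightarrow>
    (\<exists>enc dec1 dec2 Q. (\<forall>m\<in>Ms. is_pmf X (enc m)) \<and> is_pmf Z Q
      \<and> (\<forall>m\<in>Ms. \<forall>z\<in>Z. 0 < through X enc U3 m z \<longrightarrow> 0 < Q z)
      \<and> avg_error Ms Y1 (through X enc U1) dec1 + avg_error Ms Y2 (through X enc U2) dec2
          + \<theta> * avg_div Ms Z (through X enc U3) Q \<le> B)"

lemma has_code_mono:
  assumes "has_code Ms X Y1 Y2 Z U1 U2 U3 \<theta> B" "B \<le> B'"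
  shows "has_code Ms X Y1 Y2 Z U1 U2 U3 \<theta> B'"
  using assms(1) unfolding has_code_def
  by (elim exE conjE, intro exI conjI)
    (assumption, assumption, assumption, erule order_trans[OF _ assms(2)])

text \<open>The three expectations are added before a codebook is selected, so one codebook meets
  the bound for both receivers and the eavesdropper. The reference law of the divergence is the
  output law averaged over codebooks.\<close>

lemma random_code:
  fixes \<mu> :: "'c \<Rightarrow> real" and U1 :: "'x \<Rightarrow> 'y1 \<Rightarrow> real"
    and U2 :: "'x \<Rightarrow> 'y2 \<Rightarrow> real" and U3 :: "'x \<Rightarrow> 'z \<Rightarrow> real"
  assumes mu: "is_pmf \<Gamma> \<mu>" and M: "finite Ms" "Ms \<noteq> {}" and L: "finite L" "L \<noteq> {}"
    and e: "\<And>c. c \<in> \<Gamma> \<Longrightarrow> is_pmf X (e c)"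
    and U: "\<And>x. x \<in> X \<Longrightarrow> is_pmf Y1 (U1 x)" "\<And>x. x \<in> X \<Longrightarrow> is_pmf Y2 (U2 x)"
      "\<And>x. x \<in> X \<Longrightarrow> is_pmf Z (U3 x)"
    and fin: "finite X" "finite Y1" "finite Y2" "finite Z"
    and \<theta>: "0 \<le> \<theta>" and B: "B = miss \<Gamma> \<mu> Y1 (through X e U1) T1
          + real (card Ms * card L) * false_alarm \<Gamma> \<mu> Y1 (through X e U1) T1
        + (miss \<Gamma> \<mu> Y2 (through X e U2) T2
          + real (card Ms * card L) * false_alarm \<Gamma> \<mu> Y2 (through X e U2) T2)
        + \<theta> * cover \<Gamma> \<mu> Z (through X e U3) (card L)"
  shows "has_code Ms X Y1 Y2 Z U1 U2 U3 \<theta> B"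
proof -
  let ?I = "Ms \<times> L" and ?Q = "\<lambda>z. \<Sum>c\<in>\<Gamma>. \<mu> c * through X e U3 c z"
  let ?F = "\<lambda>C. avg_error Ms Y1 (through X (bin_enc L e C) U1) (unique_dec Ms L T1 C)
    + avg_error Ms Y2 (through X (bin_enc L e C) U2) (unique_dec Ms L T2 C)
    + \<theta> * avg_div Ms Z (through X (bin_enc L e C) U3) ?Q"
  note m = is_pmfD[OF mu]
  have I: "finite ?I" using M L by auto
  have k: "is_pmf Z (through X e U3 c)" if "c \<in> \<Gamma>" for c
    using that e U by (intro is_pmf_through) auto
  have "(\<Sum>C\<in>?I \<rightarrow>\<^sub>E \<Gamma>. iid \<mu> ?I C * ?F C) \<le> B"
  proof -
    note E1 = expected_error[OF mu M L, of X e Y1 U1 T1, OF e U(1) fin(2)]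
    note E2 = expected_error[OF mu M L, of X e Y2 U2 T2, OF e U(2) fin(3)]
    note E3 = expected_divergence[OF mu M L, of X e Z U3, OF e U(3) fin(4)]
    have "(\<Sum>C\<in>?I \<rightarrow>\<^sub>E \<Gamma>. iid \<mu> ?I C * ?F C)
      = (\<Sum>C\<in>?I \<rightarrow>\<^sub>E \<Gamma>. iid \<mu> ?I C * avg_error Ms Y1 (through X (bin_enc L e C) U1) (unique_dec Ms L T1 C))
      + (\<Sum>C\<in>?I \<rightarrow>\<^sub>E \<Gamma>. iid \<mu> ?I C * avg_error Ms Y2 (through X (bin_enc L e C) U2) (unique_dec Ms L T2 C))
      + \<theta> * (\<Sum>C\<in>?I \<rightarrow>\<^sub>E \<Gamma>. iid \<mu> ?I C * avg_div Ms Z (through X (bin_enc L e C) U3) ?Q)"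
      unfolding sum_distrib_left sum.distrib[symmetric]
      by (intro sum.cong) (simp_all only: distrib_left mult.left_commute)
    also have "\<dots> \<le> B"
      unfolding B by (intro add_mono E1 E2 mult_left_mono E3 \<theta>)
    finally show ?thesis .
  qed
  then obtain C where C: "C \<in> ?I \<rightarrow>\<^sub>E \<Gamma>" "0 < iid \<mu> ?I C" "?F C \<le> B"
    by (rule is_pmf_le_average[OF is_pmf_iid[OF mu I]])
  have "is_pmf X (bin_enc L e C m)" if "m \<in> Ms" for m
    using that C L fin by (intro is_pmf_bin_enc e) (auto simp: PiE_iff)
  moreover have "is_pmf Z ?Q"
  proof -
    have "(\<Sum>z\<in>Z. ?Q z) = (\<Sum>c\<in>\<Gamma>. \<mu> c * (\<Sum>z\<in>Z. through X e U3 c z))"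
      unfolding sum_distrib_left by (rule sum.swap)
    then show ?thesis using m is_pmfD[OF k] fin by (auto simp: is_pmf_def intro!: sum_nonneg)
  qed
  moreover have "0 < ?Q z"
    if mz: "m \<in> Ms" "z \<in> Z" "0 < through X (bin_enc L e C) U3 m z" for m z
  proof -
    have "\<not> (\<forall>l\<in>L. through X e U3 (C (m, l)) z \<le> 0)"
    proof
      assume "\<forall>l\<in>L. through X e U3 (C (m, l)) z \<le> 0"
      then have "(\<Sum>l\<in>L. through X e U3 (C (m, l)) z) \<le> 0" by (simp add: sum_nonpos)
      then show False using mz unfolding through_bin_enc
        by (metis divide_nonpos_nonneg linorder_not_le of_nat_0_le_iff)
    qed
    then obtain l where l: "l \<in> L" "0 < through X e U3 (C (m, l)) z" by force
    have CG: "C (m, l) \<in> \<Gamma>" using C mz l by auto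
    \<comment> \<open>The selected codebook has positive weight, so no factor of the product
      vanishes, in particular not that of \<open>C (m, l)\<close>.\<close>
    have "\<mu> (C (m, l)) \<noteq> 0"
      using C(2) I mz l unfolding iid_def by (metis SigmaI less_irrefl prod_zero_iff)
    then have "0 < \<mu> (C (m, l)) * through X e U3 (C (m, l)) z"
      using l m CG by (metis less_eq_real_def mult_pos_pos)
    also have "\<dots> \<le> ?Q z"
      using CG m is_pmfD[OF k] mz by (intro member_le_sum) auto
    finally show ?thesis .
  qed
  ultimately have all: "(\<forall>m\<in>Ms. is_pmf X (bin_enc L e C m)) \<and> is_pmf Z ?Q
      \<and> (\<forall>m\<in>Ms. \<forall>z\<in>Z. 0 < through X (bin_enc L e C) U3 m z \<longrightarrow> 0 < ?Q z)
      \<and> ?F C \<le> B"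
    using C(3) by blast
  show ?thesis unfolding has_code_def
    by (intro exI[of _ "bin_enc L e C"] exI[of _ "unique_dec Ms L T1 C"]
          exI[of _ "unique_dec Ms L T2 C"] exI[of _ ?Q]) (rule all)
qed

section \<open>One-shot superposition coding with a likelihood encoder\<close>

lemma is_pmf_Times:
  assumes "is_pmf A p" "is_pmf B q"
  shows "is_pmf (A \<times> B) (\<lambda>(a, b). p a * q b)"
  using is_pmfD[OF assms(1)] is_pmfD[OF assms(2)]
  by (auto simp: is_pmf_def sum.cartesian_product' sum_distrib_left[symmetric])

lemma sum_iid_update:
  fixes p :: "'a \<Rightarrow> real"
  assumes "is_pmf A p" "finite I" "i' \<in> I"
  shows "(\<Sum>g\<in>(I - {i}) \<rightarrow>\<^sub>E A. iid p (I - {i}) g * h ((g(i := v)) i'))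
    = (if i' = i then h v else \<Sum>a\<in>A. p a * h a)"
  using is_pmfD(3)[OF is_pmf_iid[OF assms(1), of "I - {i}"]] assms
    sum_iid_marginal[OF assms(1), of "I - {i}" i' h]
  by (auto simp flip: sum_distrib_right)

text \<open>For t = \<open>s / n\<close> < 1 this is t ln (1/t) \<le> 1 - t. For t \<ge> 1 the
  logarithm is 0, and at \<open>s = 0\<close> the factor \<open>s / n\<close> removes the
  term.\<close>

lemma mult_log_le:
  fixes s n :: real
  assumes "0 \<le> s" "0 < n"
  shows "s / n * log 2 (max 1 (n / s)) \<le> 1 / ln 2"
proof (cases "s = 0 \<or> n \<le> s")
  case True
  then have eq: "s / n * log 2 (max 1 (n / s)) = 0" using assms by (auto simp: max_def field_simps)
  show ?thesis unfolding eq by simp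
next
  case False
  then have s: "0 < s" "s < n" using assms by auto
  have "ln (n / s) \<le> n / s - 1" using s assms by (intro ln_le_minus_one) auto
  then have "s / n * ln (n / s) \<le> s / n * (n / s - 1)" using s assms by (intro mult_left_mono) auto
  also have "\<dots> \<le> 1" using s assms by (simp add: field_simps)
  finally have "s / n * ln (n / s) / ln 2 \<le> 1 / ln 2" by (intro divide_right_mono) auto
  moreover have "max 1 (n / s) = n / s" using s by (auto simp: max_def field_simps)
  ultimately show ?thesis by (simp add: log_def)
qed

text \<open>One-shot setting for a single super-codeword, whose second-layer entries are indexed by
  \<open>I1\<close> and \<open>I2\<close>. Later \<open>A0\<close>, \<open>A1\<close>,
  \<open>A2\<close> and \<open>X\<close> become sets of blocks, and all kernels become
  products.\<close>

locale superposition =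
  fixes A0 :: "'a set" and A1 :: "'b set" and A2 :: "'c set" and X :: "'x set"
    and p0 :: "'a \<Rightarrow> real" and p12 :: "'a \<Rightarrow> 'b \<Rightarrow> 'c \<Rightarrow> real"
    and px :: "'a \<Rightarrow> 'b \<Rightarrow> 'c \<Rightarrow> 'x \<Rightarrow> real" and I1 :: "'i set" and I2 :: "'j set"
  assumes p0: "is_pmf A0 p0"
    and p12: "\<And>v0. v0 \<in> A0 \<Longrightarrow> is_pmf (A1 \<times> A2) (\<lambda>(v1, v2). p12 v0 v1 v2)"
    and px: "\<And>v0 v1 v2. v0 \<in> A0 \<Longrightarrow> v1 \<in> A1 \<Longrightarrow> v2 \<in> A2 \<Longrightarrow> is_pmf X (px v0 v1 v2)"
    and finA: "finite A1" "finite A2"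
    and finI: "finite I1" "I1 \<noteq> {}" "finite I2" "I2 \<noteq> {}"
begin

definition p1 :: "'a \<Rightarrow> 'b \<Rightarrow> real" where "p1 v0 v1 = (\<Sum>v2\<in>A2. p12 v0 v1 v2)"
definition p2 :: "'a \<Rightarrow> 'c \<Rightarrow> real" where "p2 v0 v2 = (\<Sum>v1\<in>A1. p12 v0 v1 v2)"
text \<open>Density of the joint conditional law against the product of its conditional marginals;
  the mean of its logarithm is I(V_1;V_2|V_0). Where a marginal vanishes so does the numerator,
  hence the value 0 of the quotient is harmless.\<close>

definition ratio :: "'a \<Rightarrow> 'b \<Rightarrow> 'c \<Rightarrow> real" where
  "ratio v0 v1 v2 = p12 v0 v1 v2 / (p1 v0 v1 * p2 v0 v2)"

text \<open>The laws of the output given \<open>(v\<^sub>0,v\<^sub>1,v\<^sub>2)\<close>, \<open>(v\<^sub>0,v\<^sub>1)\<close>, \<open>(v\<^sub>0,v\<^sub>2)\<close>, \<open>v\<^sub>0\<close> and nothing.\<close>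
definition kap :: "('x \<Rightarrow> 'y \<Rightarrow> real) \<Rightarrow> 'a \<Rightarrow> 'b \<Rightarrow> 'c \<Rightarrow> 'y \<Rightarrow> real" where
  "kap U v0 v1 v2 y = (\<Sum>x\<in>X. px v0 v1 v2 x * U x y)"
definition kap1 :: "('x \<Rightarrow> 'y \<Rightarrow> real) \<Rightarrow> 'a \<Rightarrow> 'b \<Rightarrow> 'y \<Rightarrow> real" where
  "kap1 U v0 v1 y = (\<Sum>v2\<in>A2. p12 v0 v1 v2 / p1 v0 v1 * kap U v0 v1 v2 y)"
definition kap2 :: "('x \<Rightarrow> 'y \<Rightarrow> real) \<Rightarrow> 'a \<Rightarrow> 'c \<Rightarrow> 'y \<Rightarrow> real" where
  "kap2 U v0 v2 y = (\<Sum>v1\<in>A1. p12 v0 v1 v2 / p2 v0 v2 * kap U v0 v1 v2 y)"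
definition kap0 :: "('x \<Rightarrow> 'y \<Rightarrow> real) \<Rightarrow> 'a \<Rightarrow> 'y \<Rightarrow> real" where
  "kap0 U v0 y = (\<Sum>v1\<in>A1. \<Sum>v2\<in>A2. p12 v0 v1 v2 * kap U v0 v1 v2 y)"
definition outQ :: "('x \<Rightarrow> 'y \<Rightarrow> real) \<Rightarrow> 'y \<Rightarrow> real" where
  "outQ U y = (\<Sum>v0\<in>A0. p0 v0 * kap0 U v0 y)"

definition \<Gamma> :: "('a \<times> ('i \<Rightarrow> 'b) \<times> ('j \<Rightarrow> 'c)) set" where
  "\<Gamma> = A0 \<times> (I1 \<rightarrow>\<^sub>E A1) \<times> (I2 \<rightarrow>\<^sub>E A2)"
definition N :: real where "N = real (card I1) * real (card I2)"
definition base :: "'a \<times> ('i \<Rightarrow> 'b) \<times> ('j \<Rightarrow> 'c) \<Rightarrow> real" where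
  "base = (\<lambda>(v0, f1, f2). p0 v0 * iid (p1 v0) I1 f1 * iid (p2 v0) I2 f2)"
text \<open>The weights are those of the encoder before normalisation, so
  \<open>wsum \<phi> c / S c\<close> is the mean of \<open>\<phi>\<close> at the pair that the
  encoder selects from \<open>c\<close>.\<close>

definition wsum :: "('a \<Rightarrow> 'b \<Rightarrow> 'c \<Rightarrow> real) \<Rightarrow> 'a \<times> ('i \<Rightarrow> 'b) \<times> ('j \<Rightarrow> 'c) \<Rightarrow> real" where
  "wsum \<phi> = (\<lambda>(v0, f1, f2). \<Sum>i\<in>I1. \<Sum>j\<in>I2. ratio v0 (f1 i) (f2 j) * \<phi> v0 (f1 i) (f2 j))"
abbreviation S where "S \<equiv> wsum (\<lambda>_ _ _. 1)"
text \<open>Under \<open>base\<close> each pair has mean ratio 1, so \<open>S\<close> has mean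
  \<open>N\<close>; this is why \<open>N\<close> normalises the tilted law.\<close>

definition \<mu> :: "'a \<times> ('i \<Rightarrow> 'b) \<times> ('j \<Rightarrow> 'c) \<Rightarrow> real" where
  "\<mu> c = base c * S c / N"
text \<open>Codebooks with \<open>S c = 0\<close> have probability 0, so the encoder is arbitrary there.\<close>
definition enc :: "'a \<times> ('i \<Rightarrow> 'b) \<times> ('j \<Rightarrow> 'c) \<Rightarrow> 'x \<Rightarrow> real" where
  "enc c x = (if S c = 0
     then (case c of (v0, f1, f2) \<Rightarrow> px v0 (f1 (SOME i. i \<in> I1)) (f2 (SOME j. j \<in> I2)) x)
     else wsum (\<lambda>v0 v1 v2. px v0 v1 v2 x) c / S c)"

lemma p12_nonneg [simp]: "v0 \<in> A0 \<Longrightarrow> v1 \<in> A1 \<Longrightarrow> v2 \<in> A2 \<Longrightarrow> 0 \<le> p12 v0 v1 v2"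
  using is_pmfD(2)[OF p12] by fastforce

lemma p0_nonneg [simp]: "v0 \<in> A0 \<Longrightarrow> 0 \<le> p0 v0"
  using is_pmfD(2)[OF p0] by simp

lemma finA0: "finite A0" using is_pmfD(1)[OF p0] .

lemma sum_p12: "v0 \<in> A0 \<Longrightarrow> (\<Sum>v1\<in>A1. \<Sum>v2\<in>A2. p12 v0 v1 v2) = 1"
  using is_pmfD(3)[OF p12] by (simp add: sum.cartesian_product')

lemma is_pmf_p1: "v0 \<in> A0 \<Longrightarrow> is_pmf A1 (p1 v0)"
  using finA sum_p12 by (auto simp: is_pmf_def p1_def intro!: sum_nonneg)

lemma is_pmf_p2: "v0 \<in> A0 \<Longrightarrow> is_pmf A2 (p2 v0)"
  using finA sum_p12[of v0] unfolding is_pmf_def p2_def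
  by (subst sum.swap) (auto intro!: sum_nonneg)

lemma p12_le_p1: "v0 \<in> A0 \<Longrightarrow> v1 \<in> A1 \<Longrightarrow> v2 \<in> A2 \<Longrightarrow> p12 v0 v1 v2 \<le> p1 v0 v1"
  unfolding p1_def using finA by (intro member_le_sum[of v2]) auto

lemma p12_le_p2: "v0 \<in> A0 \<Longrightarrow> v1 \<in> A1 \<Longrightarrow> v2 \<in> A2 \<Longrightarrow> p12 v0 v1 v2 \<le> p2 v0 v2"
  unfolding p2_def using finA by (intro member_le_sum[of v1 _ "\<lambda>v1. p12 v0 v1 v2"]) auto

lemma ratio_nonneg: "v0 \<in> A0 \<Longrightarrow> v1 \<in> A1 \<Longrightarrow> v2 \<in> A2 \<Longrightarrow> 0 \<le> ratio v0 v1 v2"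
  unfolding ratio_def using is_pmfD(2)[OF is_pmf_p1] is_pmfD(2)[OF is_pmf_p2] by auto

text \<open>Reweighting an independent \<open>v2\<close> by \<open>ratio\<close> gives it the law of
  \<open>v2\<close> given \<open>v0\<close> and \<open>v1\<close>. If \<open>p2\<close> vanishes, so
  does \<open>p12\<close>, and both sides are 0.\<close>

lemma p2_ratio: "v0 \<in> A0 \<Longrightarrow> v1 \<in> A1 \<Longrightarrow> v2 \<in> A2 \<Longrightarrow>
    p2 v0 v2 * ratio v0 v1 v2 = p12 v0 v1 v2 / p1 v0 v1"
  using p12_le_p2[of v0 v1 v2] p12_nonneg[of v0 v1 v2] by (auto simp: ratio_def simp del: p12_nonneg)

lemma p1_ratio: "v0 \<in> A0 \<Longrightarrow> v1 \<in> A1 \<Longrightarrow> v2 \<in> A2 \<Longrightarrow>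
    p1 v0 v1 * ratio v0 v1 v2 = p12 v0 v1 v2 / p2 v0 v2"
  using p12_le_p1[of v0 v1 v2] p12_nonneg[of v0 v1 v2] by (auto simp: ratio_def simp del: p12_nonneg)

lemma p1_p2_ratio: "v0 \<in> A0 \<Longrightarrow> v1 \<in> A1 \<Longrightarrow> v2 \<in> A2 \<Longrightarrow>
    p1 v0 v1 * (p2 v0 v2 * ratio v0 v1 v2) = p12 v0 v1 v2"
  using p12_le_p1[of v0 v1 v2] p12_nonneg[of v0 v1 v2]
  by (auto simp: p2_ratio simp del: p12_nonneg)

lemma N_pos: "0 < N" using finI by (simp add: N_def card_gt_0_iff)

lemma wsum_nonneg:
  assumes "c \<in> \<Gamma>" "\<And>v0 v1 v2. v0 \<in> A0 \<Longrightarrow> v1 \<in> A1 \<Longrightarrow> v2 \<in> A2 \<Longrightarrow> 0 \<le> \<phi> v0 v1 v2"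
  shows "0 \<le> wsum \<phi> c"
  using assms unfolding wsum_def \<Gamma>_def
  by (auto simp: PiE_iff intro!: sum_nonneg mult_nonneg_nonneg ratio_nonneg)

lemma base_nonneg: "c \<in> \<Gamma> \<Longrightarrow> 0 \<le> base c"
  using is_pmfD(2)[OF is_pmf_p1] is_pmfD(2)[OF is_pmf_p2]
  by (auto simp: base_def iid_def \<Gamma>_def PiE_iff intro!: mult_nonneg_nonneg prod_nonneg)

lemma sum_base: "(\<Sum>c\<in>\<Gamma>. base c) = 1"
proof -
  have "(\<Sum>f1\<in>I1 \<rightarrow>\<^sub>E A1. \<Sum>f2\<in>I2 \<rightarrow>\<^sub>E A2. p0 v0 * iid (p1 v0) I1 f1 * iid (p2 v0) I2 f2) = p0 v0"
    if "v0 \<in> A0" for v0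
    using is_pmfD(3)[OF is_pmf_iid[OF is_pmf_p1[OF that], of I1]]
      is_pmfD(3)[OF is_pmf_iid[OF is_pmf_p2[OF that], of I2]] finI
    by (simp flip: sum_distrib_left)
  then show ?thesis
    using is_pmfD(3)[OF p0] by (simp add: \<Gamma>_def base_def sum.cartesian_product')
qed

lemma finite_\<Gamma>: "finite \<Gamma>"
  using finA0 finA finI by (auto simp: \<Gamma>_def intro!: finite_PiE)

text \<open>The conditional law of the rest of the codebook when the pair at position \<open>(i, j)\<close> is the
  transmitted one.\<close>
definition rest :: "'i \<Rightarrow> 'j \<Rightarrow> ('a \<times> ('i \<Rightarrow> 'b) \<times> ('j \<Rightarrow> 'c) \<Rightarrow> real) \<Rightarrow> 'a \<Rightarrow> 'b \<Rightarrow> 'c \<Rightarrow> real" where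
  "rest i j h v0 v1 v2 = (\<Sum>g1\<in>(I1 - {i}) \<rightarrow>\<^sub>E A1. \<Sum>g2\<in>(I2 - {j}) \<rightarrow>\<^sub>E A2.
      iid (p1 v0) (I1 - {i}) g1 * iid (p2 v0) (I2 - {j}) g2 * h (v0, g1(i := v1), g2(j := v2)))"

definition E012 :: "('a \<Rightarrow> 'b \<Rightarrow> 'c \<Rightarrow> real) \<Rightarrow> real" where
  "E012 F = (\<Sum>v0\<in>A0. \<Sum>v1\<in>A1. \<Sum>v2\<in>A2. p0 v0 * p12 v0 v1 v2 * F v0 v1 v2)"

text \<open>The change of measure behind the tilted law. \<open>wsum\<close> is a sum over positions
  \<open>(i, j)\<close>. Separating these two coordinates leaves the factor
  \<open>p1 * p2 * ratio = p12\<close>, so the pair at \<open>(i, j)\<close> receives the joint law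
  while all other entries stay independent given \<open>v0\<close>.\<close>

lemma sum_planted:
  "(\<Sum>c\<in>\<Gamma>. base c * wsum \<phi> c * h c)
    = (\<Sum>i\<in>I1. \<Sum>j\<in>I2. E012 (\<lambda>v0 v1 v2. \<phi> v0 v1 v2 * rest i j h v0 v1 v2))"
proof -
  let ?F1 = "I1 \<rightarrow>\<^sub>E A1" and ?F2 = "I2 \<rightarrow>\<^sub>E A2"
  let ?t = "\<lambda>v0 f1 f2 i j. ratio v0 (f1 i) (f2 j) * \<phi> v0 (f1 i) (f2 j) * h (v0, f1, f2)"
  have one: "(\<Sum>f1\<in>?F1. iid (p1 v0) I1 f1 * (\<Sum>f2\<in>?F2. iid (p2 v0) I2 f2 * ?t v0 f1 f2 i j))
    = (\<Sum>v1\<in>A1. \<Sum>v2\<in>A2. p12 v0 v1 v2 * (\<phi> v0 v1 v2 * rest i j h v0 v1 v2))"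
    if v0: "v0 \<in> A0" and i: "i \<in> I1" and j: "j \<in> I2" for v0 i j
  proof -
    let ?w1 = "iid (p1 v0) (I1 - {i})" and ?w2 = "iid (p2 v0) (I2 - {j})"
    let ?G1 = "(I1 - {i}) \<rightarrow>\<^sub>E A1" and ?G2 = "(I2 - {j}) \<rightarrow>\<^sub>E A2"
    have "(\<Sum>f1\<in>?F1. iid (p1 v0) I1 f1 * (\<Sum>f2\<in>?F2. iid (p2 v0) I2 f2 * ?t v0 f1 f2 i j))
      = (\<Sum>v1\<in>A1. p1 v0 v1 * (\<Sum>g1\<in>?G1. ?w1 g1 * (\<Sum>v2\<in>A2. p2 v0 v2 * (\<Sum>g2\<in>?G2. ?w2 g2 *
          ?t v0 (g1(i := v1)) (g2(j := v2)) i j))))"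
      using finA finI i j by (simp only: sum_iid_coord[of _ _ i] sum_iid_coord[of _ _ j])
    also have "\<dots> = (\<Sum>v1\<in>A1. \<Sum>g1\<in>?G1. \<Sum>v2\<in>A2. p1 v0 v1 * (p2 v0 v2 * ratio v0 v1 v2) *
        (\<phi> v0 v1 v2 * (\<Sum>g2\<in>?G2. ?w1 g1 * ?w2 g2 * h (v0, g1(i := v1), g2(j := v2)))))"
      by (simp add: sum_distrib_left ac_simps)
    also have "\<dots> = (\<Sum>v1\<in>A1. \<Sum>g1\<in>?G1. \<Sum>v2\<in>A2. p12 v0 v1 v2 *
        (\<phi> v0 v1 v2 * (\<Sum>g2\<in>?G2. ?w1 g1 * ?w2 g2 * h (v0, g1(i := v1), g2(j := v2)))))"
      using v0 by (intro sum.cong refl) (simp only: p1_p2_ratio)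
    also have "\<dots> = (\<Sum>v1\<in>A1. \<Sum>v2\<in>A2. p12 v0 v1 v2 * (\<phi> v0 v1 v2 * rest i j h v0 v1 v2))"
      unfolding rest_def sum_distrib_left
      by (intro sum.cong refl) (rule sum.swap)
    finally show ?thesis .
  qed
  have "(\<Sum>c\<in>\<Gamma>. base c * wsum \<phi> c * h c)
    = (\<Sum>v0\<in>A0. \<Sum>f1\<in>?F1. \<Sum>f2\<in>?F2. \<Sum>i\<in>I1. \<Sum>j\<in>I2.
        p0 v0 * (iid (p1 v0) I1 f1 * (iid (p2 v0) I2 f2 * ?t v0 f1 f2 i j)))"
    unfolding \<Gamma>_def base_def wsum_def sum.cartesian_product' prod.case
    by (simp add: sum_distrib_left sum_distrib_right mult.assoc)
  also have "\<dots> = (\<Sum>i\<in>I1. \<Sum>j\<in>I2. \<Sum>v0\<in>A0. \<Sum>f1\<in>?F1. \<Sum>f2\<in>?F2.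
        p0 v0 * (iid (p1 v0) I1 f1 * (iid (p2 v0) I2 f2 * ?t v0 f1 f2 i j)))"
    by (simp only: sum.swap[of _ I1 A0] sum.swap[of _ I1 ?F1] sum.swap[of _ I1 ?F2]
        sum.swap[of _ I2 A0] sum.swap[of _ I2 ?F1] sum.swap[of _ I2 ?F2])
  also have "\<dots> = (\<Sum>i\<in>I1. \<Sum>j\<in>I2. \<Sum>v0\<in>A0. p0 v0 *
      (\<Sum>f1\<in>?F1. iid (p1 v0) I1 f1 * (\<Sum>f2\<in>?F2. iid (p2 v0) I2 f2 * ?t v0 f1 f2 i j)))"
    by (simp only: sum_distrib_left)
  also have "\<dots> = (\<Sum>i\<in>I1. \<Sum>j\<in>I2. E012 (\<lambda>v0 v1 v2. \<phi> v0 v1 v2 * rest i j h v0 v1 v2))"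
    by (simp add: one E012_def cong: sum.cong) (simp add: sum_distrib_left mult.assoc)
  finally show ?thesis .
qed

lemma E012_mono:
  assumes "\<And>v0 v1 v2. v0 \<in> A0 \<Longrightarrow> v1 \<in> A1 \<Longrightarrow> v2 \<in> A2 \<Longrightarrow> 0 < p0 v0 \<Longrightarrow> 0 < p12 v0 v1 v2
    \<Longrightarrow> F v0 v1 v2 \<le> G v0 v1 v2"
  shows "E012 F \<le> E012 G"
  unfolding E012_def
proof (intro sum_mono)
  fix v0 v1 v2 assume v: "v0 \<in> A0" "v1 \<in> A1" "v2 \<in> A2"
  show "p0 v0 * p12 v0 v1 v2 * F v0 v1 v2 \<le> p0 v0 * p12 v0 v1 v2 * G v0 v1 v2"
  proof (cases "p0 v0 * p12 v0 v1 v2 = 0")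
    case True then show ?thesis by (simp only: mult_zero_left)
  next
    case False
    then have "0 < p0 v0" "0 < p12 v0 v1 v2"
      using v p0_nonneg[of v0] p12_nonneg[of v0 v1 v2] by (auto simp del: p0_nonneg p12_nonneg)
    then show ?thesis using assms v by (intro mult_left_mono) auto
  qed
qed

lemma E012_1: "E012 (\<lambda>_ _ _. 1) = 1"
  using is_pmfD(3)[OF p0] sum_p12 by (simp add: E012_def sum_distrib_left[symmetric])

lemma rest_const:
  assumes "v0 \<in> A0"
  shows "rest i j (\<lambda>_. 1) v0 v1 v2 = 1"
  using is_pmfD(3)[OF is_pmf_iid[OF is_pmf_p1[OF assms], of "I1 - {i}"]]
    is_pmfD(3)[OF is_pmf_iid[OF is_pmf_p2[OF assms], of "I2 - {j}"]] finI
  by (simp add: rest_def flip: sum_distrib_left)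

lemma rest_mono:
  assumes "v0 \<in> A0" "v1 \<in> A1" "v2 \<in> A2" "i \<in> I1" "j \<in> I2"
    and "\<And>f1 f2. f1 \<in> I1 \<rightarrow>\<^sub>E A1 \<Longrightarrow> f2 \<in> I2 \<rightarrow>\<^sub>E A2 \<Longrightarrow> f1 i = v1 \<Longrightarrow> f2 j = v2
      \<Longrightarrow> h (v0, f1, f2) \<le> h' (v0, f1, f2)"
  shows "rest i j h v0 v1 v2 \<le> rest i j h' v0 v1 v2"
  unfolding rest_def
proof (intro sum_mono mult_left_mono)
  fix g1 g2 assume g: "g1 \<in> (I1 - {i}) \<rightarrow>\<^sub>E A1" "g2 \<in> (I2 - {j}) \<rightarrow>\<^sub>E A2"
  have "g1(i := v1) \<in> I1 \<rightarrow>\<^sub>E A1" "g2(j := v2) \<in> I2 \<rightarrow>\<^sub>E A2"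
    using g assms(1-5) by (auto simp: PiE_iff extensional_def)
  then show "h (v0, g1(i := v1), g2(j := v2)) \<le> h' (v0, g1(i := v1), g2(j := v2))"
    using assms(6) by simp
  show "0 \<le> iid (p1 v0) (I1 - {i}) g1 * iid (p2 v0) (I2 - {j}) g2"
    using is_pmfD(2)[OF is_pmf_iid[OF is_pmf_p1[OF assms(1)]] g(1)]
      is_pmfD(2)[OF is_pmf_iid[OF is_pmf_p2[OF assms(1)]] g(2)] finI
    by (intro mult_nonneg_nonneg) auto
qed

text \<open>Position \<open>(i', j')\<close> shares both, one or no coordinates with the planted
  position \<open>(i, j)\<close>, and a coordinate that is not shared is an independent draw. The
  four cases become the four terms of the leakage bound.\<close>

lemma rest_pair:
  assumes v0: "v0 \<in> A0" and i': "i' \<in> I1" and j': "j' \<in> I2"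
  shows "rest i j (\<lambda>(v0, f1, f2). \<psi> v0 (f1 i') (f2 j')) v0 v1 v2
    = (if i' = i then (if j' = j then \<psi> v0 v1 v2 else \<Sum>b\<in>A2. p2 v0 b * \<psi> v0 v1 b)
       else (if j' = j then \<Sum>a\<in>A1. p1 v0 a * \<psi> v0 a v2
             else \<Sum>a\<in>A1. p1 v0 a * (\<Sum>b\<in>A2. p2 v0 b * \<psi> v0 a b)))"
proof -
  let ?w1 = "iid (p1 v0) (I1 - {i})" and ?w2 = "iid (p2 v0) (I2 - {j})"
  let ?G1 = "(I1 - {i}) \<rightarrow>\<^sub>E A1" and ?G2 = "(I2 - {j}) \<rightarrow>\<^sub>E A2"
  have "rest i j (\<lambda>(v0, f1, f2). \<psi> v0 (f1 i') (f2 j')) v0 v1 v2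
    = (\<Sum>g1\<in>?G1. ?w1 g1 * (\<Sum>g2\<in>?G2. ?w2 g2 * \<psi> v0 ((g1(i := v1)) i') ((g2(j := v2)) j')))"
    unfolding rest_def by (simp add: sum_distrib_left mult.assoc)
  also have "\<dots> = (\<Sum>g1\<in>?G1. ?w1 g1 * (if j' = j then \<psi> v0 ((g1(i := v1)) i') v2
      else \<Sum>b\<in>A2. p2 v0 b * \<psi> v0 ((g1(i := v1)) i') b))"
    by (subst sum_iid_update[OF is_pmf_p2[OF v0] finI(3) j',
          where h = "\<lambda>b. \<psi> v0 _ b"]) (rule refl)
  also have "\<dots> = (if i' = i then (if j' = j then \<psi> v0 v1 v2 else \<Sum>b\<in>A2. p2 v0 b * \<psi> v0 v1 b)
       else \<Sum>a\<in>A1. p1 v0 a * (if j' = j then \<psi> v0 a v2 else \<Sum>b\<in>A2. p2 v0 b * \<psi> v0 a b))"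
    by (rule sum_iid_update[OF is_pmf_p1[OF v0] finI(1) i',
          where h = "\<lambda>a. if j' = j then \<psi> v0 a v2 else \<Sum>b\<in>A2. p2 v0 b * \<psi> v0 a b"])
  finally show ?thesis by (simp cong: if_cong)
qed

section \<open>The tilted codebook law and its outputs\<close>

lemma \<mu>_nonneg: "c \<in> \<Gamma> \<Longrightarrow> 0 \<le> \<mu> c"
  unfolding \<mu>_def using base_nonneg wsum_nonneg[of c "\<lambda>_ _ _. 1"] N_pos by auto

lemma expectation_\<mu>:
  "(\<Sum>c\<in>\<Gamma>. \<mu> c * h c) = (\<Sum>i\<in>I1. \<Sum>j\<in>I2. E012 (rest i j h)) / N"
  using sum_planted[of "\<lambda>_ _ _. 1" h] by (simp add: \<mu>_def flip: sum_divide_distrib)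

lemma is_pmf_\<mu>: "is_pmf \<Gamma> \<mu>"
proof -
  have "E012 (rest i j (\<lambda>_. 1)) = 1" for i j
    using E012_1 by (simp add: E012_def rest_const)
  then have "(\<Sum>c\<in>\<Gamma>. \<mu> c) = 1"
    using expectation_\<mu>[of "\<lambda>_. 1"] finI by (simp add: N_def card_gt_0_iff)
  then show ?thesis using finite_\<Gamma> \<mu>_nonneg by (simp add: is_pmf_def)
qed

text \<open>The purpose of the tilt: the factor \<open>S c\<close> cancels the normaliser of the
  encoder. If \<open>S c = 0\<close>, all the nonnegative ratios vanish, hence so does every
  \<open>wsum\<close>, and both sides are 0.\<close>

lemma \<mu>_through:
  assumes c: "c \<in> \<Gamma>"
  shows "\<mu> c * through X enc U c y = base c * wsum (\<lambda>v0 v1 v2. kap U v0 v1 v2 y) c / N"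
proof (cases "S c = 0")
  case False
  obtain v0 f1 f2 where c': "c = (v0, f1, f2)" by (cases c)
  have "(\<Sum>x\<in>X. wsum (\<lambda>v0 v1 v2. px v0 v1 v2 x) c * U x y) = wsum (\<lambda>v0 v1 v2. kap U v0 v1 v2 y) c"
    unfolding c' wsum_def kap_def prod.case
    by (simp only: sum_distrib_right sum_distrib_left sum.swap[of _ _ X] mult.assoc)
  moreover have "through X enc U c y
    = (\<Sum>x\<in>X. wsum (\<lambda>v0 v1 v2. px v0 v1 v2 x) c * U x y) / S c"
    using False by (simp add: through_def enc_def sum_divide_distrib)
  ultimately have "S c * through X enc U c y = wsum (\<lambda>v0 v1 v2. kap U v0 v1 v2 y) c"
    using False by simp
  then show ?thesis by (simp add: \<mu>_def mult.assoc)
next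
  case True
  obtain v0 f1 f2 where c': "c = (v0, f1, f2)" by (cases c)
  have "\<forall>i\<in>I1. \<forall>j\<in>I2. ratio v0 (f1 i) (f2 j) = 0"
  proof (intro ballI)
    fix i j assume ij: "i \<in> I1" "j \<in> I2"
    have nn: "0 \<le> ratio v0 (f1 i) (f2 j)" if "i \<in> I1" "j \<in> I2" for i j
      using c that unfolding c' \<Gamma>_def by (intro ratio_nonneg) auto
    have "(\<Sum>j\<in>I2. ratio v0 (f1 i) (f2 j)) = 0"
      using True ij finI nn unfolding c' wsum_def
      by (simp add: sum_nonneg_eq_0_iff sum_nonneg)
    then show "ratio v0 (f1 i) (f2 j) = 0" using ij finI nn by (simp add: sum_nonneg_eq_0_iff)
  qed
  then have "wsum \<phi> c = 0" for \<phi> unfolding c' wsum_def by simp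
  then show ?thesis by (simp add: \<mu>_def True)
qed

lemma is_pmf_enc:
  assumes c: "c \<in> \<Gamma>"
  shows "is_pmf X (enc c)"
proof -
  obtain v0 f1 f2 where c': "c = (v0, f1, f2)" by (cases c)
  have v: "v0 \<in> A0" "\<And>i. i \<in> I1 \<Longrightarrow> f1 i \<in> A1" "\<And>j. j \<in> I2 \<Longrightarrow> f2 j \<in> A2"
    using c unfolding c' \<Gamma>_def by auto
  have s: "(SOME i. i \<in> I1) \<in> I1" "(SOME j. j \<in> I2) \<in> I2"
    using finI by (auto simp: some_in_eq)
  have fX: "finite X" using is_pmfD(1)[OF px] v s by blast
  show ?thesis
  proof (cases "S c = 0")
    case True
    then have "enc c = px v0 (f1 (SOME i. i \<in> I1)) (f2 (SOME j. j \<in> I2))"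
      by (auto simp: enc_def c')
    then show ?thesis using px v s by simp
  next
    case False
    have "(\<Sum>x\<in>X. wsum (\<lambda>v0 v1 v2. px v0 v1 v2 x) c)
      = (\<Sum>i\<in>I1. \<Sum>j\<in>I2. ratio v0 (f1 i) (f2 j) * (\<Sum>x\<in>X. px v0 (f1 i) (f2 j) x))"
      unfolding c' wsum_def prod.case sum_distrib_left by (simp only: sum.swap[of _ _ X])
    also have "\<dots> = S c"
      unfolding c' wsum_def using v is_pmfD(3)[OF px] by simp
    finally have "(\<Sum>x\<in>X. enc c x) = 1"
      using False by (simp add: enc_def flip: sum_divide_distrib)
    moreover have "0 \<le> enc c x" if "x \<in> X" for x
      using False c that is_pmfD(2)[OF px]
      by (auto simp: enc_def intro!: divide_nonneg_nonneg wsum_nonneg)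
    ultimately show ?thesis using fX by (simp add: is_pmf_def)
  qed
qed


lemma kap_nonneg:
  assumes "\<And>x. x \<in> X \<Longrightarrow> is_pmf Y (U x)" "v0 \<in> A0" "v1 \<in> A1" "v2 \<in> A2" "y \<in> Y"
  shows "0 \<le> kap U v0 v1 v2 y"
  using assms is_pmfD(2)[OF px] is_pmfD(2)[OF assms(1)] unfolding kap_def
  by (intro sum_nonneg mult_nonneg_nonneg) auto

lemma sum_outQ: "(\<Sum>c\<in>\<Gamma>. \<mu> c * through X enc U c y) = outQ U y"
proof -
  have "(\<Sum>c\<in>\<Gamma>. \<mu> c * through X enc U c y)
    = (\<Sum>i\<in>I1. \<Sum>j\<in>I2. E012 (\<lambda>v0 v1 v2. kap U v0 v1 v2 y * rest i j (\<lambda>_. 1) v0 v1 v2)) / N"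
    using sum_planted[of "\<lambda>v0 v1 v2. kap U v0 v1 v2 y" "\<lambda>_. 1"]
    by (simp add: \<mu>_through flip: sum_divide_distrib)
  also have "\<dots> = (\<Sum>i\<in>I1. \<Sum>j\<in>I2. outQ U y) / N"
    by (simp add: E012_def outQ_def kap0_def rest_const sum_distrib_left mult.assoc)
  also have "\<dots> = outQ U y" using finI by (simp add: N_def card_gt_0_iff)
  finally show ?thesis .
qed

text \<open>Once the normaliser has cancelled, the expectation is an average over the planted
  position. The bound \<open>H\<close> does not depend on the position, so the average over the
  \<open>N\<close> positions disappears.\<close>

lemma sum_through_le:
  assumes U: "\<And>x. x \<in> X \<Longrightarrow> is_pmf Y (U x)"
    and le: "\<And>i j v0 v1 v2 y. i \<in> I1 \<Longrightarrow> j \<in> I2 \<Longrightarrow> v0 \<in> A0 \<Longrightarrow> v1 \<in> A1 \<Longrightarrow> v2 \<in> A2 \<Longrightarrow> y \<in> Y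
      \<Longrightarrow> 0 < p0 v0 \<Longrightarrow> 0 < p12 v0 v1 v2 \<Longrightarrow> 0 < kap U v0 v1 v2 y
      \<Longrightarrow> rest i j (h y) v0 v1 v2 \<le> H y v0 v1 v2"
  shows "(\<Sum>c\<in>\<Gamma>. \<mu> c * (\<Sum>y\<in>Y. through X enc U c y * h y c))
    \<le> (\<Sum>y\<in>Y. E012 (\<lambda>v0 v1 v2. kap U v0 v1 v2 y * H y v0 v1 v2))"
proof -
  have "(\<Sum>c\<in>\<Gamma>. \<mu> c * (\<Sum>y\<in>Y. through X enc U c y * h y c))
    = (\<Sum>y\<in>Y. \<Sum>c\<in>\<Gamma>. \<mu> c * through X enc U c y * h y c)"
    unfolding sum_distrib_left by (subst sum.swap) (simp only: mult.assoc)
  also have "\<dots> = (\<Sum>y\<in>Y. (\<Sum>i\<in>I1. \<Sum>j\<in>I2.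
      E012 (\<lambda>v0 v1 v2. kap U v0 v1 v2 y * rest i j (h y) v0 v1 v2)) / N)"
    using sum_planted[of "\<lambda>v0 v1 v2. kap U v0 v1 v2 _" "h _"]
    by (simp add: \<mu>_through flip: sum_divide_distrib)
  also have "\<dots> \<le> (\<Sum>y\<in>Y. (\<Sum>i\<in>I1. \<Sum>j\<in>I2.
      E012 (\<lambda>v0 v1 v2. kap U v0 v1 v2 y * H y v0 v1 v2)) / N)"
  proof (intro sum_mono divide_right_mono E012_mono)
    fix y i j v0 v1 v2 assume *: "y \<in> Y" "i \<in> I1" "j \<in> I2" "v0 \<in> A0" "v1 \<in> A1" "v2 \<in> A2"
      "0 < p0 v0" "0 < p12 v0 v1 v2"
    show "kap U v0 v1 v2 y * rest i j (h y) v0 v1 v2 \<le> kap U v0 v1 v2 y * H y v0 v1 v2"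
    proof (cases "kap U v0 v1 v2 y = 0")
      case True then show ?thesis by (simp only: mult_zero_left)
    next
      case False
      then have "0 < kap U v0 v1 v2 y" using kap_nonneg[of Y U, OF U *(4-6,1)] by simp
      then show ?thesis using * le by (intro mult_left_mono) auto
    qed
  qed (use N_pos in auto)
  also have "\<dots> = (\<Sum>y\<in>Y. E012 (\<lambda>v0 v1 v2. kap U v0 v1 v2 y * H y v0 v1 v2))"
    using finI by (simp add: N_def card_gt_0_iff)
  finally show ?thesis .
qed

section \<open>Error terms of the threshold tests\<close>

lemma rest_le_const:
  assumes "v0 \<in> A0" "v1 \<in> A1" "v2 \<in> A2" "i \<in> I1" "j \<in> I2"
    and "\<And>f1 f2. f1 \<in> I1 \<rightarrow>\<^sub>E A1 \<Longrightarrow> f2 \<in> I2 \<rightarrow>\<^sub>E A2 \<Longrightarrow> f1 i = v1 \<Longrightarrow> f2 j = v2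
      \<Longrightarrow> h (v0, f1, f2) \<le> b"
  shows "rest i j h v0 v1 v2 \<le> b"
proof -
  have "rest i j h v0 v1 v2 \<le> rest i j (\<lambda>_. b) v0 v1 v2" by (rule rest_mono) (use assms in auto)
  also have "\<dots> = b * rest i j (\<lambda>_. 1) v0 v1 v2"
    by (simp add: rest_def sum_distrib_left mult.commute)
  finally show ?thesis using assms by (simp add: rest_const)
qed

text \<open>Indirect decoding: the super-codeword passes if any of its \<open>v1\<close> does, so a
  miss implies that the planted \<open>v1\<close> fails.\<close>

lemma miss_le1:
  assumes "\<And>x. x \<in> X \<Longrightarrow> is_pmf Y (U x)"
  shows "miss \<Gamma> \<mu> Y (through X enc U) (\<lambda>(v0, f1, f2) y. \<exists>i\<in>I1. \<tau> v0 (f1 i) y)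
    \<le> (\<Sum>y\<in>Y. E012 (\<lambda>v0 v1 v2. kap U v0 v1 v2 y * of_bool (\<not> \<tau> v0 v1 y)))"
  unfolding miss_def
  by (rule sum_through_le[OF assms]) (auto intro!: rest_le_const)

lemma miss_le2:
  assumes "\<And>x. x \<in> X \<Longrightarrow> is_pmf Y (U x)"
  shows "miss \<Gamma> \<mu> Y (through X enc U) (\<lambda>(v0, f1, f2) y. \<exists>j\<in>I2. \<tau> v0 (f2 j) y)
    \<le> (\<Sum>y\<in>Y. E012 (\<lambda>v0 v1 v2. kap U v0 v1 v2 y * of_bool (\<not> \<tau> v0 v2 y)))"
  unfolding miss_def
  by (rule sum_through_le[OF assms]) (auto intro!: rest_le_const)

text \<open>The tilt does not change the law of a single entry: at the planted position
  \<open>v1\<close> has the marginal \<open>p1\<close> of \<open>p12\<close>, elsewhere it is an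
  independent draw from \<open>p1\<close>. This is all that the test of a wrong super-codeword
  depends on, up to a union bound.\<close>

lemma sum_\<mu>_1:
  assumes i': "i' \<in> I1"
  shows "(\<Sum>c\<in>\<Gamma>. \<mu> c * (case c of (v0, f1, f2) \<Rightarrow> h v0 (f1 i')))
    = (\<Sum>v0\<in>A0. p0 v0 * (\<Sum>v1\<in>A1. p1 v0 v1 * h v0 v1))" (is "?l = ?r")
proof -
  obtain j' where j': "j' \<in> I2" using finI by auto
  let ?h = "\<lambda>(v0, f1, f2). h v0 (f1 i')"
  have rest: "rest i j ?h v0 v1 v2 = (if i' = i then h v0 v1 else \<Sum>a\<in>A1. p1 v0 a * h v0 a)"
    if "v0 \<in> A0" for i j v0 v1 v2
    using is_pmfD(3)[OF is_pmf_p2[OF that]]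
    by (subst rest_pair[OF that i' j', where \<psi> = "\<lambda>v0 a b. h v0 a"])
      (simp flip: sum_distrib_right)
  have "E012 (rest i j ?h) = ?r" for i j
  proof (cases "i' = i")
    case True
    show ?thesis
      by (simp only: E012_def rest if_P[OF True] p1_def sum_distrib_left sum_distrib_right mult.assoc cong: sum.cong)
  next
    case False
    define H where "H v0 = (\<Sum>a\<in>A1. p1 v0 a * h v0 a)" for v0
    have "E012 (rest i j ?h) = E012 (\<lambda>v0 v1 v2. H v0)"
      by (simp only: E012_def rest if_not_P[OF False] H_def cong: sum.cong)
    also have "\<dots> = (\<Sum>v0\<in>A0. p0 v0 * ((\<Sum>v1\<in>A1. \<Sum>v2\<in>A2. p12 v0 v1 v2) * H v0))"
      by (simp only: E012_def sum_distrib_left sum_distrib_right mult.assoc)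
    finally show ?thesis by (simp add: sum_p12 H_def)
  qed
  then show ?thesis unfolding expectation_\<mu> using finI by (simp add: N_def card_gt_0_iff)
qed

lemma sum_\<mu>_2:
  assumes j': "j' \<in> I2"
  shows "(\<Sum>c\<in>\<Gamma>. \<mu> c * (case c of (v0, f1, f2) \<Rightarrow> h v0 (f2 j')))
    = (\<Sum>v0\<in>A0. p0 v0 * (\<Sum>v2\<in>A2. p2 v0 v2 * h v0 v2))" (is "?l = ?r")
proof -
  obtain i' where i': "i' \<in> I1" using finI by auto
  let ?h = "\<lambda>(v0, f1, f2). h v0 (f2 j')"
  have rest: "rest i j ?h v0 v1 v2 = (if j' = j then h v0 v2 else \<Sum>b\<in>A2. p2 v0 b * h v0 b)"
    if "v0 \<in> A0" for i j v0 v1 v2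
    using is_pmfD(3)[OF is_pmf_p1[OF that]]
    by (subst rest_pair[OF that i' j', where \<psi> = "\<lambda>v0 a b. h v0 b"])
      (simp flip: sum_distrib_right)
  have "E012 (rest i j ?h) = ?r" for i j
  proof (cases "j' = j")
    case True
    have "E012 (rest i j ?h) = (\<Sum>v0\<in>A0. p0 v0 * (\<Sum>v1\<in>A1. \<Sum>v2\<in>A2. p12 v0 v1 v2 * h v0 v2))"
      by (simp only: E012_def rest if_P[OF True] sum_distrib_left mult.assoc cong: sum.cong)
    also have "\<dots> = ?r"
      by (simp only: p2_def sum_distrib_right sum.swap[of _ A2 A1])
    finally show ?thesis .
  next
    case False
    define H where "H v0 = (\<Sum>a\<in>A2. p2 v0 a * h v0 a)" for v0
    have "E012 (rest i j ?h) = E012 (\<lambda>v0 v1 v2. H v0)"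
      by (simp only: E012_def rest if_not_P[OF False] H_def cong: sum.cong)
    also have "\<dots> = (\<Sum>v0\<in>A0. p0 v0 * ((\<Sum>v1\<in>A1. \<Sum>v2\<in>A2. p12 v0 v1 v2) * H v0))"
      by (simp only: E012_def sum_distrib_left sum_distrib_right mult.assoc)
    finally show ?thesis by (simp add: sum_p12 H_def)
  qed
  then show ?thesis unfolding expectation_\<mu> using finI by (simp add: N_def card_gt_0_iff)
qed

lemma outQ_nonneg:
  assumes "\<And>x. x \<in> X \<Longrightarrow> is_pmf Y (U x)" "y \<in> Y"
  shows "0 \<le> outQ U y"
  unfolding outQ_def kap0_def using kap_nonneg[OF assms(1)] assms(2)
  by (intro sum_nonneg mult_nonneg_nonneg) auto

lemma sum_kap:
  assumes "\<And>x. x \<in> X \<Longrightarrow> is_pmf Y (U x)" "v0 \<in> A0" "v1 \<in> A1" "v2 \<in> A2"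
  shows "(\<Sum>y\<in>Y. kap U v0 v1 v2 y) = 1"
proof -
  have "(\<Sum>y\<in>Y. kap U v0 v1 v2 y) = (\<Sum>x\<in>X. px v0 v1 v2 x * (\<Sum>y\<in>Y. U x y))"
    unfolding kap_def sum_distrib_left by (rule sum.swap)
  then show ?thesis using is_pmfD(3)[OF assms(1)] is_pmfD(3)[OF px] assms by simp
qed

lemma false_alarm_union:
  fixes b :: real
  assumes "finite I" and U: "\<And>x. x \<in> X \<Longrightarrow> is_pmf Y (U x)"
    and marg: "\<And>i y. i \<in> I \<Longrightarrow> (\<Sum>c\<in>\<Gamma>. \<mu> c * of_bool (\<tau> i c y)) = M y"
    and le: "(\<Sum>y\<in>Y. outQ U y * M y) \<le> b"
  shows "false_alarm \<Gamma> \<mu> Y (through X enc U) (\<lambda>c y. \<exists>i\<in>I. \<tau> i c y) \<le> card I * b"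
proof -
  have "(\<Sum>c\<in>\<Gamma>. \<mu> c * of_bool (\<exists>i\<in>I. \<tau> i c y)) \<le> card I * M y" for y
  proof -
    have "(\<Sum>c\<in>\<Gamma>. \<mu> c * of_bool (\<exists>i\<in>I. \<tau> i c y)) \<le> (\<Sum>c\<in>\<Gamma>. \<mu> c * (\<Sum>i\<in>I. of_bool (\<tau> i c y)))"
    proof (intro sum_mono mult_left_mono \<mu>_nonneg)
      fix c
      show "of_bool (\<exists>i\<in>I. \<tau> i c y) \<le> (\<Sum>i\<in>I. of_bool (\<tau> i c y) :: real)"
      proof (cases "\<exists>i\<in>I. \<tau> i c y")
        case True
        then obtain i where i: "i \<in> I" "\<tau> i c y" by auto
        then have "(of_bool (\<tau> i c y) :: real) \<le> (\<Sum>i\<in>I. of_bool (\<tau> i c y))"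
          using assms(1) by (intro member_le_sum[of i I "\<lambda>i. of_bool (\<tau> i c y)"]) auto
        then show ?thesis using i by (auto simp: of_bool_def)
      qed (auto intro!: sum_nonneg)
    qed
    also have "\<dots> = (\<Sum>i\<in>I. \<Sum>c\<in>\<Gamma>. \<mu> c * of_bool (\<tau> i c y))"
      unfolding sum_distrib_left by (rule sum.swap)
    finally show ?thesis by (simp add: marg)
  qed
  then have "false_alarm \<Gamma> \<mu> Y (through X enc U) (\<lambda>c y. \<exists>i\<in>I. \<tau> i c y)
    \<le> (\<Sum>y\<in>Y. outQ U y * (card I * M y))"
    unfolding false_alarm_def sum_outQ
    by (intro sum_mono mult_left_mono outQ_nonneg[OF U]) auto
  also have "\<dots> = card I * (\<Sum>y\<in>Y. outQ U y * M y)" by (simp add: sum_distrib_left ac_simps)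
  also have "\<dots> \<le> card I * b" using le by (intro mult_left_mono) auto
  finally show ?thesis .
qed

text \<open>Only an inequality, because \<open>kap1\<close> is identically 0 when
  \<open>p1 v0 v1 = 0\<close>.\<close>

lemma sum_kap1:
  assumes U: "\<And>x. x \<in> X \<Longrightarrow> is_pmf Y (U x)" and v: "v0 \<in> A0" "v1 \<in> A1"
  shows "(\<Sum>y\<in>Y. kap1 U v0 v1 y) \<le> 1"
proof -
  have "(\<Sum>y\<in>Y. kap1 U v0 v1 y) = (\<Sum>v2\<in>A2. p12 v0 v1 v2 / p1 v0 v1 * (\<Sum>y\<in>Y. kap U v0 v1 v2 y))"
    unfolding kap1_def sum_distrib_left by (rule sum.swap)
  also have "\<dots> = p1 v0 v1 / p1 v0 v1"
    using v by (simp add: sum_kap[OF U] p1_def flip: sum_divide_distrib)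
  finally show ?thesis by simp
qed

lemma sum_kap2:
  assumes U: "\<And>x. x \<in> X \<Longrightarrow> is_pmf Y (U x)" and v: "v0 \<in> A0" "v2 \<in> A2"
  shows "(\<Sum>y\<in>Y. kap2 U v0 v2 y) \<le> 1"
proof -
  have "(\<Sum>y\<in>Y. kap2 U v0 v2 y) = (\<Sum>v1\<in>A1. p12 v0 v1 v2 / p2 v0 v2 * (\<Sum>y\<in>Y. kap U v0 v1 v2 y))"
    unfolding kap2_def sum_distrib_left by (rule sum.swap)
  also have "\<dots> = p2 v0 v2 / p2 v0 v2"
    using v by (simp add: sum_kap[OF U] p2_def flip: sum_divide_distrib)
  finally show ?thesis by simp
qed

text \<open>Where the test passes, \<open>outQ\<close> is at most \<open>k / \<gamma>\<close>.
  Replacing the output law by this bound leaves a kernel of mass at most 1 in place of the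
  indicator.\<close>

lemma threshold_mass:
  assumes U: "\<And>x. x \<in> X \<Longrightarrow> is_pmf Y (U x)" and A: "\<And>v0. v0 \<in> A0 \<Longrightarrow> is_pmf A (p v0)"
    and k: "\<And>v0 v. v0 \<in> A0 \<Longrightarrow> v \<in> A \<Longrightarrow> (\<Sum>y\<in>Y. k v0 v y) \<le> 1"
    and k0: "\<And>v0 v y. v0 \<in> A0 \<Longrightarrow> v \<in> A \<Longrightarrow> y \<in> Y \<Longrightarrow> 0 \<le> k v0 v y"
    and \<gamma>: "0 < \<gamma>"
  shows "(\<Sum>y\<in>Y. outQ U y * (\<Sum>v0\<in>A0. p0 v0 * (\<Sum>v\<in>A. p v0 v * of_bool (\<gamma> * outQ U y < k v0 v y))))
    \<le> 1 / \<gamma>"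
proof -
  note pA = is_pmfD[OF A]
  have "(\<Sum>y\<in>Y. outQ U y * (\<Sum>v0\<in>A0. p0 v0 * (\<Sum>v\<in>A. p v0 v * of_bool (\<gamma> * outQ U y < k v0 v y))))
    \<le> (\<Sum>y\<in>Y. \<Sum>v0\<in>A0. p0 v0 * (\<Sum>v\<in>A. p v0 v * (k v0 v y / \<gamma>)))"
    unfolding sum_distrib_left
  proof (intro sum_mono)
    fix y v0 v assume *: "y \<in> Y" "v0 \<in> A0" "v \<in> A"
    have "outQ U y * of_bool (\<gamma> * outQ U y < k v0 v y) \<le> k v0 v y / \<gamma>"
      using \<gamma> k0[of v0 v y] * by (auto simp: of_bool_def field_simps)
    then have "p0 v0 * p v0 v * (outQ U y * of_bool (\<gamma> * outQ U y < k v0 v y))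
      \<le> p0 v0 * p v0 v * (k v0 v y / \<gamma>)"
      using * pA by (intro mult_left_mono mult_nonneg_nonneg) auto
    then show "outQ U y * (p0 v0 * (p v0 v * of_bool (\<gamma> * outQ U y < k v0 v y)))
      \<le> p0 v0 * (p v0 v * (k v0 v y / \<gamma>))" by (simp only: ac_simps)
  qed
  also have "\<dots> = (\<Sum>v0\<in>A0. p0 v0 * (\<Sum>v\<in>A. p v0 v * (\<Sum>y\<in>Y. k v0 v y))) / \<gamma>"
    by (simp only: sum.swap[of _ _ Y] sum_distrib_left sum_divide_distrib times_divide_eq_right)
  also have "\<dots> \<le> (\<Sum>v0\<in>A0. p0 v0 * (\<Sum>v\<in>A. p v0 v * 1)) / \<gamma>"
    using \<gamma> k pA by (intro divide_right_mono sum_mono mult_left_mono) auto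
  also have "\<dots> = 1 / \<gamma>" using pA is_pmfD(3)[OF p0] by simp
  finally show ?thesis .
qed

lemma kap1_nonneg:
  assumes U: "\<And>x. x \<in> X \<Longrightarrow> is_pmf Y (U x)" and v: "v0 \<in> A0" "v1 \<in> A1" "y \<in> Y"
  shows "0 \<le> kap1 U v0 v1 y"
  unfolding kap1_def using kap_nonneg[OF U] v is_pmfD(2)[OF is_pmf_p1]
  by (intro sum_nonneg mult_nonneg_nonneg divide_nonneg_nonneg) auto

lemma kap2_nonneg:
  assumes U: "\<And>x. x \<in> X \<Longrightarrow> is_pmf Y (U x)" and v: "v0 \<in> A0" "v2 \<in> A2" "y \<in> Y"
  shows "0 \<le> kap2 U v0 v2 y"
  unfolding kap2_def using kap_nonneg[OF U] v is_pmfD(2)[OF is_pmf_p2]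
  by (intro sum_nonneg mult_nonneg_nonneg divide_nonneg_nonneg) auto

lemma false_alarm_le1:
  assumes U: "\<And>x. x \<in> X \<Longrightarrow> is_pmf Y (U x)" and \<gamma>: "0 < \<gamma>"
  shows "false_alarm \<Gamma> \<mu> Y (through X enc U)
      (\<lambda>(v0, f1, f2) y. \<exists>i\<in>I1. \<gamma> * outQ U y < kap1 U v0 (f1 i) y) \<le> card I1 / \<gamma>"
proof -
  have "false_alarm \<Gamma> \<mu> Y (through X enc U)
      (\<lambda>c y. \<exists>i\<in>I1. (case c of (v0, f1, f2) \<Rightarrow> \<gamma> * outQ U y < kap1 U v0 (f1 i) y))
    \<le> card I1 * (1 / \<gamma>)"
    using sum_\<mu>_1[where h = "\<lambda>v0 v. of_bool (\<gamma> * outQ U _ < kap1 U v0 v _)"]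
    by (intro false_alarm_union[OF finI(1) U _
        threshold_mass[OF U is_pmf_p1 sum_kap1[OF U] kap1_nonneg[OF U] \<gamma>]])
      (auto simp: case_prod_unfold)
  then show ?thesis by (simp add: case_prod_unfold)
qed

lemma false_alarm_le2:
  assumes U: "\<And>x. x \<in> X \<Longrightarrow> is_pmf Y (U x)" and \<gamma>: "0 < \<gamma>"
  shows "false_alarm \<Gamma> \<mu> Y (through X enc U)
      (\<lambda>(v0, f1, f2) y. \<exists>j\<in>I2. \<gamma> * outQ U y < kap2 U v0 (f2 j) y) \<le> card I2 / \<gamma>"
proof -
  have "false_alarm \<Gamma> \<mu> Y (through X enc U)
      (\<lambda>c y. \<exists>i\<in>I2. (case c of (v0, f1, f2) \<Rightarrow> \<gamma> * outQ U y < kap2 U v0 (f2 i) y))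
    \<le> card I2 * (1 / \<gamma>)"
    using sum_\<mu>_2[where h = "\<lambda>v0 v. of_bool (\<gamma> * outQ U _ < kap2 U v0 v _)"]
    by (intro false_alarm_union[OF finI(3) U _
        threshold_mass[OF U is_pmf_p2 sum_kap2[OF U] kap2_nonneg[OF U] \<gamma>]])
      (auto simp: case_prod_unfold)
  then show ?thesis by (simp add: case_prod_unfold)
qed

end

section \<open>Leakage of the superposition code\<close>

context superposition begin

lemma rest_jensen:
  assumes v: "v0 \<in> A0" "v1 \<in> A1" "v2 \<in> A2" and ij: "i \<in> I1" "j \<in> I2"
    and pos: "\<And>f1 f2. f1 \<in> I1 \<rightarrow>\<^sub>E A1 \<Longrightarrow> f2 \<in> I2 \<rightarrow>\<^sub>E A2 \<Longrightarrow> 0 < h (v0, f1, f2)"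
  shows "rest i j (\<lambda>c. log 2 (h c)) v0 v1 v2 \<le> log 2 (rest i j h v0 v1 v2)"
proof -
  let ?G1 = "(I1 - {i}) \<rightarrow>\<^sub>E A1" and ?G2 = "(I2 - {j}) \<rightarrow>\<^sub>E A2"
  let ?w = "\<lambda>(g1, g2). iid (p1 v0) (I1 - {i}) g1 * iid (p2 v0) (I2 - {j}) g2"
  have w: "is_pmf (?G1 \<times> ?G2) ?w"
    using finI by (intro is_pmf_Times is_pmf_iid is_pmf_p1 is_pmf_p2 v) auto
  have rest: "rest i j h v0 v1 v2 = (\<Sum>g\<in>?G1 \<times> ?G2. ?w g *
      (case g of (g1, g2) \<Rightarrow> h (v0, g1(i := v1), g2(j := v2))))" for h
    unfolding rest_def by (simp add: sum.cartesian_product')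
  have pos': "0 < h (v0, g1(i := v1), g2(j := v2))" if "g1 \<in> ?G1" "g2 \<in> ?G2" for g1 g2
    using that v ij by (intro pos) (auto simp: PiE_iff extensional_def)
  have "(\<Sum>g\<in>?G1 \<times> ?G2. ?w g * log 2 (case g of (g1, g2) \<Rightarrow> h (v0, g1(i := v1), g2(j := v2))))
    \<le> log 2 (rest i j h v0 v1 v2)"
    unfolding rest using pos' by (intro jensen_log[OF w]) auto
  then show ?thesis unfolding rest by (simp add: case_prod_unfold)
qed

text \<open>A count of positions: one pair is the planted one, fewer than \<open>card I2\<close>
  pairs share only \<open>v1\<close>, fewer than \<open>card I1\<close> share only
  \<open>v2\<close>, and at most \<open>N\<close> share neither.\<close>

lemma rest_wsum_le:
  assumes v: "v0 \<in> A0" "v1 \<in> A1" "v2 \<in> A2" and ij: "i \<in> I1" "j \<in> I2"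
    and U: "\<And>x. x \<in> X \<Longrightarrow> is_pmf Z (U x)" and z: "z \<in> Z"
  shows "rest i j (wsum (\<lambda>v0 v1 v2. kap U v0 v1 v2 z)) v0 v1 v2
    \<le> ratio v0 v1 v2 * kap U v0 v1 v2 z + card I2 * kap1 U v0 v1 z + card I1 * kap2 U v0 v2 z
      + N * kap0 U v0 z"
proof -
  let ?k = "\<lambda>a b. kap U v0 a b z"
  let ?\<psi> = "\<lambda>v0 a b. ratio v0 a b * kap U v0 a b z"
  note kn = kap_nonneg[of Z U, OF U]
  have k1: "(\<Sum>b\<in>A2. p2 v0 b * ?\<psi> v0 v1 b) = kap1 U v0 v1 z"
    using v unfolding kap1_def mult.assoc[symmetric] by (intro sum.cong) (auto simp: p2_ratio)
  have k2: "(\<Sum>a\<in>A1. p1 v0 a * ?\<psi> v0 a v2) = kap2 U v0 v2 z"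
    using v unfolding kap2_def mult.assoc[symmetric] by (intro sum.cong) (auto simp: p1_ratio)
  have k0: "(\<Sum>a\<in>A1. p1 v0 a * (\<Sum>b\<in>A2. p2 v0 b * ?\<psi> v0 a b)) = kap0 U v0 z"
    using v unfolding kap0_def sum_distrib_left
    by (intro sum.cong) (auto simp flip: mult.assoc simp: p1_p2_ratio[unfolded mult.assoc[symmetric]])
  have nn: "0 \<le> ?\<psi> v0 v1 v2" "0 \<le> kap1 U v0 v1 z" "0 \<le> kap2 U v0 v2 z" "0 \<le> kap0 U v0 z"
    using v z kn kap1_nonneg[of Z U, OF U] kap2_nonneg[of Z U, OF U] ratio_nonneg
    by (auto simp: kap0_def intro!: sum_nonneg)
  have "rest i j (wsum (\<lambda>v0 v1 v2. kap U v0 v1 v2 z)) v0 v1 v2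
    = (\<Sum>i'\<in>I1. \<Sum>j'\<in>I2. rest i j (\<lambda>(v0, f1, f2). ?\<psi> v0 (f1 i') (f2 j')) v0 v1 v2)"
    unfolding rest_def wsum_def prod.case sum_distrib_left
    by (simp only: sum.swap[of _ I1 "(I1 - {i}) \<rightarrow>\<^sub>E A1"] sum.swap[of _ I2 "(I1 - {i}) \<rightarrow>\<^sub>E A1"]
        sum.swap[of _ I1 "(I2 - {j}) \<rightarrow>\<^sub>E A2"] sum.swap[of _ I2 "(I2 - {j}) \<rightarrow>\<^sub>E A2"])
  also have "\<dots> \<le> (\<Sum>i'\<in>I1. \<Sum>j'\<in>I2. (if i' = i then if j' = j then ?\<psi> v0 v1 v2 else 0 else 0)
      + (if i' = i then kap1 U v0 v1 z else 0) + (if j' = j then kap2 U v0 v2 z else 0) + kap0 U v0 z)"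
  proof (intro sum_mono)
    fix i' j' assume ij': "i' \<in> I1" "j' \<in> I2"
    show "rest i j (\<lambda>(v0, f1, f2). ?\<psi> v0 (f1 i') (f2 j')) v0 v1 v2
      \<le> (if i' = i then if j' = j then ?\<psi> v0 v1 v2 else 0 else 0)
      + (if i' = i then kap1 U v0 v1 z else 0) + (if j' = j then kap2 U v0 v2 z else 0) + kap0 U v0 z"
      unfolding rest_pair[OF v(1) ij', where \<psi> = ?\<psi>] k1 k2 k0 using nn by auto
  qed
  also have "\<dots> = ?\<psi> v0 v1 v2 + card I2 * kap1 U v0 v1 z + card I1 * kap2 U v0 v2 z + N * kap0 U v0 z"
  proof -
    have "(\<Sum>i'\<in>I1. \<Sum>j'\<in>I2. if i' = i then if j' = j then ?\<psi> v0 v1 v2 else 0 else 0)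
      = (\<Sum>i'\<in>I1. if i' = i then ?\<psi> v0 v1 v2 else 0)"
      using finI ij by (intro sum.cong) auto
    then have "(\<Sum>i'\<in>I1. \<Sum>j'\<in>I2. if i' = i then if j' = j then ?\<psi> v0 v1 v2 else 0 else 0) = ?\<psi> v0 v1 v2"
      using finI ij by simp
    moreover have "(\<Sum>i'\<in>I1. \<Sum>j'\<in>I2. if i' = i then kap1 U v0 v1 z else 0) = card I2 * kap1 U v0 v1 z"
      using finI ij by (subst sum.swap) simp
    moreover have "(\<Sum>i'\<in>I1. \<Sum>j'\<in>I2. if j' = j then kap2 U v0 v2 z else 0) = card I1 * kap2 U v0 v2 z"
      using finI ij by simp
    ultimately show ?thesis by (simp add: sum.distrib N_def)
  qed
  finally show ?thesis .
qed

text \<open>The random normaliser \<open>S\<close> is not covered by Jensen's inequality. Replacing it by its mean \<open>N\<close>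
  costs a factor \<open>max 1 (N / S)\<close>, and in the tilted law the expected logarithm of this factor is
  bounded by \<open>1 / ln 2\<close>.\<close>
lemma cover_le:
  assumes U: "\<And>x. x \<in> X \<Longrightarrow> is_pmf Z (U x)" and K: "0 < K" and Z: "finite Z"
  shows "cover \<Gamma> \<mu> Z (through X enc U) K
    \<le> 1 / ln 2 + (\<Sum>z\<in>Z. E012 (\<lambda>v0 v1 v2. kap U v0 v1 v2 z * log 2 (1 +
        (ratio v0 v1 v2 * kap U v0 v1 v2 z / N + kap1 U v0 v1 z / card I1
          + kap2 U v0 v2 z / card I2 + kap0 U v0 z) / (K * outQ U z))))"
proof -
  let ?k = "through X enc U" and ?W = "\<lambda>z. wsum (\<lambda>v0 v1 v2. kap U v0 v1 v2 z)"
  let ?G = "\<lambda>z c. ?W z c / (N * K * outQ U z)"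
  have pk: "is_pmf Z (?k c)" if "c \<in> \<Gamma>" for c
    using that U by (intro is_pmf_through is_pmf_enc) auto
  note k = is_pmfD[OF pk]
  have W: "0 \<le> ?W z c" if "c \<in> \<Gamma>" "z \<in> Z" for z c
    using that kap_nonneg[of Z U, OF U] by (intro wsum_nonneg) auto
  have Qk: "\<mu> c * ?k c z \<le> outQ U z" if "c \<in> \<Gamma>" "z \<in> Z" for c z
    unfolding sum_outQ[symmetric] using that k \<mu>_nonneg finite_\<Gamma>
    by (intro member_le_sum[of c \<Gamma> "\<lambda>c. \<mu> c * ?k c z"]) auto
  have Qn: "0 \<le> outQ U z" if "z \<in> Z" for z using outQ_nonneg[of Z U, OF U] that by auto
  \<comment> \<open>The constant is weighted by \<open>base\<close> and not by \<open>\<mu>\<close>: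
    the factor \<open>S c / N\<close> in \<open>\<mu>\<close> keeps the contribution of
    \<open>log 2 (N / S c)\<close> bounded when \<open>S c\<close> is small.\<close>
  have split: "\<mu> c * (\<Sum>z\<in>Z. ?k c z * log 2 (1 + ?k c z / (K * outQ U z)))
    \<le> base c * (1 / ln 2) + \<mu> c * (\<Sum>z\<in>Z. ?k c z * log 2 (1 + ?G z c))" if c: "c \<in> \<Gamma>" for c
  proof (cases "\<mu> c = 0")
    case True then show ?thesis using base_nonneg[OF c] by simp
  next
    case False
    let ?m = "max 1 (N / S c)"
    have b: "base c > 0" and S: "S c > 0"
      using False base_nonneg[OF c] wsum_nonneg[OF c, of "\<lambda>_ _ _. 1"]
      by (auto simp: \<mu>_def order.strict_iff_order)
    then have m: "\<mu> c > 0" using N_pos by (simp add: \<mu>_def)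
    have "?k c z * log 2 (1 + ?k c z / (K * outQ U z))
      \<le> ?k c z * (log 2 ?m + log 2 (1 + ?G z c))" if z: "z \<in> Z" for z
    proof (cases "?k c z = 0")
      case False
      then have kp: "?k c z > 0" using k(2)[OF c z] by simp
      then have Q: "outQ U z > 0" using Qk[OF c z] m by (meson mult_pos_pos order_less_le_trans)
      have "?k c z = ?W z c / S c"
        using \<mu>_through[OF c, of U z] b S N_pos by (simp add: \<mu>_def field_simps)
      then have kG: "?k c z / (K * outQ U z) = ?G z c * (N / S c)"
        using N_pos by simp
      have G: "?G z c \<ge> 0" using W[OF c z] N_pos K Q by simp
      \<comment> \<open>\<open>?m\<close> dominates both 1 and \<open>N / S c\<close>, so the random
        normaliser can be factored out of the argument of the logarithm.\<close>
      have "1 + ?G z c * (N / S c) \<le> ?m + ?G z c * ?m"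
        using G by (intro add_mono mult_left_mono) auto
      then have le: "1 + ?G z c * (N / S c) \<le> ?m * (1 + ?G z c)"
        by (simp only: distrib_left mult_1_right mult.commute)
      have "log 2 (1 + ?G z c * (N / S c)) \<le> log 2 (?m * (1 + ?G z c))"
      proof (rule log_mono)
        show "0 < 1 + ?G z c * (N / S c)"
          using G N_pos S by (intro add_pos_nonneg mult_nonneg_nonneg) auto
      qed (use le in auto)
      also have "\<dots> = log 2 ?m + log 2 (1 + ?G z c)"
        using G by (intro log_mult_pos) auto
      finally show ?thesis unfolding kG using kp by (intro mult_left_mono) auto
    qed simp
    then have "(\<Sum>z\<in>Z. ?k c z * log 2 (1 + ?k c z / (K * outQ U z)))
      \<le> (\<Sum>z\<in>Z. ?k c z * (log 2 ?m + log 2 (1 + ?G z c)))" by (rule sum_mono)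
    also have "\<dots> = log 2 ?m + (\<Sum>z\<in>Z. ?k c z * log 2 (1 + ?G z c))"
      using k(3)[OF c] by (simp add: distrib_left sum.distrib flip: sum_distrib_right)
    finally have "\<mu> c * (\<Sum>z\<in>Z. ?k c z * log 2 (1 + ?k c z / (K * outQ U z)))
      \<le> \<mu> c * log 2 ?m + \<mu> c * (\<Sum>z\<in>Z. ?k c z * log 2 (1 + ?G z c))"
      using m by (simp flip: distrib_left)
    moreover have "\<mu> c * log 2 ?m \<le> base c * (1 / ln 2)"
      using mult_left_mono[OF mult_log_le[of "S c" N], of "base c"] S N_pos b
      by (simp add: \<mu>_def)
    ultimately show ?thesis by linarith
  qed
  have "cover \<Gamma> \<mu> Z ?k K \<le> (\<Sum>c\<in>\<Gamma>. base c * (1 / ln 2) + \<mu> c * (\<Sum>z\<in>Z. ?k c z * log 2 (1 + ?G z c)))"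
    unfolding cover_def sum_outQ by (intro sum_mono split)
  also have "\<dots> = 1 / ln 2 + (\<Sum>c\<in>\<Gamma>. \<mu> c * (\<Sum>z\<in>Z. ?k c z * log 2 (1 + ?G z c)))"
    by (simp only: sum.distrib sum_distrib_right[symmetric] sum_base mult_1_left)
  also have "(\<Sum>c\<in>\<Gamma>. \<mu> c * (\<Sum>z\<in>Z. ?k c z * log 2 (1 + ?G z c)))
    \<le> (\<Sum>z\<in>Z. E012 (\<lambda>v0 v1 v2. kap U v0 v1 v2 z * log 2 (1 +
        (ratio v0 v1 v2 * kap U v0 v1 v2 z / N + kap1 U v0 v1 z / card I1
          + kap2 U v0 v2 z / card I2 + kap0 U v0 z) / (K * outQ U z))))"
  proof (rule sum_through_le[OF U])
    fix i j v0 v1 v2 z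
    assume ij: "i \<in> I1" "j \<in> I2" and v: "v0 \<in> A0" "v1 \<in> A1" "v2 \<in> A2" and z: "z \<in> Z"
    let ?a = "N * K * outQ U z"
    let ?R = "ratio v0 v1 v2 * kap U v0 v1 v2 z / N + kap1 U v0 v1 z / card I1
          + kap2 U v0 v2 z / card I2 + kap0 U v0 z"
    have a: "0 \<le> ?a" using N_pos K Qn[OF z] by simp
    have G: "0 \<le> ?G z c" if "c \<in> \<Gamma>" for c using W[OF that z] a by simp
    \<comment> \<open>All denominators are deterministic now, so Jensen's inequality can average
      over everything but the planted pair.\<close>
    have "rest i j (\<lambda>c. log 2 (1 + ?G z c)) v0 v1 v2 \<le> log 2 (rest i j (\<lambda>c. 1 + ?G z c) v0 v1 v2)"
      using v G by (intro rest_jensen[OF v ij] add_pos_nonneg) (auto simp: \<Gamma>_def)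
    also have "rest i j (\<lambda>c. 1 + ?G z c) v0 v1 v2 = 1 + rest i j (?W z) v0 v1 v2 / ?a"
    proof -
      have "rest i j (\<lambda>c. 1 + ?G z c) v0 v1 v2 = rest i j (\<lambda>c. 1) v0 v1 v2 + rest i j (?W z) v0 v1 v2 / ?a"
        unfolding rest_def by (simp only: distrib_left sum.distrib sum_divide_distrib times_divide_eq_right)
      then show ?thesis by (simp only: rest_const[OF v(1)])
    qed
    also have "log 2 \<dots> \<le> log 2 (1 + ?R / (K * outQ U z))"
    proof (rule log_mono)
      have "rest i j (\<lambda>_. 0) v0 v1 v2 \<le> rest i j (?W z) v0 v1 v2"
        using v W z by (intro rest_mono[OF v ij]) (auto simp: \<Gamma>_def)
      then have "0 \<le> rest i j (?W z) v0 v1 v2" by (simp add: rest_def)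
      then show "0 < 1 + rest i j (?W z) v0 v1 v2 / ?a" using a by (intro add_pos_nonneg) auto
      have "rest i j (?W z) v0 v1 v2 / ?a \<le> (N * ?R) / ?a"
      proof (intro divide_right_mono a)
        have "N * ?R = ratio v0 v1 v2 * kap U v0 v1 v2 z + card I2 * kap1 U v0 v1 z
          + card I1 * kap2 U v0 v2 z + N * kap0 U v0 z"
          using finI unfolding N_def by (simp add: field_simps card_gt_0_iff)
        then show "rest i j (?W z) v0 v1 v2 \<le> N * ?R"
          using rest_wsum_le[OF v ij, of Z U z] U z by simp
      qed
      also have "\<dots> = ?R / (K * outQ U z)" using N_pos by (simp add: mult.assoc)
      finally show "1 + rest i j (?W z) v0 v1 v2 / ?a \<le> 1 + ?R / (K * outQ U z)" by simp
    qed simp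
    finally show "rest i j (\<lambda>c. log 2 (1 + ?G z c)) v0 v1 v2 \<le> log 2 (1 + ?R / (K * outQ U z))" .
  qed auto
  finally show ?thesis by simp
qed

end

text \<open>Thresholds and index set sizes stay free until the block length enters. The terms
  \<open>card I1 / \<gamma>1\<close> and \<open>card I2 / \<gamma>2\<close> arise because any entry
  of a wrong super-codeword may trigger the test.\<close>

lemma (in superposition) one_shot:
  fixes U1 :: "'x \<Rightarrow> 'y1 \<Rightarrow> real" and U2 :: "'x \<Rightarrow> 'y2 \<Rightarrow> real" and U3 :: "'x \<Rightarrow> 'z \<Rightarrow> real"
    and Ms :: "'m set" and L :: "'l set"
  assumes M: "finite Ms" "Ms \<noteq> {}" and L: "finite L" "L \<noteq> {}"
    and U: "\<And>x. x \<in> X \<Longrightarrow> is_pmf Y1 (U1 x)" "\<And>x. x \<in> X \<Longrightarrow> is_pmf Y2 (U2 x)"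
      "\<And>x. x \<in> X \<Longrightarrow> is_pmf Z (U3 x)"
    and fin: "finite X" "finite Y1" "finite Y2" "finite Z"
    and \<gamma>: "0 < \<gamma>1" "0 < \<gamma>2" and \<theta>: "0 \<le> \<theta>"
  shows "has_code Ms X Y1 Y2 Z U1 U2 U3 \<theta>
      ((\<Sum>y\<in>Y1. E012 (\<lambda>v0 v1 v2. kap U1 v0 v1 v2 y * of_bool (\<not> \<gamma>1 * outQ U1 y < kap1 U1 v0 v1 y)))
          + real (card Ms * card L) * (card I1 / \<gamma>1)
        + ((\<Sum>y\<in>Y2. E012 (\<lambda>v0 v1 v2. kap U2 v0 v1 v2 y * of_bool (\<not> \<gamma>2 * outQ U2 y < kap2 U2 v0 v2 y)))
          + real (card Ms * card L) * (card I2 / \<gamma>2))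
        + \<theta> * (1 / ln 2 + (\<Sum>z\<in>Z. E012 (\<lambda>v0 v1 v2. kap U3 v0 v1 v2 z * log 2 (1 +
            (ratio v0 v1 v2 * kap U3 v0 v1 v2 z / N + kap1 U3 v0 v1 z / card I1
              + kap2 U3 v0 v2 z / card I2 + kap0 U3 v0 z) / (card L * outQ U3 z))))))"
    (is "has_code _ _ _ _ _ _ _ _ _ ?B")
proof -
  let ?T1 = "\<lambda>(v0, f1, f2) y. \<exists>i\<in>I1. \<gamma>1 * outQ U1 y < kap1 U1 v0 (f1 i) y"
  let ?T2 = "\<lambda>(v0, f1, f2) y. \<exists>j\<in>I2. \<gamma>2 * outQ U2 y < kap2 U2 v0 (f2 j) y"
  let ?B' = "miss \<Gamma> \<mu> Y1 (through X enc U1) ?T1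
          + real (card Ms * card L) * false_alarm \<Gamma> \<mu> Y1 (through X enc U1) ?T1
        + (miss \<Gamma> \<mu> Y2 (through X enc U2) ?T2
          + real (card Ms * card L) * false_alarm \<Gamma> \<mu> Y2 (through X enc U2) ?T2)
        + \<theta> * cover \<Gamma> \<mu> Z (through X enc U3) (card L)"
  have "has_code Ms X Y1 Y2 Z U1 U2 U3 \<theta> ?B'"
    by (rule random_code[OF is_pmf_\<mu> M L _ _ _ _ fin \<theta> refl]) (auto intro: is_pmf_enc U)
  moreover have "?B' \<le> ?B"
    using L by (intro add_mono mult_left_mono miss_le1[OF U(1)] miss_le2[OF U(2)]
        false_alarm_le1[OF U(1)] false_alarm_le2[OF U(2)] cover_le[OF U(3)] \<gamma> \<theta> fin)
      (auto simp: card_gt_0_iff)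
  ultimately show ?thesis by (rule has_code_mono)
qed

section \<open>Sums over sequences of fixed length\<close>

lemma lists_n_0: "lists_n 0 = {[]}"
  by (auto simp: lists_n_def)

lemma lists_n_Suc: "lists_n (Suc n) = (\<lambda>(a, xs). a # xs) ` (UNIV \<times> lists_n n)"
  by (auto simp: lists_n_def image_iff length_Suc_conv)

lemma finite_lists_n [simp]: "finite (lists_n n :: 'a::finite list set)"
  by (induction n) (auto simp: lists_n_0 lists_n_Suc)

lemma sum_lists_Suc:
  "(\<Sum>xs\<in>lists_n (Suc n). F xs) = (\<Sum>a\<in>UNIV. \<Sum>xs\<in>lists_n n. F (a # xs))"
  unfolding lists_n_Suc by (subst sum.reindex) (auto simp: inj_on_def sum.cartesian_product')

lemma sum_lists_prod:
  fixes f :: "nat \<Rightarrow> 'a::finite \<Rightarrow> real"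
  shows "(\<Sum>xs\<in>lists_n n. \<Prod>i<n. f i (xs ! i)) = (\<Prod>i<n. \<Sum>a\<in>UNIV. f i a)"
proof (induction n arbitrary: f)
  case 0
  then show ?case by (simp add: lists_n_0)
next
  case (Suc n)
  have "(\<Sum>xs\<in>lists_n (Suc n). \<Prod>i<Suc n. f i (xs ! i))
    = (\<Sum>a\<in>UNIV. f 0 a * (\<Sum>xs\<in>lists_n n. \<Prod>i<n. f (Suc i) (xs ! i)))"
    by (simp add: sum_lists_Suc prod.lessThan_Suc_shift sum_distrib_left del: prod.lessThan_Suc)
  also have "\<dots> = (\<Prod>i<Suc n. \<Sum>a\<in>UNIV. f i a)"
    by (simp only: Suc.IH[of "\<lambda>i. f (Suc i)"] prod.lessThan_Suc_shift sum_distrib_right)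
  finally show ?case .
qed

lemma is_pmf_lists:
  fixes p :: "nat \<Rightarrow> 'a::finite \<Rightarrow> real"
  assumes "\<And>i. i < n \<Longrightarrow> is_pmf UNIV (p i)"
  shows "is_pmf (lists_n n) (\<lambda>xs. \<Prod>i<n. p i (xs ! i))"
  using is_pmfD[OF assms] by (auto simp: is_pmf_def sum_lists_prod intro!: prod_nonneg)

text \<open>Repeated use turns a sum over several parallel sequences into one over sequences of
  tuples, to which the moment bounds apply.\<close>

lemma sum_lists_zip:
  "(\<Sum>ss\<in>lists_n n. F ss) = (\<Sum>xs\<in>lists_n n. \<Sum>ys\<in>lists_n n. F (zip xs ys))"
proof -
  have "lists_n n = (\<lambda>(xs, ys). zip xs ys) ` (lists_n n \<times> lists_n n)"
  proof (safe, goal_cases)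
    case (1 ss)
    then show ?case
      by (intro image_eqI[of _ _ "(map fst ss, map snd ss)"]) (auto simp: lists_n_def zip_map_fst_snd)
  qed (auto simp: lists_n_def)
  moreover have "inj_on (\<lambda>(xs, ys). zip xs ys) (lists_n n \<times> lists_n n)"
    by (auto simp: inj_on_def lists_n_def zip_eq_conv)
  ultimately show ?thesis
    by (subst sum.reindex_cong[of "\<lambda>(xs, ys). zip xs ys" "lists_n n \<times> lists_n n" _ F])
      (auto simp: sum.cartesian_product')
qed

section \<open>Second moment bounds for sums of independent terms\<close>

lemma moments_iid_sum:
  fixes P d :: "'s::finite \<Rightarrow> real"
  assumes P: "is_pmf UNIV P"
  defines "m \<equiv> (\<Sum>s\<in>UNIV. P s * d s)"
  shows "(\<Sum>ss\<in>lists_n n. (\<Prod>i<n. P (ss ! i)) * (\<Sum>i<n. d (ss ! i) - m)) = 0"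
    and "(\<Sum>ss\<in>lists_n n. (\<Prod>i<n. P (ss ! i)) * (\<Sum>i<n. d (ss ! i) - m)\<^sup>2)
      = n * (\<Sum>s\<in>UNIV. P s * (d s - m)\<^sup>2)"
proof (induction n)
  case 0
  { case 1 show ?case by (simp add: lists_n_0) }
  { case 2 show ?case by (simp add: lists_n_0) }
next
  case (Suc n)
  let ?w = "\<lambda>ss. \<Prod>i<n. P (ss ! i)" and ?Y = "\<lambda>ss. \<Sum>i<n. d (ss ! i) - m"
  have w: "(\<Sum>ss\<in>lists_n n. ?w ss) = 1"
    using is_pmfD(3)[OF is_pmf_lists, of n "\<lambda>_. P"] P by simp
  have c: "(\<Sum>s\<in>UNIV. P s * (d s - m)) = 0"
    using is_pmfD(3)[OF P] by (simp add: right_diff_distrib sum_subtractf m_def flip: sum_distrib_right)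
  note shift = sum_lists_Suc prod.lessThan_Suc_shift sum.lessThan_Suc_shift
  {
    case 1
    have "(\<Sum>a\<in>UNIV. \<Sum>ss\<in>lists_n n. P a * ?w ss * (d a - m + ?Y ss))
      = (\<Sum>a\<in>UNIV. P a * (d a - m) * (\<Sum>ss\<in>lists_n n. ?w ss) + P a * (\<Sum>ss\<in>lists_n n. ?w ss * ?Y ss))"
      by (simp add: sum_distrib_left distrib_left sum.distrib ac_simps)
    then show ?case
      using w c Suc.IH(1) by (simp add: shift del: prod.lessThan_Suc sum.lessThan_Suc)
  }
  {
    case 2
    \<comment> \<open>The cross term vanishes by the first claim for \<open>n\<close>, which is why
      both moments are treated in one induction.\<close>
    have alg: "p * w * (x + y)\<^sup>2 = p * x\<^sup>2 * w + (2 * p * x * (w * y) + p * (w * y\<^sup>2))"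
      for p w x y :: real by (simp add: power2_eq_square algebra_simps)
    have "(\<Sum>a\<in>UNIV. \<Sum>ss\<in>lists_n n. P a * ?w ss * (d a - m + ?Y ss)\<^sup>2)
      = (\<Sum>a\<in>UNIV. P a * (d a - m)\<^sup>2 * (\<Sum>ss\<in>lists_n n. ?w ss)
          + (2 * P a * (d a - m) * (\<Sum>ss\<in>lists_n n. ?w ss * ?Y ss)
          + P a * (\<Sum>ss\<in>lists_n n. ?w ss * (?Y ss)\<^sup>2)))"
      by (simp only: alg sum.distrib sum_distrib_left[symmetric])
    also have "\<dots> = (\<Sum>a\<in>UNIV. P a * (d a - m)\<^sup>2) + n * (\<Sum>s\<in>UNIV. P s * (d s - m)\<^sup>2)"
      using w Suc.IH is_pmfD(3)[OF P] by (simp add: sum.distrib flip: sum_distrib_right)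
    finally show ?case
      by (simp add: shift algebra_simps del: prod.lessThan_Suc sum.lessThan_Suc)
  }
qed

definition variance_of :: "('s::finite \<Rightarrow> real) \<Rightarrow> ('s \<Rightarrow> real) \<Rightarrow> real" where
  "variance_of P d = (\<Sum>s\<in>UNIV. P s * (d s - (\<Sum>s\<in>UNIV. P s * d s))\<^sup>2)"

text \<open>Chebyshev's inequality: on the event the centred sum is at most
  \<open>- n * \<delta>\<close>.\<close>

lemma lower_tail:
  fixes P :: "'s::finite \<Rightarrow> real"
  assumes P: "is_pmf UNIV P" and n: "0 < n" and \<delta>: "0 < \<delta>"
    and a: "a \<le> n * ((\<Sum>s\<in>UNIV. P s * d s) - \<delta>)"
  shows "(\<Sum>ss\<in>lists_n n. (\<Prod>i<n. P (ss ! i)) * of_bool ((\<Sum>i<n. d (ss ! i)) \<le> a))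
    \<le> variance_of P d / (n * \<delta>\<^sup>2)"
proof -
  let ?m = "\<Sum>s\<in>UNIV. P s * d s"
  have "(\<Sum>ss\<in>lists_n n. (\<Prod>i<n. P (ss ! i)) * of_bool ((\<Sum>i<n. d (ss ! i)) \<le> a))
    \<le> (\<Sum>ss\<in>lists_n n. (\<Prod>i<n. P (ss ! i)) * ((\<Sum>i<n. d (ss ! i) - ?m)\<^sup>2 / (n * \<delta>)\<^sup>2))"
  proof (intro sum_mono mult_left_mono)
    fix ss
    show "0 \<le> (\<Prod>i<n. P (ss ! i))" using is_pmfD(2)[OF P] by (intro prod_nonneg) auto
    have "1 \<le> (\<Sum>i<n. d (ss ! i) - ?m)\<^sup>2 / (n * \<delta>)\<^sup>2" if "(\<Sum>i<n. d (ss ! i)) \<le> a"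
    proof -
      have "n * \<delta> \<le> - (\<Sum>i<n. d (ss ! i) - ?m)"
        using that a by (simp add: sum_subtractf algebra_simps)
      then have "(n * \<delta>)\<^sup>2 \<le> (- (\<Sum>i<n. d (ss ! i) - ?m))\<^sup>2" using \<delta> by (intro power_mono) auto
      then show ?thesis using n \<delta> by simp
    qed
    then show "of_bool ((\<Sum>i<n. d (ss ! i)) \<le> a) \<le> (\<Sum>i<n. d (ss ! i) - ?m)\<^sup>2 / (n * \<delta>)\<^sup>2"
      by (auto simp: of_bool_def)
  qed
  also have "\<dots> = n * variance_of P d / (n * \<delta>)\<^sup>2"
    using moments_iid_sum(2)[OF P, of n d]
    by (simp add: variance_of_def flip: sum_divide_distrib)
  also have "\<dots> = variance_of P d / (n * \<delta>\<^sup>2)" using n by (simp add: power2_eq_square)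
  finally show ?thesis .
qed

text \<open>Either the centred sum \<open>Y\<close> is at most \<open>sqrt n\<close>, or it is at
  most \<open>Y * Y / sqrt n\<close>. Since \<open>Y * Y\<close> has mean \<open>n\<close> times the
  variance, both bounds have order \<open>sqrt n\<close>. The level \<open>a\<close> may equal the
  mean of the sum.\<close>

lemma positive_part:
  fixes P :: "'s::finite \<Rightarrow> real"
  assumes P: "is_pmf UNIV P" and n: "0 < n" and a: "n * (\<Sum>s\<in>UNIV. P s * d s) \<le> a"
  shows "(\<Sum>ss\<in>lists_n n. (\<Prod>i<n. P (ss ! i)) * max 0 ((\<Sum>i<n. d (ss ! i)) - a))
    \<le> sqrt n * (1 + variance_of P d)"
proof -
  let ?m = "\<Sum>s\<in>UNIV. P s * d s"
  have "(\<Sum>ss\<in>lists_n n. (\<Prod>i<n. P (ss ! i)) * max 0 ((\<Sum>i<n. d (ss ! i)) - a))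
    \<le> (\<Sum>ss\<in>lists_n n. (\<Prod>i<n. P (ss ! i)) * (sqrt n + (\<Sum>i<n. d (ss ! i) - ?m)\<^sup>2 / sqrt n))"
  proof (intro sum_mono mult_left_mono)
    fix ss
    show "0 \<le> (\<Prod>i<n. P (ss ! i))" using is_pmfD(2)[OF P] by (intro prod_nonneg) auto
    define Y where "Y = (\<Sum>i<n. d (ss ! i) - ?m)"
    have "(\<Sum>i<n. d (ss ! i)) - a \<le> Y"
      using a by (simp add: Y_def sum_subtractf)
    moreover have "0 \<le> Y\<^sup>2 / sqrt n" "0 \<le> sqrt n" by auto
    moreover have "Y \<le> sqrt n + Y\<^sup>2 / sqrt n"
    proof (cases "Y \<le> sqrt n")
      case False
      then have "Y * sqrt n \<le> Y * Y" by (intro mult_left_mono) (auto intro: order_trans[of 0 "sqrt n"])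
      then have "Y \<le> Y\<^sup>2 / sqrt n" using n by (simp add: pos_le_divide_eq power2_eq_square)
      then show ?thesis by (simp add: add_increasing)
    qed (use \<open>0 \<le> Y\<^sup>2 / sqrt n\<close> in linarith)
    ultimately show "max 0 ((\<Sum>i<n. d (ss ! i)) - a) \<le> sqrt n + (\<Sum>i<n. d (ss ! i) - ?m)\<^sup>2 / sqrt n"
      unfolding Y_def[symmetric] by linarith
  qed
  also have "\<dots> = sqrt n + n * variance_of P d / sqrt n"
    using moments_iid_sum(2)[OF P, of n d] is_pmfD(3)[OF is_pmf_lists, of n "\<lambda>_. P"] P
    by (simp add: variance_of_def distrib_left sum.distrib
        flip: sum_divide_distrib sum_distrib_right)
  also have "\<dots> = sqrt n * (1 + variance_of P d)"
    using n by (simp add: field_simps)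
  finally show ?thesis .
qed

section \<open>Memoryless laws\<close>

lemma sum_lists_prod2:
  fixes f :: "nat \<Rightarrow> 'a::finite \<Rightarrow> 'b::finite \<Rightarrow> real"
  shows "(\<Sum>xs\<in>lists_n n. \<Sum>ys\<in>lists_n n. \<Prod>i<n. f i (xs ! i) (ys ! i))
    = (\<Prod>i<n. \<Sum>a\<in>UNIV. \<Sum>b\<in>UNIV. f i a b)"
proof -
  have "(\<Sum>ys\<in>lists_n n. \<Prod>i<n. f i (xs ! i) (ys ! i)) = (\<Prod>i<n. \<Sum>b\<in>UNIV. f i (xs ! i) b)" for xs
    by (rule sum_lists_prod)
  then show ?thesis by (simp add: sum_lists_prod[of "\<lambda>i a. \<Sum>b\<in>UNIV. f i a b"])
qed

definition prod_kernel :: "nat \<Rightarrow> ('x \<Rightarrow> 'y \<Rightarrow> real) \<Rightarrow> 'x list \<Rightarrow> 'y list \<Rightarrow> real" where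
  "prod_kernel n U xs ys = (\<Prod>i<n. U (xs ! i) (ys ! i))"

lemma is_pmf_prod_kernel:
  fixes U :: "'x \<Rightarrow> 'y::finite \<Rightarrow> real"
  assumes "\<And>x. is_pmf UNIV (U x)"
  shows "is_pmf (lists_n n) (prod_kernel n U xs)"
  unfolding prod_kernel_def using is_pmf_lists[of n "\<lambda>i. U (xs ! i)"] assms by simp

text \<open>\<open>pq\<close> is the law of Q and \<open>k\<close> the law of V_0 given Q. Factoring
  p(q,v_0) in this way allows the block code to be built for a fixed time-sharing sequence.\<close>

locale memoryless =
  fixes pq :: "'q::finite \<Rightarrow> real" and k :: "'q \<Rightarrow> 'a::finite \<Rightarrow> real"
    and p12 :: "'a \<Rightarrow> 'b::finite \<Rightarrow> 'c::finite \<Rightarrow> real"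
    and px :: "'a \<Rightarrow> 'b \<Rightarrow> 'c \<Rightarrow> 'x::finite \<Rightarrow> real"
  assumes pq: "is_pmf UNIV pq" and k: "\<And>q. is_pmf UNIV (k q)"
    and p12: "\<And>a. is_pmf UNIV (\<lambda>(b, c). p12 a b c)"
    and px: "\<And>a b c. is_pmf UNIV (px a b c)"
begin

definition p1 :: "'a \<Rightarrow> 'b \<Rightarrow> real" where "p1 a b = (\<Sum>c\<in>UNIV. p12 a b c)"
definition p2 :: "'a \<Rightarrow> 'c \<Rightarrow> real" where "p2 a c = (\<Sum>b\<in>UNIV. p12 a b c)"
definition ratio :: "'a \<Rightarrow> 'b \<Rightarrow> 'c \<Rightarrow> real" where "ratio a b c = p12 a b c / (p1 a b * p2 a c)"
definition kap :: "('x \<Rightarrow> 'y \<Rightarrow> real) \<Rightarrow> 'a \<Rightarrow> 'b \<Rightarrow> 'c \<Rightarrow> 'y \<Rightarrow> real" where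
  "kap U a b c y = (\<Sum>x\<in>UNIV. px a b c x * U x y)"
definition kap1 :: "('x \<Rightarrow> 'y \<Rightarrow> real) \<Rightarrow> 'a \<Rightarrow> 'b \<Rightarrow> 'y \<Rightarrow> real" where
  "kap1 U a b y = (\<Sum>c\<in>UNIV. p12 a b c / p1 a b * kap U a b c y)"
definition kap2 :: "('x \<Rightarrow> 'y \<Rightarrow> real) \<Rightarrow> 'a \<Rightarrow> 'c \<Rightarrow> 'y \<Rightarrow> real" where
  "kap2 U a c y = (\<Sum>b\<in>UNIV. p12 a b c / p2 a c * kap U a b c y)"
definition kap0 :: "('x \<Rightarrow> 'y \<Rightarrow> real) \<Rightarrow> 'a \<Rightarrow> 'y \<Rightarrow> real" where
  "kap0 U a y = (\<Sum>b\<in>UNIV. \<Sum>c\<in>UNIV. p12 a b c * kap U a b c y)"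
definition outQ :: "('x \<Rightarrow> 'y \<Rightarrow> real) \<Rightarrow> 'q \<Rightarrow> 'y \<Rightarrow> real" where
  "outQ U q y = (\<Sum>a\<in>UNIV. k q a * kap0 U a y)"

definition J :: "('x \<Rightarrow> 'y \<Rightarrow> real) \<Rightarrow> 'q \<times> 'a \<times> 'b \<times> 'c \<times> 'y \<Rightarrow> real" where
  "J U = (\<lambda>(q, a, b, c, y). pq q * k q a * p12 a b c * kap U a b c y)"

text \<open>Information densities. Under \<open>J\<close> the means of \<open>D0\<close>,
  \<open>D1\<close> and \<open>D2\<close> are I(V_0;Y|Q), I(V_0,V_1;Y|Q) and I(V_0,V_2;Y|Q).
  \<open>D12\<close> also contains \<open>ratio\<close>, so its mean is I(V_0,V_1,V_2;Y|Q) +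
  I(V_1;V_2|V_0).\<close>

definition D0 :: "('x \<Rightarrow> 'y \<Rightarrow> real) \<Rightarrow> 'q \<times> 'a \<times> 'b \<times> 'c \<times> 'y \<Rightarrow> real" where
  "D0 U = (\<lambda>(q, a, b, c, y). log 2 (kap0 U a y / outQ U q y))"
definition D1 :: "('x \<Rightarrow> 'y \<Rightarrow> real) \<Rightarrow> 'q \<times> 'a \<times> 'b \<times> 'c \<times> 'y \<Rightarrow> real" where
  "D1 U = (\<lambda>(q, a, b, c, y). log 2 (kap1 U a b y / outQ U q y))"
definition D2 :: "('x \<Rightarrow> 'y \<Rightarrow> real) \<Rightarrow> 'q \<times> 'a \<times> 'b \<times> 'c \<times> 'y \<Rightarrow> real" where
  "D2 U = (\<lambda>(q, a, b, c, y). log 2 (kap2 U a c y / outQ U q y))"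
definition D12 :: "('x \<Rightarrow> 'y \<Rightarrow> real) \<Rightarrow> 'q \<times> 'a \<times> 'b \<times> 'c \<times> 'y \<Rightarrow> real" where
  "D12 U = (\<lambda>(q, a, b, c, y). log 2 (ratio a b c * kap U a b c y / outQ U q y))"

lemma nonneg [simp]: "0 \<le> pq q" "0 \<le> k q a" "0 \<le> p12 a b c" "0 \<le> px a b c x"
  using is_pmfD(2)[OF pq] is_pmfD(2)[OF k] is_pmfD(2)[OF px] is_pmfD(2)[OF p12[of a], of "(b, c)"]
  by auto

lemma p1_nonneg [simp]: "0 \<le> p1 a b" unfolding p1_def by (intro sum_nonneg) simp
lemma p2_nonneg [simp]: "0 \<le> p2 a c" unfolding p2_def by (intro sum_nonneg) simp

lemma sum_p12: "(\<Sum>b\<in>UNIV. \<Sum>c\<in>UNIV. p12 a b c) = 1"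
  using is_pmfD(3)[OF p12[of a]] by (simp add: sum.cartesian_product' flip: UNIV_Times_UNIV)

lemma kap_nonneg:
  assumes "\<And>x. is_pmf UNIV (U x)" shows "0 \<le> kap U a b c y"
  unfolding kap_def using is_pmfD(2)[OF assms] by (intro sum_nonneg mult_nonneg_nonneg) auto

lemma sum_kap:
  fixes U :: "'x \<Rightarrow> 'y::finite \<Rightarrow> real"
  assumes "\<And>x. is_pmf UNIV (U x)" shows "(\<Sum>y\<in>UNIV. kap U a b c y) = 1"
proof -
  have "(\<Sum>y\<in>UNIV. kap U a b c y) = (\<Sum>x\<in>UNIV. px a b c x * (\<Sum>y\<in>UNIV. U x y))"
    unfolding kap_def sum_distrib_left by (rule sum.swap)
  then show ?thesis using is_pmfD(3)[OF assms] is_pmfD(3)[OF px] by simp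
qed

lemma is_pmf_J:
  fixes U :: "'x \<Rightarrow> 'y::finite \<Rightarrow> real"
  assumes U: "\<And>x. is_pmf UNIV (U x)"
  shows "is_pmf UNIV (J U)"
proof -
  have "(\<Sum>s\<in>UNIV. J U s) = (\<Sum>q\<in>UNIV. \<Sum>a\<in>UNIV. pq q * k q a *
      (\<Sum>b\<in>UNIV. \<Sum>c\<in>UNIV. p12 a b c * (\<Sum>y\<in>UNIV. kap U a b c y)))"
    by (simp add: J_def sum.cartesian_product' sum_distrib_left mult.assoc flip: UNIV_Times_UNIV)
  also have "\<dots> = 1"
    using is_pmfD(3)[OF k] is_pmfD(3)[OF pq]
    by (simp add: sum_kap[OF U] sum_p12 flip: sum_distrib_left)
  finally show ?thesis using kap_nonneg[OF U] by (auto simp: is_pmf_def J_def)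
qed

lemma positive:
  assumes U: "\<And>x. is_pmf UNIV (U x)" and J: "0 < J U (q, a, b, c, y)"
  shows "0 < kap U a b c y" "0 < ratio a b c" "0 < kap1 U a b y" "0 < kap2 U a c y"
    "0 < kap0 U a y" "0 < outQ U q y"
proof -
  have "k q a \<noteq> 0 \<and> p12 a b c \<noteq> 0 \<and> kap U a b c y \<noteq> 0" using J by (auto simp: J_def)
  then have p: "0 < k q a" "0 < p12 a b c" "0 < kap U a b c y"
    using kap_nonneg[of U a b c y, OF U] nonneg(2)[of q a] nonneg(3)[of a b c]
    by (auto simp only: order.strict_iff_order)
  then show "0 < kap U a b c y" by simp
  have "p12 a b c \<le> p1 a b" unfolding p1_def by (intro member_le_sum) auto
  then have p1: "0 < p1 a b" using p by simp
  have "p12 a b c \<le> p2 a c" unfolding p2_def by (intro member_le_sum[of b _ "\<lambda>b. p12 a b c"]) auto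
  then have p2: "0 < p2 a c" using p by simp
  show "0 < ratio a b c" unfolding ratio_def using p p1 p2 by simp
  have "p12 a b c / p1 a b * kap U a b c y \<le> kap1 U a b y"
    unfolding kap1_def using kap_nonneg[OF U]
    by (intro member_le_sum[of c _ "\<lambda>c. p12 a b c / p1 a b * kap U a b c y"]) auto
  moreover have "0 < p12 a b c / p1 a b * kap U a b c y" using p p1 by simp
  ultimately show "0 < kap1 U a b y" by linarith
  have "p12 a b c / p2 a c * kap U a b c y \<le> kap2 U a c y"
    unfolding kap2_def using kap_nonneg[OF U]
    by (intro member_le_sum[of b _ "\<lambda>b. p12 a b c / p2 a c * kap U a b c y"]) auto
  moreover have "0 < p12 a b c / p2 a c * kap U a b c y" using p p2 by simp
  ultimately show "0 < kap2 U a c y" by linarith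
  have "p12 a b c * kap U a b c y \<le> (\<Sum>c\<in>UNIV. p12 a b c * kap U a b c y)"
    using kap_nonneg[OF U] by (intro member_le_sum[of c _ "\<lambda>c. p12 a b c * kap U a b c y"]) auto
  also have "\<dots> \<le> kap0 U a y"
    unfolding kap0_def using kap_nonneg[OF U]
    by (intro member_le_sum[of b _ "\<lambda>b. \<Sum>c\<in>UNIV. p12 a b c * kap U a b c y"])
      (auto intro!: sum_nonneg)
  finally have "p12 a b c * kap U a b c y \<le> kap0 U a y" .
  moreover have "0 < p12 a b c * kap U a b c y" using p by simp
  ultimately show k0: "0 < kap0 U a y" by linarith
  have "0 \<le> kap0 U a y" for a
    unfolding kap0_def using kap_nonneg[OF U] by (intro sum_nonneg) auto
  then have "k q a * kap0 U a y \<le> outQ U q y"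
    unfolding outQ_def by (intro member_le_sum[of a _ "\<lambda>a. k q a * kap0 U a y"]) auto
  moreover have "0 < k q a * kap0 U a y" using p k0 by simp
  ultimately show "0 < outQ U q y" by linarith
qed

text \<open>Expectation given the time-sharing sequence \<open>qs\<close>, with the remaining layers
  and the output drawn memorylessly.\<close>

definition Ew :: "nat \<Rightarrow> ('x \<Rightarrow> 'y::finite \<Rightarrow> real) \<Rightarrow>
    ('a list \<Rightarrow> 'b list \<Rightarrow> 'c list \<Rightarrow> 'y list \<Rightarrow> real) \<Rightarrow> 'q list \<Rightarrow> real" where
  "Ew n U h qs = (\<Sum>as\<in>lists_n n. \<Sum>bs\<in>lists_n n. \<Sum>cs\<in>lists_n n. \<Sum>ys\<in>lists_n n.
    (\<Prod>i<n. k (qs ! i) (as ! i) * p12 (as ! i) (bs ! i) (cs ! i) * kap U (as ! i) (bs ! i) (cs ! i) (ys ! i))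
    * h as bs cs ys)"

definition miss1 :: "nat \<Rightarrow> ('x \<Rightarrow> 'y::finite \<Rightarrow> real) \<Rightarrow> real \<Rightarrow> 'q list \<Rightarrow> real" where
  "miss1 n U \<gamma> qs = Ew n U (\<lambda>as bs cs ys. of_bool (\<not> \<gamma> * (\<Prod>i<n. outQ U (qs ! i) (ys ! i))
              < (\<Prod>i<n. kap1 U (as ! i) (bs ! i) (ys ! i)))) qs"

definition miss2 :: "nat \<Rightarrow> ('x \<Rightarrow> 'y::finite \<Rightarrow> real) \<Rightarrow> real \<Rightarrow> 'q list \<Rightarrow> real" where
  "miss2 n U \<gamma> qs = Ew n U (\<lambda>as bs cs ys. of_bool (\<not> \<gamma> * (\<Prod>i<n. outQ U (qs ! i) (ys ! i))
              < (\<Prod>i<n. kap2 U (as ! i) (cs ! i) (ys ! i)))) qs"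

definition leak :: "nat \<Rightarrow> ('x \<Rightarrow> 'y::finite \<Rightarrow> real) \<Rightarrow> real \<Rightarrow> real \<Rightarrow> real \<Rightarrow> 'q list \<Rightarrow> real" where
  "leak n U K0 K1 K2 qs = Ew n U (\<lambda>as bs cs ys. log 2 (1 +
            ((\<Prod>i<n. ratio (as ! i) (bs ! i) (cs ! i)) * (\<Prod>i<n. kap U (as ! i) (bs ! i) (cs ! i) (ys ! i))
                / (K1 * K2)
              + (\<Prod>i<n. kap1 U (as ! i) (bs ! i) (ys ! i)) / K1
              + (\<Prod>i<n. kap2 U (as ! i) (cs ! i) (ys ! i)) / K2
              + (\<Prod>i<n. kap0 U (as ! i) (ys ! i)))
            / (K0 * (\<Prod>i<n. outQ U (qs ! i) (ys ! i))))) qs"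

text \<open>For fixed \<open>qs\<close> every ingredient of the one-shot bound, including
  \<open>ratio\<close> and the conditional output laws, is a product over the positions.
  \<open>card L\<close> counts the super-codewords per message, \<open>K1\<close> and
  \<open>K2\<close> the second-layer sequences per super-codeword.\<close>

lemma block_code:
  fixes U1 :: "'x \<Rightarrow> 'y1::finite \<Rightarrow> real" and U2 :: "'x \<Rightarrow> 'y2::finite \<Rightarrow> real"
    and U3 :: "'x \<Rightarrow> 'z::finite \<Rightarrow> real" and Ms :: "'m set" and L :: "'l set" and K1 K2 :: nat
  assumes M: "finite Ms" "Ms \<noteq> {}" and L: "finite L" "L \<noteq> {}"
    and U: "\<And>x. is_pmf UNIV (U1 x)" "\<And>x. is_pmf UNIV (U2 x)" "\<And>x. is_pmf UNIV (U3 x)"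
    and \<gamma>: "0 < \<gamma>1" "0 < \<gamma>2" and \<theta>: "0 \<le> \<theta>" and K: "0 < K1" "0 < K2"
  shows "has_code Ms (lists_n n) (lists_n n) (lists_n n) (lists_n n)
      (prod_kernel n U1) (prod_kernel n U2) (prod_kernel n U3) \<theta>
      (miss1 n U1 \<gamma>1 qs
          + real (card Ms * card L) * (K1 / \<gamma>1)
        + (miss2 n U2 \<gamma>2 qs
          + real (card Ms * card L) * (K2 / \<gamma>2))
        + \<theta> * (1 / ln 2 + leak n U3 (card L) K1 K2 qs))"
proof -
  let ?p0 = "\<lambda>as. \<Prod>i<n. k (qs ! i) (as ! i)"
  let ?p12 = "\<lambda>as bs cs. \<Prod>i<n. p12 (as ! i) (bs ! i) (cs ! i)"
  let ?px = "\<lambda>as bs cs xs. \<Prod>i<n. px (as ! i) (bs ! i) (cs ! i) (xs ! i)"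
  interpret w: superposition "lists_n n" "lists_n n" "lists_n n" "lists_n n" ?p0 ?p12 ?px
    "{..<K1}" "{..<K2}"
  proof
    show "is_pmf (lists_n n) ?p0" using k by (intro is_pmf_lists)
    show "is_pmf (lists_n n) (?px as bs cs)" for as bs cs using px by (intro is_pmf_lists)
    show "is_pmf (lists_n n \<times> lists_n n) (\<lambda>(bs, cs). ?p12 as bs cs)" for as
      using sum_lists_prod2[of "\<lambda>i b c. p12 (as ! i) b c" n]
      by (auto simp: is_pmf_def sum.cartesian_product' sum_p12 intro!: prod_nonneg)
  qed (use K in auto)
  have wp1: "w.p1 as bs = (\<Prod>i<n. p1 (as ! i) (bs ! i))" for as bs
    unfolding w.p1_def p1_def by (simp add: sum_lists_prod[symmetric])
  have wp2: "w.p2 as bs = (\<Prod>i<n. p2 (as ! i) (bs ! i))" for as bs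
    unfolding w.p2_def p2_def by (simp add: sum_lists_prod[symmetric])
  have wr: "w.ratio as bs cs = (\<Prod>i<n. ratio (as ! i) (bs ! i) (cs ! i))" for as bs cs
    unfolding w.ratio_def wp1 wp2 ratio_def by (simp add: prod_dividef prod.distrib)
  have wk: "w.kap (prod_kernel n U) as bs cs ys = (\<Prod>i<n. kap U (as ! i) (bs ! i) (cs ! i) (ys ! i))"
    for U :: "'x \<Rightarrow> 'y \<Rightarrow> real" and as bs cs ys
    unfolding w.kap_def kap_def prod_kernel_def
    by (simp add: sum_lists_prod[symmetric] prod.distrib)
  have wk1: "w.kap1 (prod_kernel n U) as bs ys = (\<Prod>i<n. kap1 U (as ! i) (bs ! i) (ys ! i))"
    for U :: "'x \<Rightarrow> 'y \<Rightarrow> real" and as bs ys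
    unfolding w.kap1_def wk wp1 kap1_def
    by (simp add: sum_lists_prod[symmetric] prod.distrib prod_dividef)
  have wk2: "w.kap2 (prod_kernel n U) as cs ys = (\<Prod>i<n. kap2 U (as ! i) (cs ! i) (ys ! i))"
    for U :: "'x \<Rightarrow> 'y \<Rightarrow> real" and as cs ys
    unfolding w.kap2_def wk wp2 kap2_def
    by (simp add: sum_lists_prod[symmetric] prod.distrib prod_dividef)
  have wk0: "w.kap0 (prod_kernel n U) as ys = (\<Prod>i<n. kap0 U (as ! i) (ys ! i))"
    for U :: "'x \<Rightarrow> 'y \<Rightarrow> real" and as ys
    unfolding w.kap0_def wk kap0_def
    by (simp add: sum_lists_prod2[symmetric] prod.distrib)
  have wQ: "w.outQ (prod_kernel n U) ys = (\<Prod>i<n. outQ U (qs ! i) (ys ! i))"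
    for U :: "'x \<Rightarrow> 'y \<Rightarrow> real" and ys
    unfolding w.outQ_def wk0 outQ_def
    by (simp add: sum_lists_prod[symmetric] prod.distrib)
  have wE: "(\<Sum>ys\<in>lists_n n. w.E012 (\<lambda>as bs cs. w.kap (prod_kernel n U) as bs cs ys * h as bs cs ys))
    = Ew n U h qs" for U :: "'x \<Rightarrow> 'y::finite \<Rightarrow> real" and h
    unfolding w.E012_def Ew_def wk
    by (simp only: sum.swap[of _ _ "lists_n n :: 'y list set"] prod.distrib mult.assoc)
  have wN: "w.N = real K1 * real K2" unfolding w.N_def by simp
  note os = w.one_shot[OF M L _ _ _ _ _ _ _ \<gamma> \<theta>, of "lists_n n" "prod_kernel n U1"
      "lists_n n" "prod_kernel n U2" "lists_n n" "prod_kernel n U3",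
      OF is_pmf_prod_kernel[OF U(1)] is_pmf_prod_kernel[OF U(2)] is_pmf_prod_kernel[OF U(3)]
      finite_lists_n finite_lists_n finite_lists_n finite_lists_n]
  show ?thesis
    using os unfolding wE wr wN unfolding miss1_def miss2_def leak_def wk wk1 wk2 wk0 wQ by simp
qed

end

section \<open>Averages over the time-sharing sequence\<close>

lemma log_prod_lessThan:
  fixes f :: "nat \<Rightarrow> real"
  assumes "\<And>i. i < n \<Longrightarrow> 0 < f i"
  shows "log 2 (\<Prod>i<n. f i) = (\<Sum>i<n. log 2 (f i))"
  using assms
proof (induction n)
  case (Suc n)
  then have "0 < (\<Prod>i<n. f i)" "0 < f n" by (auto intro!: prod_pos)
  then show ?case using Suc by (simp add: log_mult_pos)
qed simp

text \<open>Each of 1, \<open>w\<close>, \<open>x\<close>, \<open>y\<close>, \<open>z\<close> is at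
  most 2 to the power of the sum of the positive parts. The resulting factor 5 is rounded up to 8,
  whence the 3.\<close>

lemma log_one_plus_sum_le:
  fixes w x y z :: real
  assumes "0 < w" "0 < x" "0 < y" "0 < z"
  shows "log 2 (1 + (w + x + y + z)) \<le> 3 + (max 0 (log 2 w) + max 0 (log 2 x) + max 0 (log 2 y) + max 0 (log 2 z))"
proof -
  let ?s = "max 0 (log 2 w) + max 0 (log 2 x) + max 0 (log 2 y) + max 0 (log 2 z)"
  have le: "u \<le> 2 powr ?s" if "0 < u" "log 2 u \<le> ?s" for u
    using that by (simp add: log_le_iff)
  have m: "log 2 u \<le> max 0 (log 2 u)" "0 \<le> max 0 (log 2 u)" for u :: real by auto
  have "1 \<le> (2::real) powr ?s" "0 < (2::real) powr ?s"
    by (auto intro!: ge_one_powr_ge_zero)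
  moreover have "w \<le> 2 powr ?s" "x \<le> 2 powr ?s" "y \<le> 2 powr ?s" "z \<le> 2 powr ?s"
    using assms m[of w] m[of x] m[of y] m[of z] by (intro le; linarith)+
  ultimately have "1 + (w + x + y + z) \<le> 8 * 2 powr ?s" by linarith
  also have "\<dots> = 2 powr (3 + ?s)" by (simp add: powr_add)
  finally show ?thesis using assms by (subst log_le_iff) (auto intro!: add_pos_pos)
qed

context memoryless begin

text \<open>Averaging over \<open>qs\<close> too makes the five parallel sequences an i.i.d.
  sequence of tuples with law \<open>J U\<close>. The pointwise comparison is asked only on its
  support, where all logarithms have positive arguments.\<close>

lemma Ew_average_le:
  fixes U :: "'x \<Rightarrow> 'y::finite \<Rightarrow> real"
    and h :: "'q list \<Rightarrow> 'a list \<Rightarrow> 'b list \<Rightarrow> 'c list \<Rightarrow> 'y list \<Rightarrow> real"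
  assumes U: "\<And>x. is_pmf UNIV (U x)"
    and le: "\<And>qs as bs cs ys. qs \<in> lists_n n \<Longrightarrow> as \<in> lists_n n \<Longrightarrow> bs \<in> lists_n n \<Longrightarrow>
      cs \<in> lists_n n \<Longrightarrow> ys \<in> lists_n n \<Longrightarrow>
      (\<And>i. i < n \<Longrightarrow> 0 < J U (qs ! i, as ! i, bs ! i, cs ! i, ys ! i)) \<Longrightarrow>
      h qs as bs cs ys \<le> H (zip qs (zip as (zip bs (zip cs ys))))"
  shows "(\<Sum>qs\<in>lists_n n. (\<Prod>i<n. pq (qs ! i)) * Ew n U (h qs) qs)
    \<le> (\<Sum>ss\<in>lists_n n. (\<Prod>i<n. J U (ss ! i)) * H ss)"
proof -
  have J0: "0 \<le> J U s" for s using is_pmfD(2)[OF is_pmf_J[OF U]] by auto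
  have "(\<Sum>qs\<in>lists_n n. (\<Prod>i<n. pq (qs ! i)) * Ew n U (h qs) qs)
    = (\<Sum>qs\<in>lists_n n. \<Sum>as\<in>lists_n n. \<Sum>bs\<in>lists_n n. \<Sum>cs\<in>lists_n n. \<Sum>ys\<in>lists_n n.
        (\<Prod>i<n. J U (qs ! i, as ! i, bs ! i, cs ! i, ys ! i)) * h qs as bs cs ys)"
    by (simp add: Ew_def J_def prod.distrib sum_distrib_left mult.assoc)
  also have "\<dots> \<le> (\<Sum>qs\<in>lists_n n. \<Sum>as\<in>lists_n n. \<Sum>bs\<in>lists_n n. \<Sum>cs\<in>lists_n n. \<Sum>ys\<in>lists_n n.
        (\<Prod>i<n. J U (qs ! i, as ! i, bs ! i, cs ! i, ys ! i)) * H (zip qs (zip as (zip bs (zip cs ys)))))"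
  proof (intro sum_mono)
    fix qs :: "'q list" and as :: "'a list" and bs :: "'b list" and cs :: "'c list" and ys :: "'y list"
    assume *: "qs \<in> lists_n n" "as \<in> lists_n n" "bs \<in> lists_n n" "cs \<in> lists_n n" "ys \<in> lists_n n"
    let ?P = "\<Prod>i<n. J U (qs ! i, as ! i, bs ! i, cs ! i, ys ! i)"
    show "?P * h qs as bs cs ys \<le> ?P * H (zip qs (zip as (zip bs (zip cs ys))))"
    proof (cases "?P = 0")
      case True
      then show ?thesis by (simp only: mult_zero_left)
    next
      case False
      then have "0 < J U (qs ! i, as ! i, bs ! i, cs ! i, ys ! i)" if "i < n" for i
        using that J0[of "(qs ! i, as ! i, bs ! i, cs ! i, ys ! i)"]
        by (auto simp: order.strict_iff_order prod_zero_iff)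
      then show ?thesis using * le J0 by (intro mult_left_mono prod_nonneg) auto
    qed
  qed
  also have "\<dots> = (\<Sum>ss\<in>lists_n n. (\<Prod>i<n. J U (ss ! i)) * H ss)"
    unfolding sum_lists_zip by (intro sum.cong refl) (simp add: lists_n_def)
  finally show ?thesis .
qed

lemma prod_le_imp_log_le:
  fixes f g :: "nat \<Rightarrow> real"
  assumes pos: "\<And>i. i < n \<Longrightarrow> 0 < f i" "\<And>i. i < n \<Longrightarrow> 0 < g i" and \<gamma>: "0 < \<gamma>"
    and le: "(\<Prod>i<n. f i) \<le> \<gamma> * (\<Prod>i<n. g i)"
  shows "(\<Sum>i<n. log 2 (f i / g i)) \<le> log 2 \<gamma>"
proof -
  have "(\<Sum>i<n. log 2 (f i / g i)) = log 2 ((\<Prod>i<n. f i) / (\<Prod>i<n. g i))"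
    using pos by (simp add: log_prod_lessThan[symmetric] prod_dividef)
  also have "\<dots> \<le> log 2 \<gamma>"
  proof (rule log_mono)
    have "0 < (\<Prod>i<n. g i)" "0 < (\<Prod>i<n. f i)" using pos by (auto intro!: prod_pos)
    then show "0 < (\<Prod>i<n. f i) / (\<Prod>i<n. g i)" "(\<Prod>i<n. f i) / (\<Prod>i<n. g i) \<le> \<gamma>"
      using le by (auto simp: pos_divide_le_eq)
  qed simp
  finally show ?thesis .
qed

lemma miss_average1:
  fixes U :: "'x \<Rightarrow> 'y::finite \<Rightarrow> real"
  assumes U: "\<And>x. is_pmf UNIV (U x)" and \<gamma>: "0 < \<gamma>"
  shows "(\<Sum>qs\<in>lists_n n. (\<Prod>i<n. pq (qs ! i)) * miss1 n U \<gamma> qs)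
    \<le> (\<Sum>ss\<in>lists_n n. (\<Prod>i<n. J U (ss ! i)) * of_bool ((\<Sum>i<n. D1 U (ss ! i)) \<le> log 2 \<gamma>))"
  unfolding miss1_def
proof (rule Ew_average_le[OF U])
  fix qs as bs cs ys
  assume len: "qs \<in> lists_n n" "as \<in> lists_n n" "bs \<in> lists_n n" "cs \<in> lists_n n" "ys \<in> lists_n n"
    and J: "\<And>i. i < n \<Longrightarrow> 0 < J U (qs ! i, as ! i, bs ! i, cs ! i, ys ! i)"
  note pos = positive[OF U J]
  show "of_bool (\<not> \<gamma> * (\<Prod>i<n. outQ U (qs ! i) (ys ! i)) < (\<Prod>i<n. kap1 U (as ! i) (bs ! i) (ys ! i)))
    \<le> (of_bool ((\<Sum>i<n. D1 U (zip qs (zip as (zip bs (zip cs ys))) ! i)) \<le> log 2 \<gamma>) :: real)"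
    using prod_le_imp_log_le[OF pos(3,6) \<gamma>] len
    by (auto simp: of_bool_def lists_n_def D1_def not_less)
qed

lemma miss_average2:
  fixes U :: "'x \<Rightarrow> 'y::finite \<Rightarrow> real"
  assumes U: "\<And>x. is_pmf UNIV (U x)" and \<gamma>: "0 < \<gamma>"
  shows "(\<Sum>qs\<in>lists_n n. (\<Prod>i<n. pq (qs ! i)) * miss2 n U \<gamma> qs)
    \<le> (\<Sum>ss\<in>lists_n n. (\<Prod>i<n. J U (ss ! i)) * of_bool ((\<Sum>i<n. D2 U (ss ! i)) \<le> log 2 \<gamma>))"
  unfolding miss2_def
proof (rule Ew_average_le[OF U])
  fix qs as bs cs ys
  assume len: "qs \<in> lists_n n" "as \<in> lists_n n" "bs \<in> lists_n n" "cs \<in> lists_n n" "ys \<in> lists_n n"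
    and J: "\<And>i. i < n \<Longrightarrow> 0 < J U (qs ! i, as ! i, bs ! i, cs ! i, ys ! i)"
  note pos = positive[OF U J]
  show "of_bool (\<not> \<gamma> * (\<Prod>i<n. outQ U (qs ! i) (ys ! i)) < (\<Prod>i<n. kap2 U (as ! i) (cs ! i) (ys ! i)))
    \<le> (of_bool ((\<Sum>i<n. D2 U (zip qs (zip as (zip bs (zip cs ys))) ! i)) \<le> log 2 \<gamma>) :: real)"
    using prod_le_imp_log_le[OF pos(4,6) \<gamma>] len
    by (auto simp: of_bool_def lists_n_def D2_def not_less)
qed

text \<open>Each product over the positions turns into a sum of information densities, and the
  codebook sizes dividing it become the level that this sum has to exceed in order to
  contribute.\<close>

lemma cover_average:
  fixes U :: "'x \<Rightarrow> 'y::finite \<Rightarrow> real"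
  assumes U: "\<And>x. is_pmf UNIV (U x)" and K: "0 < (K0::real)" "0 < (K1::real)" "0 < (K2::real)"
  shows "(\<Sum>qs\<in>lists_n n. (\<Prod>i<n. pq (qs ! i)) * leak n U K0 K1 K2 qs)
    \<le> (\<Sum>ss\<in>lists_n n. (\<Prod>i<n. J U (ss ! i)) * (3 +
        (max 0 ((\<Sum>i<n. D12 U (ss ! i)) - log 2 (K0 * K1 * K2))
        + max 0 ((\<Sum>i<n. D1 U (ss ! i)) - log 2 (K0 * K1))
        + max 0 ((\<Sum>i<n. D2 U (ss ! i)) - log 2 (K0 * K2))
        + max 0 ((\<Sum>i<n. D0 U (ss ! i)) - log 2 K0))))"
  unfolding leak_def
proof (rule Ew_average_le[OF U])
  fix qs as bs cs ys
  assume len: "qs \<in> lists_n n" "as \<in> lists_n n" "bs \<in> lists_n n" "cs \<in> lists_n n" "ys \<in> lists_n n"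
    and J: "\<And>i. i < n \<Longrightarrow> 0 < J U (qs ! i, as ! i, bs ! i, cs ! i, ys ! i)"
  note pos = positive[OF U J]
  let ?r = "\<Prod>i<n. ratio (as ! i) (bs ! i) (cs ! i)"
  let ?k = "\<Prod>i<n. kap U (as ! i) (bs ! i) (cs ! i) (ys ! i)"
  let ?k1 = "\<Prod>i<n. kap1 U (as ! i) (bs ! i) (ys ! i)" and ?k2 = "\<Prod>i<n. kap2 U (as ! i) (cs ! i) (ys ! i)"
  let ?kz = "\<Prod>i<n. kap0 U (as ! i) (ys ! i)" and ?Q = "\<Prod>i<n. outQ U (qs ! i) (ys ! i)"
  let ?ss = "zip qs (zip as (zip bs (zip cs ys)))"
  have p: "0 < ?r" "0 < ?k" "0 < ?k1" "0 < ?k2" "0 < ?kz" "0 < ?Q" using pos by (auto intro!: prod_pos)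
  have sums: "(\<Sum>i<n. D12 U (?ss ! i)) = log 2 (?r * ?k / ?Q)" "(\<Sum>i<n. D1 U (?ss ! i)) = log 2 (?k1 / ?Q)"
    "(\<Sum>i<n. D2 U (?ss ! i)) = log 2 (?k2 / ?Q)" "(\<Sum>i<n. D0 U (?ss ! i)) = log 2 (?kz / ?Q)"
    using pos len
    by (simp_all add: D12_def D1_def D2_def D0_def lists_n_def prod_dividef[symmetric] prod.distrib[symmetric]
          log_prod_lessThan)
  have eq: "(?r * ?k / (K1 * K2) + ?k1 / K1 + ?k2 / K2 + ?kz) / (K0 * ?Q)
    = ?r * ?k / ?Q / (K0 * K1 * K2) + ?k1 / ?Q / (K0 * K1) + ?k2 / ?Q / (K0 * K2) + ?kz / ?Q / K0"
    by (simp add: add_divide_distrib ac_simps)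
  have lg: "log 2 (x / c) = log 2 x - log 2 c" if "0 < x" "0 < c" for x c :: real
    using that by (rule log_divide_pos)
  have "log 2 (1 + (?r * ?k / ?Q / (K0 * K1 * K2) + ?k1 / ?Q / (K0 * K1) + ?k2 / ?Q / (K0 * K2) + ?kz / ?Q / K0))
    \<le> 3 + (max 0 (log 2 (?r * ?k / ?Q / (K0 * K1 * K2))) + max 0 (log 2 (?k1 / ?Q / (K0 * K1)))
      + max 0 (log 2 (?k2 / ?Q / (K0 * K2))) + max 0 (log 2 (?kz / ?Q / K0)))"
    using p K by (intro log_one_plus_sum_le divide_pos_pos mult_pos_pos)
  also have "\<dots> = 3 + (max 0 (log 2 (?r * ?k / ?Q) - log 2 (K0 * K1 * K2)) + max 0 (log 2 (?k1 / ?Q) - log 2 (K0 * K1))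
      + max 0 (log 2 (?k2 / ?Q) - log 2 (K0 * K2)) + max 0 (log 2 (?kz / ?Q) - log 2 K0))"
    using p K by (simp only: lg divide_pos_pos mult_pos_pos)
  finally show "log 2 (1 + (?r * ?k / (K1 * K2) + ?k1 / K1 + ?k2 / K2 + ?kz) / (K0 * ?Q))
    \<le> 3 + (max 0 ((\<Sum>i<n. D12 U (?ss ! i)) - log 2 (K0 * K1 * K2))
        + max 0 ((\<Sum>i<n. D1 U (?ss ! i)) - log 2 (K0 * K1))
        + max 0 ((\<Sum>i<n. D2 U (?ss ! i)) - log 2 (K0 * K2))
        + max 0 ((\<Sum>i<n. D0 U (?ss ! i)) - log 2 K0))"
    unfolding eq sums .
qed

definition EJ :: "('x \<Rightarrow> 'y::finite \<Rightarrow> real) \<Rightarrow> ('q \<times> 'a \<times> 'b \<times> 'c \<times> 'y \<Rightarrow> real) \<Rightarrow> real" where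
  "EJ U d = (\<Sum>s\<in>UNIV. J U s * d s)"

definition vars :: "('x \<Rightarrow> 'y::finite \<Rightarrow> real) \<Rightarrow> real" where
  "vars U = variance_of (J U) (D12 U) + variance_of (J U) (D1 U) + variance_of (J U) (D2 U)
    + variance_of (J U) (D0 U)"

lemma average_code:
  fixes U1 :: "'x \<Rightarrow> 'y1::finite \<Rightarrow> real" and U2 :: "'x \<Rightarrow> 'y2::finite \<Rightarrow> real"
    and U3 :: "'x \<Rightarrow> 'z::finite \<Rightarrow> real" and Ms :: "'m set"
  assumes M: "finite Ms" "Ms \<noteq> {}" and n: "0 < n"
    and U: "\<And>x. is_pmf UNIV (U1 x)" "\<And>x. is_pmf UNIV (U2 x)" "\<And>x. is_pmf UNIV (U3 x)"
    and K: "0 < K0" "0 < K1" "0 < K2" and \<delta>: "0 < \<delta>"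
    and cov: "n * EJ U3 (D0 U3) \<le> log 2 (real K0)"
      "n * EJ U3 (D1 U3) \<le> log 2 (real K0 * real K1)"
      "n * EJ U3 (D2 U3) \<le> log 2 (real K0 * real K2)"
      "n * EJ U3 (D12 U3) \<le> log 2 (real K0 * real K1 * real K2)"
  shows "has_code Ms (lists_n n) (lists_n n) (lists_n n) (lists_n n)
      (prod_kernel n U1) (prod_kernel n U2) (prod_kernel n U3) (1 / n)
      (variance_of (J U1) (D1 U1) / (n * \<delta>\<^sup>2)
          + real (card Ms * K0) * (K1 / 2 powr (n * (EJ U1 (D1 U1) - \<delta>)))
        + (variance_of (J U2) (D2 U2) / (n * \<delta>\<^sup>2)
          + real (card Ms * K0) * (K2 / 2 powr (n * (EJ U2 (D2 U2) - \<delta>))))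
        + 1 / n * (1 / ln 2 + (3 + sqrt n * (4 + vars U3))))"
    (is "has_code _ _ _ _ _ _ _ _ _ ?B")
proof -
  \<comment> \<open>The exponents lie \<open>n * \<delta>\<close> below the means of the density
    sums: a miss is then a large deviation from the mean, while the false alarms still carry nearly
    the full exponent.\<close>
  let ?\<gamma>1 = "2 powr (n * (EJ U1 (D1 U1) - \<delta>))" and ?\<gamma>2 = "2 powr (n * (EJ U2 (D2 U2) - \<delta>))"
  let ?w = "\<lambda>qs. \<Prod>i<n. pq (qs ! i)"
  let ?c1 = "real (card Ms * K0) * (K1 / ?\<gamma>1)" and ?c2 = "real (card Ms * K0) * (K2 / ?\<gamma>2)"
  let ?G = "\<lambda>qs. miss1 n U1 ?\<gamma>1 qs + ?c1 + (miss2 n U2 ?\<gamma>2 qs + ?c2) + 1 / n * (1 / ln 2 + leak n U3 K0 K1 K2 qs)"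
  have w: "is_pmf (lists_n n) ?w" using pq by (intro is_pmf_lists)
  have "(\<Sum>qs\<in>lists_n n. ?w qs * miss1 n U1 ?\<gamma>1 qs)
    \<le> (\<Sum>ss\<in>lists_n n. (\<Prod>i<n. J U1 (ss ! i)) * of_bool ((\<Sum>i<n. D1 U1 (ss ! i)) \<le> log 2 ?\<gamma>1))"
    by (intro miss_average1 U) simp
  also have "\<dots> \<le> variance_of (J U1) (D1 U1) / (n * \<delta>\<^sup>2)"
    by (intro lower_tail is_pmf_J U n \<delta>) (simp add: EJ_def)
  finally have S1: "(\<Sum>qs\<in>lists_n n. ?w qs * miss1 n U1 ?\<gamma>1 qs) \<le> variance_of (J U1) (D1 U1) / (n * \<delta>\<^sup>2)" .
  have "(\<Sum>qs\<in>lists_n n. ?w qs * miss2 n U2 ?\<gamma>2 qs)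
    \<le> (\<Sum>ss\<in>lists_n n. (\<Prod>i<n. J U2 (ss ! i)) * of_bool ((\<Sum>i<n. D2 U2 (ss ! i)) \<le> log 2 ?\<gamma>2))"
    by (intro miss_average2 U) simp
  also have "\<dots> \<le> variance_of (J U2) (D2 U2) / (n * \<delta>\<^sup>2)"
    by (intro lower_tail is_pmf_J U n \<delta>) (simp add: EJ_def)
  finally have S2: "(\<Sum>qs\<in>lists_n n. ?w qs * miss2 n U2 ?\<gamma>2 qs) \<le> variance_of (J U2) (D2 U2) / (n * \<delta>\<^sup>2)" .
  have P3: "is_pmf UNIV (J U3)" by (intro is_pmf_J U)
  have s3: "(\<Sum>ss\<in>lists_n n. \<Prod>i<n. J U3 (ss ! i)) = 1"
    using is_pmfD(3)[OF is_pmf_lists, of n "\<lambda>_. J U3"] P3 by simp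
  note pp = positive_part[OF P3 n, folded EJ_def]
  have "(\<Sum>qs\<in>lists_n n. ?w qs * leak n U3 K0 K1 K2 qs)
    \<le> (\<Sum>ss\<in>lists_n n. (\<Prod>i<n. J U3 (ss ! i)) * (3 +
        (max 0 ((\<Sum>i<n. D12 U3 (ss ! i)) - log 2 (real K0 * real K1 * real K2))
        + max 0 ((\<Sum>i<n. D1 U3 (ss ! i)) - log 2 (real K0 * real K1))
        + max 0 ((\<Sum>i<n. D2 U3 (ss ! i)) - log 2 (real K0 * real K2))
        + max 0 ((\<Sum>i<n. D0 U3 (ss ! i)) - log 2 (real K0)))))"
    using K by (intro cover_average U) auto
  also have "\<dots> \<le> 3 + (sqrt n * (1 + variance_of (J U3) (D12 U3)) + sqrt n * (1 + variance_of (J U3) (D1 U3))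
      + sqrt n * (1 + variance_of (J U3) (D2 U3)) + sqrt n * (1 + variance_of (J U3) (D0 U3)))"
    unfolding distrib_left sum.distrib
    using pp[OF cov(1)] pp[OF cov(2)] pp[OF cov(3)] pp[OF cov(4)]
    by (simp add: s3 distrib_left flip: sum_distrib_right)
  also have "\<dots> = 3 + sqrt n * (4 + vars U3)" by (simp add: vars_def algebra_simps)
  finally have S3: "(\<Sum>qs\<in>lists_n n. ?w qs * leak n U3 K0 K1 K2 qs) \<le> 3 + sqrt n * (4 + vars U3)" .
  have c: "(\<Sum>qs\<in>lists_n n. ?w qs * c) = c" for c
    using is_pmfD(3)[OF w] by (simp flip: sum_distrib_right)
  have "(\<Sum>qs\<in>lists_n n. ?w qs * ?G qs)
    = (\<Sum>qs\<in>lists_n n. ?w qs * miss1 n U1 ?\<gamma>1 qs) + ?c1 + ((\<Sum>qs\<in>lists_n n. ?w qs * miss2 n U2 ?\<gamma>2 qs) + ?c2)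
      + 1 / n * (1 / ln 2 + (\<Sum>qs\<in>lists_n n. ?w qs * leak n U3 K0 K1 K2 qs))"
    by (simp only: distrib_left sum.distrib c mult.left_commute[of _ "1 / real n" "leak _ _ _ _ _ _"]
        sum_distrib_left[symmetric, of "1 / real n"])
  also have "\<dots> \<le> ?B"
    using S1 S2 S3 by (intro add_mono mult_left_mono) auto
  \<comment> \<open>Only the sum of all terms has been averaged, so a single \<open>qs\<close>
    controls both receivers and the leakage.\<close>
  finally obtain qs where qs: "?G qs \<le> ?B" by (rule is_pmf_le_average[OF w])
  have ne: "{..<K0} \<noteq> {}" using K by auto
  have "has_code Ms (lists_n n) (lists_n n) (lists_n n) (lists_n n)
      (prod_kernel n U1) (prod_kernel n U2) (prod_kernel n U3) (1 / n) (?G qs)"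
    using block_code[OF M finite_lessThan[of K0] ne U _ _ _ K(2,3), where ?\<gamma>1.0 = ?\<gamma>1 and ?\<gamma>2.0 = ?\<gamma>2
        and \<theta> = "1 / real n" and n = n and qs = qs]
    unfolding card_lessThan by simp
  then show ?thesis by (rule has_code_mono[OF _ qs])
qed

end

section \<open>Rates and codes for the channel\<close>

lemma num_msgs_ge: "2 powr (n * T) \<le> num_msgs n T"
  unfolding num_msgs_def by linarith

text \<open>Rounding up adds at most 1, which is at most \<open>2 powr (n * T)\<close> because
  \<open>0 \<le> T\<close>. Bins and second-layer codebooks get their sizes from the same
  function.\<close>

lemma num_msgs_le:
  assumes "0 \<le> T" shows "num_msgs n T \<le> 2 * 2 powr (n * T)"
proof -
  have "1 \<le> 2 powr (n * T)" using assms by (intro ge_one_powr_ge_zero) auto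
  then show ?thesis unfolding num_msgs_def by linarith
qed

lemma num_msgs_pos: "0 < num_msgs n T"
  using num_msgs_ge[of n T] powr_gt_zero[of 2 "n * T"] by linarith

lemma log_num_msgs: "n * T \<le> log 2 (num_msgs n T)"
  using num_msgs_ge[of n T] num_msgs_pos[of n T] by (subst le_log_iff) auto

context memoryless begin

text \<open>The covering conditions may be equalities: sizes are rounded up, and the positive parts
  have order \<open>sqrt n\<close> at most. The packing conditions are strict in order to give the
  false alarms a negative exponent.\<close>

lemma good_codes:
  fixes U1 :: "'x \<Rightarrow> 'y1::finite \<Rightarrow> real" and U2 :: "'x \<Rightarrow> 'y2::finite \<Rightarrow> real"
    and U3 :: "'x \<Rightarrow> 'z::finite \<Rightarrow> real"
  assumes U: "\<And>x. is_pmf UNIV (U1 x)" "\<And>x. is_pmf UNIV (U2 x)" "\<And>x. is_pmf UNIV (U3 x)"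
    and R: "0 \<le> R" and T: "0 \<le> T0" "0 \<le> T1" "0 \<le> T2"
    and cov: "EJ U3 (D0 U3) \<le> T0" "EJ U3 (D1 U3) \<le> T0 + T1" "EJ U3 (D2 U3) \<le> T0 + T2"
      "EJ U3 (D12 U3) \<le> T0 + T1 + T2"
    and pack: "R + T0 + T1 < EJ U1 (D1 U1)" "R + T0 + T2 < EJ U2 (D2 U2)"
  obtains \<epsilon> :: "nat \<Rightarrow> real" where "\<epsilon> \<longlonglongrightarrow> 0"
    "\<And>n. 0 < n \<Longrightarrow> has_code (msgs n R) (lists_n n) (lists_n n) (lists_n n) (lists_n n)
      (prod_kernel n U1) (prod_kernel n U2) (prod_kernel n U3) (1 / n) (\<epsilon> n)"
proof -
  \<comment> \<open>Half of the smaller slack: one \<open>\<delta>\<close> puts the threshold below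
    the mean, the other is the decay rate of the false alarms.\<close>
  define \<delta> where "\<delta> = min (EJ U1 (D1 U1) - (R + T0 + T1)) (EJ U2 (D2 U2) - (R + T0 + T2)) / 2"
  have \<delta>: "0 < \<delta>" "R + T0 + T1 + 2 * \<delta> \<le> EJ U1 (D1 U1)" "R + T0 + T2 + 2 * \<delta> \<le> EJ U2 (D2 U2)"
    using pack by (auto simp: \<delta>_def min_def field_simps)
  define v1 v2 where "v1 = variance_of (J U1) (D1 U1) / \<delta>\<^sup>2" and "v2 = variance_of (J U2) (D2 U2) / \<delta>\<^sup>2"
  \<comment> \<open>The 8 collects three rounding factors 2, from the messages, the bins and the
    second layer. The weight \<open>1 / n\<close> turns a leakage of order \<open>sqrt n\<close>
    into \<open>1 / sqrt n\<close>.\<close>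
  define \<epsilon> where "\<epsilon> n = v1 / real n + 8 * 2 powr (- \<delta> * real n) + (v2 / real n + 8 * 2 powr (- \<delta> * real n))
    + ((1 / ln 2 + 3) / real n + (4 + vars U3) / sqrt (real n))" for n :: nat
  have exp0: "(\<lambda>n. 2 powr (- \<delta> * real n)) \<longlonglongrightarrow> 0"
    using \<delta>(1) by real_asymp
  have sq0: "(\<lambda>n. c / sqrt (real n)) \<longlonglongrightarrow> 0" for c
    by (intro real_tendsto_divide_at_top[OF tendsto_const] filterlim_compose[OF sqrt_at_top] filterlim_real_sequentially)
  have "\<epsilon> \<longlonglongrightarrow> 0 + 8 * 0 + (0 + 8 * 0) + (0 + 0)"
    unfolding \<epsilon>_def by (intro tendsto_intros exp0 sq0 lim_const_over_n)
  then have lim: "\<epsilon> \<longlonglongrightarrow> 0" by simp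
  have rate: "real (num_msgs n R * num_msgs n T0) * (num_msgs n T / 2 powr (n * (I - \<delta>)))
      \<le> 8 * 2 powr (- \<delta> * n)" if "0 \<le> T" "R + T0 + T + 2 * \<delta> \<le> I" for n T I
  proof -
    have "real (num_msgs n R * num_msgs n T0) * num_msgs n T
      \<le> (2 * 2 powr (n * R)) * (2 * 2 powr (n * T0)) * (2 * 2 powr (n * T))"
      unfolding of_nat_mult using num_msgs_le R \<open>0 \<le> T0\<close> \<open>0 \<le> T\<close> by (intro mult_mono) auto
    also have "\<dots> = 8 * 2 powr (n * (R + T0 + T))" by (simp add: powr_add distrib_left)
    finally have "real (num_msgs n R * num_msgs n T0) * (num_msgs n T / 2 powr (n * (I - \<delta>)))
      \<le> 8 * 2 powr (n * (R + T0 + T)) / 2 powr (n * (I - \<delta>))"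
      unfolding times_divide_eq_right by (intro divide_right_mono) auto
    also have "\<dots> = 8 * 2 powr (n * (R + T0 + T - (I - \<delta>)))"
      by (simp add: powr_diff right_diff_distrib)
    also have "\<dots> \<le> 8 * 2 powr (- \<delta> * n)"
    proof -
      have "real n * (R + T0 + T - (I - \<delta>)) \<le> real n * (- \<delta>)" using that by (intro mult_left_mono) auto
      then show ?thesis by (simp add: mult.commute)
    qed
    finally show ?thesis .
  qed
  show thesis
  proof (rule that[OF lim])
    fix n :: nat assume n: "0 < n"
    let ?K0 = "num_msgs n T0" and ?K1 = "num_msgs n T1" and ?K2 = "num_msgs n T2"
    have lg: "log 2 (x * y) = log 2 x + log 2 y" if "0 < x" "0 < y" for x y :: real
      using that by (rule log_mult_pos)
    have c: "n * e \<le> L" if "e \<le> t" "n * t \<le> L" for e t L :: real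
      using mult_left_mono[OF that(1), of n] that(2) by simp
    have cov': "n * EJ U3 (D0 U3) \<le> log 2 (real ?K0)"
      "n * EJ U3 (D1 U3) \<le> log 2 (real ?K0 * real ?K1)"
      "n * EJ U3 (D2 U3) \<le> log 2 (real ?K0 * real ?K2)"
      "n * EJ U3 (D12 U3) \<le> log 2 (real ?K0 * real ?K1 * real ?K2)"
      using log_num_msgs[of n T0] log_num_msgs[of n T1] log_num_msgs[of n T2] num_msgs_pos
      by (auto intro!: c[OF cov(1)] c[OF cov(2)] c[OF cov(3)] c[OF cov(4)] simp: lg distrib_left)
    have M: "finite (msgs n R)" "msgs n R \<noteq> {}" "card (msgs n R) = num_msgs n R"
      using num_msgs_pos[of n R] by (auto simp: msgs_def)
    have le: "variance_of (J U1) (D1 U1) / (n * \<delta>\<^sup>2)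
          + real (card (msgs n R) * ?K0) * (?K1 / 2 powr (n * (EJ U1 (D1 U1) - \<delta>)))
        + (variance_of (J U2) (D2 U2) / (n * \<delta>\<^sup>2)
          + real (card (msgs n R) * ?K0) * (?K2 / 2 powr (n * (EJ U2 (D2 U2) - \<delta>))))
        + 1 / n * (1 / ln 2 + (3 + sqrt n * (4 + vars U3))) \<le> \<epsilon> n"
      unfolding \<epsilon>_def M(3)
    proof (intro add_mono rate T \<delta>)
      have "1 / n * (sqrt n * (4 + vars U3)) = (4 + vars U3) / sqrt n"
      proof -
        have "1 / real n * (sqrt n * (4 + vars U3)) = 1 / (sqrt n * sqrt n) * (sqrt n * (4 + vars U3))" by simp
        also have "\<dots> = (4 + vars U3) / sqrt n" using n by (simp del: real_sqrt_mult_self)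
        finally show ?thesis .
      qed
      then show "1 / real n * (1 / ln 2 + (3 + sqrt n * (4 + vars U3)))
        \<le> (1 / ln 2 + 3) / n + (4 + vars U3) / sqrt n"
        unfolding add.assoc[symmetric] distrib_left[of "1 / real n" "1 / ln 2 + 3"] by simp
    qed (auto simp: v1_def v2_def mult.commute)
    show "has_code (msgs n R) (lists_n n) (lists_n n) (lists_n n) (lists_n n)
        (prod_kernel n U1) (prod_kernel n U2) (prod_kernel n U3) (1 / n) (\<epsilon> n)"
      by (rule has_code_mono[OF average_code[where ?U1.0 = U1 and ?U2.0 = U2 and ?U3.0 = U3,
            OF M(1,2) n U num_msgs_pos num_msgs_pos num_msgs_pos \<delta>(1) cov'] le])
  qed
qed

end

section \<open>Marginal channels, error probability and equivocation\<close>

definition margin1 :: "('x \<Rightarrow> 'y1 \<times> 'y2 \<times> 'z \<Rightarrow> real) \<Rightarrow> 'x \<Rightarrow> 'y1 \<Rightarrow> real" where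
  "margin1 W x y1 = (\<Sum>y2\<in>UNIV. \<Sum>z\<in>UNIV. W x (y1, y2, z))"
definition margin2 :: "('x \<Rightarrow> 'y1 \<times> 'y2 \<times> 'z \<Rightarrow> real) \<Rightarrow> 'x \<Rightarrow> 'y2 \<Rightarrow> real" where
  "margin2 W x y2 = (\<Sum>y1\<in>UNIV. \<Sum>z\<in>UNIV. W x (y1, y2, z))"
definition margin3 :: "('x \<Rightarrow> 'y1 \<times> 'y2 \<times> 'z \<Rightarrow> real) \<Rightarrow> 'x \<Rightarrow> 'z \<Rightarrow> real" where
  "margin3 W x z = (\<Sum>y1\<in>UNIV. \<Sum>y2\<in>UNIV. W x (y1, y2, z))"

lemma pmf_on_is_pmf: "pmf_on p \<longleftrightarrow> is_pmf UNIV p"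
  by (auto simp: pmf_on_def is_pmf_def)

lemma is_pmf_margins:
  fixes W :: "'x::finite \<Rightarrow> 'y1::finite \<times> 'y2::finite \<times> 'z::finite \<Rightarrow> real"
  assumes "dmc W"
  shows "is_pmf UNIV (margin1 W x)" "is_pmf UNIV (margin2 W x)" "is_pmf UNIV (margin3 W x)"
proof -
  have W: "is_pmf UNIV (W x)" using assms by (simp add: dmc_def pmf_on_is_pmf)
  have s: "(\<Sum>y1\<in>UNIV. \<Sum>y2\<in>UNIV. \<Sum>z\<in>UNIV. W x (y1, y2, z)) = 1"
    using is_pmfD(3)[OF W] by (simp add: sum.cartesian_product' flip: UNIV_Times_UNIV)
  have nn: "0 \<le> W x y" for y using is_pmfD(2)[OF W] by simp
  show "is_pmf UNIV (margin1 W x)"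
    using s nn by (auto simp: is_pmf_def margin1_def intro!: sum_nonneg)
  have "(\<Sum>y2\<in>UNIV. \<Sum>y1\<in>UNIV. \<Sum>z\<in>UNIV. W x (y1, y2, z)) = 1"
    by (subst sum.swap) (rule s)
  then show "is_pmf UNIV (margin2 W x)"
    using nn by (auto simp: is_pmf_def margin2_def intro!: sum_nonneg)
  have "(\<Sum>z\<in>UNIV. \<Sum>y1\<in>UNIV. \<Sum>y2\<in>UNIV. W x (y1, y2, z)) = 1"
    using s by (simp only: sum.swap[of _ _ "UNIV :: 'z set"])
  then show "is_pmf UNIV (margin3 W x)"
    using nn by (auto simp: is_pmf_def margin3_def intro!: sum_nonneg)
qed

lemma sum_code_joint:
  "(\<Sum>s\<in>code_space n R. code_joint W n R enc s * F s)
    = (\<Sum>m\<in>msgs n R. \<Sum>xs\<in>lists_n n. \<Sum>ys1\<in>lists_n n. \<Sum>ys2\<in>lists_n n. \<Sum>zs\<in>lists_n n.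
        enc m xs / num_msgs n R * (\<Prod>i<n. W (xs ! i) (ys1 ! i, ys2 ! i, zs ! i)) * F (m, xs, ys1, ys2, zs))"
  by (simp add: code_space_def code_joint_def sum.cartesian_product')

abbreviation block_out ::
    "nat \<Rightarrow> ('m \<Rightarrow> 'x list \<Rightarrow> real) \<Rightarrow> ('x \<Rightarrow> 'y \<Rightarrow> real) \<Rightarrow> 'm \<Rightarrow> 'y list \<Rightarrow> real" where
  "block_out n enc U \<equiv> through (lists_n n) enc (prod_kernel n U)"

text \<open>A quantity of the message and one output sees only the corresponding marginal channel,
  because the sum over the two other output blocks factors over the positions.\<close>

lemma sum_code_joint_margins:
  fixes W :: "'x::finite \<Rightarrow> 'y1::finite \<times> 'y2::finite \<times> 'z::finite \<Rightarrow> real"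
  shows "(\<Sum>s\<in>code_space n R. code_joint W n R enc s * (case s of (m, xs, ys1, ys2, zs) \<Rightarrow> F1 m ys1))
      = (\<Sum>m\<in>msgs n R. \<Sum>ys\<in>lists_n n. block_out n enc (margin1 W) m ys * F1 m ys) / num_msgs n R"
    and "(\<Sum>s\<in>code_space n R. code_joint W n R enc s * (case s of (m, xs, ys1, ys2, zs) \<Rightarrow> F2 m ys2))
      = (\<Sum>m\<in>msgs n R. \<Sum>ys\<in>lists_n n. block_out n enc (margin2 W) m ys * F2 m ys) / num_msgs n R"
    and "(\<Sum>s\<in>code_space n R. code_joint W n R enc s * (case s of (m, xs, ys1, ys2, zs) \<Rightarrow> F3 m zs))
      = (\<Sum>m\<in>msgs n R. \<Sum>zs\<in>lists_n n. block_out n enc (margin3 W) m zs * F3 m zs) / num_msgs n R"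
proof -
  let ?L1 = "lists_n n :: 'y1 list set" and ?L2 = "lists_n n :: 'y2 list set"
    and ?L3 = "lists_n n :: 'z list set" and ?X = "lists_n n :: 'x list set"
  let ?p = "\<lambda>m xs. enc m xs / num_msgs n R"
  let ?W = "\<lambda>xs ys1 ys2 zs. \<Prod>i<n. W (xs ! i) (ys1 ! i, ys2 ! i, zs ! i)"
  have m1: "(\<Sum>ys2\<in>?L2. \<Sum>zs\<in>?L3. ?W xs ys1 ys2 zs) = prod_kernel n (margin1 W) xs ys1" for xs ys1
    unfolding prod_kernel_def margin1_def by (rule sum_lists_prod2)
  have m2: "(\<Sum>ys1\<in>?L1. \<Sum>zs\<in>?L3. ?W xs ys1 ys2 zs) = prod_kernel n (margin2 W) xs ys2" for xs ys2
    unfolding prod_kernel_def margin2_def by (rule sum_lists_prod2)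
  have m3: "(\<Sum>ys1\<in>?L1. \<Sum>ys2\<in>?L2. ?W xs ys1 ys2 zs) = prod_kernel n (margin3 W) xs zs" for xs zs
    unfolding prod_kernel_def margin3_def by (rule sum_lists_prod2)
  have fold: "(\<Sum>xs\<in>?X. \<Sum>ys\<in>lists_n n. ?p m xs * (prod_kernel n V xs ys * F m ys))
      = (\<Sum>ys\<in>lists_n n. block_out n enc V m ys * F m ys) / num_msgs n R"
    for V :: "'x \<Rightarrow> 'y::finite \<Rightarrow> real" and m F
    unfolding through_def sum_distrib_right sum_divide_distrib by (subst sum.swap) (simp add: mult.assoc)
  show "(\<Sum>s\<in>code_space n R. code_joint W n R enc s * (case s of (m, xs, ys1, ys2, zs) \<Rightarrow> F1 m ys1))
      = (\<Sum>m\<in>msgs n R. \<Sum>ys\<in>lists_n n. block_out n enc (margin1 W) m ys * F1 m ys) / num_msgs n R"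
    unfolding sum_divide_distrib[of _ "msgs n R"] fold[symmetric] m1[symmetric] sum_code_joint prod.case
    by (simp only: sum_distrib_left sum_distrib_right mult.assoc)
  have "(\<Sum>ys1\<in>?L1. \<Sum>ys2\<in>?L2. \<Sum>zs\<in>?L3. ?p m xs * ?W xs ys1 ys2 zs * F2 m ys2)
    = (\<Sum>ys2\<in>?L2. ?p m xs * (prod_kernel n (margin2 W) xs ys2 * F2 m ys2))" for m xs
    unfolding m2[symmetric] by (subst sum.swap) (simp only: sum_distrib_left sum_distrib_right mult.assoc)
  then show "(\<Sum>s\<in>code_space n R. code_joint W n R enc s * (case s of (m, xs, ys1, ys2, zs) \<Rightarrow> F2 m ys2))
      = (\<Sum>m\<in>msgs n R. \<Sum>ys\<in>lists_n n. block_out n enc (margin2 W) m ys * F2 m ys) / num_msgs n R"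
    unfolding sum_divide_distrib[of _ "msgs n R"] fold[symmetric] sum_code_joint prod.case by simp
  have "(\<Sum>ys1\<in>?L1. \<Sum>ys2\<in>?L2. \<Sum>zs\<in>?L3. ?p m xs * ?W xs ys1 ys2 zs * F3 m zs)
    = (\<Sum>zs\<in>?L3. ?p m xs * (prod_kernel n (margin3 W) xs zs * F3 m zs))" for m xs
    unfolding m3[symmetric]
    by (simp only: sum_distrib_left sum_distrib_right mult.assoc sum.swap[of _ ?L3 ?L1] sum.swap[of _ ?L3 ?L2])
  then show "(\<Sum>s\<in>code_space n R. code_joint W n R enc s * (case s of (m, xs, ys1, ys2, zs) \<Rightarrow> F3 m zs))
      = (\<Sum>m\<in>msgs n R. \<Sum>zs\<in>lists_n n. block_out n enc (margin3 W) m zs * F3 m zs) / num_msgs n R"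
    unfolding sum_divide_distrib[of _ "msgs n R"] fold[symmetric] sum_code_joint prod.case by simp
qed

lemma code_joint_nonneg:
  fixes W :: "'x::finite \<Rightarrow> 'y1::finite \<times> 'y2::finite \<times> 'z::finite \<Rightarrow> real"
  assumes "dmc W" "\<And>m. m \<in> msgs n R \<Longrightarrow> is_pmf (lists_n n) (enc m)" "s \<in> code_space n R"
  shows "0 \<le> code_joint W n R enc s"
  using assms is_pmfD(2)[OF assms(2)]
  by (auto simp: code_joint_def code_space_def dmc_def pmf_on_def
      intro!: mult_nonneg_nonneg divide_nonneg_nonneg prod_nonneg)

lemma err_prob_le:
  fixes W :: "'x::finite \<Rightarrow> 'y1::finite \<times> 'y2::finite \<times> 'z::finite \<Rightarrow> real"
  assumes W: "dmc W" and enc: "\<And>m. m \<in> msgs n R \<Longrightarrow> is_pmf (lists_n n) (enc m)"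
  shows "0 \<le> err_prob W n R enc dec1 dec2"
    and "err_prob W n R enc dec1 dec2
      \<le> avg_error (msgs n R) (lists_n n) (block_out n enc (margin1 W)) dec1
      + avg_error (msgs n R) (lists_n n) (block_out n enc (margin2 W)) dec2"
proof -
  note nn = code_joint_nonneg[OF W enc]
  show "0 \<le> err_prob W n R enc dec1 dec2"
    unfolding err_prob_def by (intro sum_nonneg mult_nonneg_nonneg nn) auto
  have "err_prob W n R enc dec1 dec2 \<le> (\<Sum>s\<in>code_space n R.
      code_joint W n R enc s * (case s of (m, xs, ys1, ys2, zs) \<Rightarrow> of_bool (dec1 ys1 \<noteq> Some m))
    + code_joint W n R enc s * (case s of (m, xs, ys1, ys2, zs) \<Rightarrow> of_bool (dec2 ys2 \<noteq> Some m)))"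
    unfolding err_prob_def distrib_left[symmetric]
    by (intro sum_mono mult_left_mono nn) auto
  also have "\<dots> = avg_error (msgs n R) (lists_n n) (block_out n enc (margin1 W)) dec1
      + avg_error (msgs n R) (lists_n n) (block_out n enc (margin2 W)) dec2"
    unfolding sum.distrib sum_code_joint_margins(1)[where ?F1.0 = "\<lambda>m ys. of_bool (dec1 ys \<noteq> Some m)"]
      sum_code_joint_margins(2)[where ?F2.0 = "\<lambda>m ys. of_bool (dec2 ys \<noteq> Some m)"] avg_error_def
    by (simp add: msgs_def)
  finally show "err_prob W n R enc dec1 dec2
      \<le> avg_error (msgs n R) (lists_n n) (block_out n enc (margin1 W)) dec1
      + avg_error (msgs n R) (lists_n n) (block_out n enc (margin2 W)) dec2" .
qed

lemma finite_code_space: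
  "finite (code_space n R :: (nat \<times> 'x::finite list \<times> 'y1::finite list \<times> 'y2::finite list \<times> 'z::finite list) set)"
  by (auto simp: code_space_def msgs_def)

text \<open>With \<open>Pb\<close> the output law averaged over the messages, H(M|Z) equals log |M|
  minus the average divergence of the laws given \<open>m\<close> from \<open>Q\<close>, plus the
  divergence of \<open>Pb\<close> from \<open>Q\<close>. The last term is nonnegative, so any
  dominating \<open>Q\<close> can serve as reference.\<close>

lemma equivocation_ge:
  fixes W :: "'x::finite \<Rightarrow> 'y1::finite \<times> 'y2::finite \<times> 'z::finite \<Rightarrow> real"
  assumes W: "dmc W" and enc: "\<And>m. m \<in> msgs n R \<Longrightarrow> is_pmf (lists_n n) (enc m)"
    and Q: "is_pmf (lists_n n) Q"
      "\<And>m z. m \<in> msgs n R \<Longrightarrow> z \<in> lists_n n \<Longrightarrow> 0 < block_out n enc (margin3 W) m z \<Longrightarrow> 0 < Q z"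
  shows "log 2 (num_msgs n R) - avg_div (msgs n R) (lists_n n) (block_out n enc (margin3 W)) Q
    \<le> equivocation W n R enc"
proof -
  let ?P = "block_out n enc (margin3 W)" and ?M = "real (num_msgs n R)"
  let ?S = "code_space n R" and ?p = "code_joint W n R enc"
  have M: "?M > 0" using num_msgs_pos by simp
  have P: "is_pmf (lists_n n) (?P m)" if "m \<in> msgs n R" for m
    using that by (intro is_pmf_through enc is_pmf_prod_kernel is_pmf_margins[OF W])
  define Pb where "Pb z = (\<Sum>m\<in>msgs n R. ?P m z) / ?M" for z
  have margmz: "marg ?S ?p (\<lambda>b. ((case b of (m, xs, ys1, ys2, zs) \<Rightarrow> m), (case b of (m, xs, ys1, ys2, zs) \<Rightarrow> zs)))
      (m, xs, ys1, ys2, zs) = ?P m zs / ?M" if "m \<in> msgs n R" "zs \<in> lists_n n" for m xs ys1 ys2 zs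
  proof -
    have "marg ?S ?p (\<lambda>b. ((case b of (m, xs, ys1, ys2, zs) \<Rightarrow> m), (case b of (m, xs, ys1, ys2, zs) \<Rightarrow> zs)))
      (m, xs, ys1, ys2, zs) = (\<Sum>s\<in>?S. ?p s * (case s of (m', xs', ys1', ys2', zs') \<Rightarrow> of_bool (m' = m \<and> zs' = zs)))"
      unfolding marg_def by (rule sum.mono_neutral_cong_left) (auto simp: finite_code_space)
    also have "\<dots> = (\<Sum>m'\<in>msgs n R. \<Sum>z\<in>lists_n n. ?P m' z * of_bool (m' = m \<and> z = zs)) / ?M"
      by (rule sum_code_joint_margins(3)[where ?F3.0 = "\<lambda>m' z. of_bool (m' = m \<and> z = zs)"])
    also have "(\<Sum>m'\<in>msgs n R. \<Sum>z\<in>lists_n n. ?P m' z * of_bool (m' = m \<and> z = zs))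
      = (\<Sum>m'\<in>msgs n R. if m' = m then \<Sum>z\<in>lists_n n. if z = zs then ?P m' z else 0 else 0)"
      by (intro sum.cong refl) (auto simp: of_bool_def if_distrib[of "(*) _"] cong: if_cong)
    also have "\<dots> = ?P m zs" using that by (simp add: msgs_def)
    finally show ?thesis .
  qed
  have margz: "marg ?S ?p (\<lambda>(m, xs, ys1, ys2, zs). zs) (m, xs, ys1, ys2, zs) = Pb zs"
    if "zs \<in> lists_n n" for m xs ys1 ys2 zs
  proof -
    have "marg ?S ?p (\<lambda>(m, xs, ys1, ys2, zs). zs) (m, xs, ys1, ys2, zs)
      = (\<Sum>s\<in>?S. ?p s * (case s of (m', xs', ys1', ys2', zs') \<Rightarrow> of_bool (zs' = zs)))"
      unfolding marg_def by (rule sum.mono_neutral_cong_left) (auto simp: finite_code_space)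
    also have "\<dots> = (\<Sum>m'\<in>msgs n R. \<Sum>z\<in>lists_n n. ?P m' z * of_bool (z = zs)) / ?M"
      by (rule sum_code_joint_margins(3)[where ?F3.0 = "\<lambda>m' z. of_bool (z = zs)"])
    also have "\<dots> = Pb zs" using that by (simp add: Pb_def of_bool_def if_distrib cong: if_cong)
    finally show ?thesis .
  qed
  have eq: "equivocation W n R enc
    = - ((\<Sum>m\<in>msgs n R. \<Sum>z\<in>lists_n n. ?P m z * log 2 (?P m z / ?M / Pb z)) / ?M)"
  proof -
    have "equivocation W n R enc = - (\<Sum>s\<in>?S. ?p s * (case s of (m, xs, ys1, ys2, zs) \<Rightarrow> log 2 (?P m zs / ?M / Pb zs)))"
      unfolding equivocation_def cent_def
    proof (intro arg_cong[of _ _ uminus] sum.cong refl, goal_cases)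
      case (1 s)
      then obtain m xs ys1 ys2 zs where s: "s = (m, xs, ys1, ys2, zs)" "m \<in> msgs n R" "zs \<in> lists_n n"
        by (auto simp: code_space_def)
      show ?case unfolding s(1) margmz[OF s(2,3)] margz[OF s(3)] prod.case ..
    qed
    then show ?thesis by (simp only: sum_code_joint_margins(3))
  qed
  have Pbsum: "is_pmf (lists_n n) Pb"
  proof -
    have "(\<Sum>z\<in>lists_n n. Pb z) = (\<Sum>m\<in>msgs n R. \<Sum>z\<in>lists_n n. ?P m z) / ?M"
      unfolding Pb_def sum_divide_distrib[symmetric] by (subst sum.swap) simp
    also have "\<dots> = 1" using is_pmfD(3)[OF P] M by (simp add: msgs_def)
    finally show ?thesis using is_pmfD(2)[OF P] M by (auto simp: is_pmf_def Pb_def intro!: sum_nonneg divide_nonneg_nonneg)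
  qed
  have pb: "0 < Pb z" if "m \<in> msgs n R" "z \<in> lists_n n" "0 < ?P m z" for m z
  proof -
    have "?P m z \<le> (\<Sum>m\<in>msgs n R. ?P m z)"
      using that is_pmfD(2)[OF P] by (intro member_le_sum[of m _ "\<lambda>m. ?P m z"]) (auto simp: msgs_def)
    then show ?thesis using that M by (simp add: Pb_def)
  qed
  have pointwise: "?P m z * log 2 (?P m z / ?M / Pb z)
    = ?P m z * log 2 (?P m z / Q z) - ?P m z * log 2 ?M - ?P m z * log 2 (Pb z / Q z)"
    if "m \<in> msgs n R" "z \<in> lists_n n" for m z
  proof (cases "?P m z = 0")
    case False
    then have p: "0 < ?P m z" using is_pmfD(2)[OF P] that by (simp add: order.strict_iff_order)
    then have "0 < Pb z" "0 < Q z" using pb Q that by auto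
    then have "log 2 (?P m z / ?M / Pb z) = log 2 (?P m z / Q z) - log 2 ?M - log 2 (Pb z / Q z)"
      using p M by (simp add: log_divide_pos log_mult_pos)
    then show ?thesis by (simp add: right_diff_distrib)
  qed simp
  have "(\<Sum>m\<in>msgs n R. \<Sum>z\<in>lists_n n. ?P m z * log 2 (?P m z / ?M / Pb z)) / ?M
    = avg_div (msgs n R) (lists_n n) ?P Q - (\<Sum>m\<in>msgs n R. \<Sum>z\<in>lists_n n. ?P m z * log 2 ?M) / ?M
      - (\<Sum>m\<in>msgs n R. \<Sum>z\<in>lists_n n. ?P m z * log 2 (Pb z / Q z)) / ?M"
    unfolding avg_div_def
    by (simp only: pointwise sum_subtractf diff_divide_distrib cong: sum.cong) (simp add: msgs_def)
  also have "(\<Sum>m\<in>msgs n R. \<Sum>z\<in>lists_n n. ?P m z * log 2 ?M) / ?M = log 2 ?M"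
    using is_pmfD(3)[OF P] M by (simp add: msgs_def flip: sum_distrib_right)
  also have "(\<Sum>m\<in>msgs n R. \<Sum>z\<in>lists_n n. ?P m z * log 2 (Pb z / Q z)) / ?M
    = (\<Sum>z\<in>lists_n n. Pb z * log 2 (Pb z / Q z))"
    unfolding Pb_def by (subst sum.swap) (simp add: sum_distrib_right sum_divide_distrib)
  finally have main: "equivocation W n R enc = log 2 ?M - avg_div (msgs n R) (lists_n n) ?P Q
      + (\<Sum>z\<in>lists_n n. Pb z * log 2 (Pb z / Q z))"
    unfolding eq by simp
  have "0 \<le> (\<Sum>z\<in>lists_n n. Pb z * log 2 (Pb z / Q z))"
  proof (rule divergence_nonneg[OF Pbsum])
    fix z assume z: "z \<in> lists_n n" "0 < Pb z"
    then have "(\<Sum>m\<in>msgs n R. ?P m z) \<noteq> 0" by (auto simp: Pb_def)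
    then obtain m where "m \<in> msgs n R" "?P m z \<noteq> 0" using sum.neutral by meson
    then show "0 < Q z" using Q(2)[of m z] is_pmfD(2)[OF P] z by (simp add: order.strict_iff_order)
  qed (use is_pmfD[OF Q(1)] in auto)
  then show ?thesis unfolding main by simp
qed

section \<open>Single-letter information quantities\<close>

definition push :: "('s::finite \<Rightarrow> real) \<Rightarrow> ('s \<Rightarrow> 't) \<Rightarrow> 't \<Rightarrow> real" where
  "push p \<pi> t = (\<Sum>s\<in>{s. \<pi> s = t}. p s)"

lemma marg_push:
  fixes p :: "'s::finite \<Rightarrow> real" and \<pi> :: "'s \<Rightarrow> 't::finite"
  shows "marg UNIV p (\<lambda>s. F (\<pi> s)) a = marg UNIV (push p \<pi>) F (\<pi> a)"
proof -
  have "(\<Sum>t\<in>{t. F t = F (\<pi> a)}. push p \<pi> t)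
    = (\<Sum>t\<in>{t. F t = F (\<pi> a)}. sum p {s \<in> {s. F (\<pi> s) = F (\<pi> a)}. \<pi> s = t})"
    unfolding push_def by (intro sum.cong) (auto intro!: arg_cong[of _ _ "sum p"])
  also have "\<dots> = sum p {s. F (\<pi> s) = F (\<pi> a)}"
    by (rule sum.group) auto
  finally show ?thesis by (simp add: marg_def)
qed

text \<open>Mutual information depends only on the joint law of its arguments. This passes from the
  eight-component sample space to tuples with a single output, where X and the other outputs are
  summed out.\<close>

lemma cmi_push:
  fixes p :: "'s::finite \<Rightarrow> real" and \<pi> :: "'s \<Rightarrow> 't::finite"
  shows "cmi UNIV p (\<lambda>s. f (\<pi> s)) (\<lambda>s. g (\<pi> s)) (\<lambda>s. h (\<pi> s)) = cmi UNIV (push p \<pi>) f g h"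
proof -
  have "(\<Sum>s\<in>UNIV. p s * G (\<pi> s)) = (\<Sum>t\<in>UNIV. push p \<pi> t * G t)" for G :: "'t \<Rightarrow> real"
    using sum.group[of UNIV UNIV \<pi> "\<lambda>s. p s * G (\<pi> s)"]
    by (simp add: push_def sum_distrib_right)
  then show ?thesis
    unfolding cmi_def marg_push[of p "\<lambda>t. (f t, g t, h t)" \<pi>] marg_push[of p "\<lambda>t. (f t, h t)" \<pi>]
      marg_push[of p "\<lambda>t. (g t, h t)" \<pi>] marg_push[of p h \<pi>] .
qed

text \<open>Gibbs' inequality with the reference function \<open>P s * (v s / u s)\<close>. In the
  applications its mass is computed by cancelling \<open>u\<close> against a kernel obtained by
  summing out part of \<open>P\<close>.\<close>

lemma expectation_log_ratio_nonneg:
  assumes P: "is_pmf A P" and pos: "\<And>s. s \<in> A \<Longrightarrow> 0 < P s \<Longrightarrow> 0 < u s \<and> 0 < v s"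
    and le: "(\<Sum>s\<in>A. P s * (v s / u s)) \<le> 1"
  shows "0 \<le> (\<Sum>s\<in>A. P s * log 2 (u s / v s))"
proof -
  have P0: "P s = 0 \<or> 0 < P s" if "s \<in> A" for s using is_pmfD(2)[OF P that] by auto
  have "0 \<le> (\<Sum>s\<in>A. P s * log 2 (P s / (P s * (v s / u s))))"
  proof (rule divergence_nonneg[OF P _ le])
    show "0 \<le> P s * (v s / u s)" if "s \<in> A" for s using P0[OF that] pos[OF that] by auto
    show "0 < P s * (v s / u s)" if "s \<in> A" "0 < P s" for s using pos[OF that] that by simp
  qed
  also have "\<dots> = (\<Sum>s\<in>A. P s * log 2 (u s / v s))"
  proof (intro sum.cong refl)
    fix s assume "s \<in> A"
    then show "P s * log 2 (P s / (P s * (v s / u s))) = P s * log 2 (u s / v s)"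
      using P0[of s] by auto
  qed
  finally show ?thesis .
qed

context memoryless begin

lemma p12_div_p1: "p1 a b * (p12 a b c / p1 a b) = p12 a b c"
proof (cases "p1 a b = 0")
  case True
  have "p12 a b c \<le> p1 a b" unfolding p1_def by (intro member_le_sum) auto
  then show ?thesis using True nonneg(3)[of a b c] by simp
qed simp

lemma p12_div_p2: "p2 a c * (p12 a b c / p2 a c) = p12 a b c"
proof (cases "p2 a c = 0")
  case True
  have "p12 a b c \<le> p2 a c" unfolding p2_def by (intro member_le_sum[of b _ "\<lambda>b. p12 a b c"]) auto
  then show ?thesis using True nonneg(3)[of a b c] by simp
qed simp

lemma p1_kap1: "(\<Sum>c\<in>UNIV. p12 a b c * kap U a b c y) = p1 a b * kap1 U a b y"
  unfolding kap1_def sum_distrib_left mult.assoc[symmetric] p12_div_p1 ..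

lemma p2_kap2: "(\<Sum>b\<in>UNIV. p12 a b c * kap U a b c y) = p2 a c * kap2 U a c y"
  unfolding kap2_def sum_distrib_left mult.assoc[symmetric] p12_div_p2 ..

lemma sum_5: "(\<Sum>s\<in>UNIV. F s) = (\<Sum>q\<in>UNIV. \<Sum>a\<in>UNIV. \<Sum>b\<in>UNIV. \<Sum>c\<in>UNIV. \<Sum>y\<in>UNIV. F (q, a, b, c, y))"
  for F :: "'q \<times> 'a \<times> 'b \<times> 'c \<times> 'y::finite \<Rightarrow> real"
  by (simp add: sum.cartesian_product' flip: UNIV_Times_UNIV)

section \<open>Means of the information densities as mutual informations\<close>

context
  fixes U :: "'x \<Rightarrow> 'y::finite \<Rightarrow> real"
  assumes U: "\<And>x. is_pmf UNIV (U x)"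
begin

lemma sum_kap0: "(\<Sum>y\<in>UNIV. kap0 U a y) = 1"
proof -
  have "(\<Sum>y\<in>UNIV. kap0 U a y) = (\<Sum>b\<in>UNIV. \<Sum>c\<in>UNIV. p12 a b c * (\<Sum>y\<in>UNIV. kap U a b c y))"
    unfolding kap0_def sum_distrib_left by (simp only: sum.swap[of _ _ "UNIV :: 'y set"])
  then show ?thesis by (simp add: sum_kap[OF U] sum_p12)
qed

lemma kap0_nonneg: "0 \<le> kap0 U a y"
  unfolding kap0_def using kap_nonneg[OF U] by (intro sum_nonneg) auto

lemma outQ_nonneg: "0 \<le> outQ U q y"
  unfolding outQ_def using kap0_nonneg by (intro sum_nonneg) auto

lemma sum_outQ: "(\<Sum>y\<in>UNIV. outQ U q y) = 1"
proof -
  have "(\<Sum>y\<in>UNIV. outQ U q y) = (\<Sum>a\<in>UNIV. k q a * (\<Sum>y\<in>UNIV. kap0 U a y))"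
    unfolding outQ_def sum_distrib_left by (rule sum.swap)
  then show ?thesis using is_pmfD(3)[OF k] by (simp add: sum_kap0)
qed

lemma J_nonneg: "0 \<le> J U s"
  using is_pmfD(2)[OF is_pmf_J[OF U]] by simp

text \<open>Makes the rate T_0 = I(V_0;Z|Q) admissible as the exponent of a codebook size.\<close>

lemma EJ_D0_nonneg: "0 \<le> EJ U (D0 U)"
proof -
  let ?v = "\<lambda>(q, a, b, c, y). outQ U q y" and ?u = "\<lambda>(q, a, b, c, y). kap0 U a y"
  have "(\<Sum>s\<in>UNIV. J U s * (?v s / ?u s))
    = (\<Sum>q\<in>UNIV. \<Sum>a\<in>UNIV. \<Sum>b\<in>UNIV. \<Sum>c\<in>UNIV. \<Sum>y\<in>UNIV.
        pq q * (k q a * (p12 a b c * kap U a b c y * (outQ U q y / kap0 U a y))))"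
    by (simp add: sum_5 J_def mult.assoc)
  also have "\<dots> = (\<Sum>q\<in>UNIV. pq q * (\<Sum>a\<in>UNIV. k q a * (\<Sum>y\<in>UNIV. kap0 U a y * (outQ U q y / kap0 U a y))))"
    unfolding kap0_def[of U _ _, abs_def] sum_distrib_left sum_distrib_right
    by (simp only: sum.swap[of _ "UNIV :: 'y set" "UNIV :: 'c set"] sum.swap[of _ "UNIV :: 'y set" "UNIV :: 'b set"])
  \<comment> \<open>Only an inequality, since \<open>kap0 * (outQ / kap0)\<close> is 0 instead of
    \<open>outQ\<close> where \<open>kap0\<close> vanishes.\<close>
  also have "\<dots> \<le> (\<Sum>q\<in>UNIV. pq q * (\<Sum>a\<in>UNIV. k q a * (\<Sum>y\<in>UNIV. outQ U q y)))"
    by (intro sum_mono mult_left_mono) (auto simp: outQ_nonneg)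
  also have "\<dots> = 1" using is_pmfD(3)[OF k] is_pmfD(3)[OF pq] by (simp add: sum_outQ)
  finally have "0 \<le> (\<Sum>s\<in>UNIV. J U s * log 2 (?u s / ?v s))"
    using positive[of U, OF U] by (intro expectation_log_ratio_nonneg[OF is_pmf_J[OF U]]) auto
  also have "\<dots> = EJ U (D0 U)" unfolding EJ_def D0_def by (intro sum.cong) auto
  finally show ?thesis .
qed

lemma EJ_log_ratio_mono:
  assumes pos: "\<And>q a b c y. 0 < J U (q, a, b, c, y) \<Longrightarrow>
      0 < u (q, a, b, c, y) \<and> 0 < v (q, a, b, c, y) \<and> 0 < w (q, a, b, c, y)"
    and le: "(\<Sum>s\<in>UNIV. J U s * (v s / u s)) \<le> 1"
  shows "EJ U (\<lambda>s. log 2 (v s / w s)) \<le> EJ U (\<lambda>s. log 2 (u s / w s))"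
proof -
  have pos': "0 < u s \<and> 0 < v s \<and> 0 < w s" if "0 < J U s" for s
    using that pos by (cases s) auto
  have "0 \<le> (\<Sum>s\<in>UNIV. J U s * log 2 (u s / v s))"
    using pos' le by (intro expectation_log_ratio_nonneg[OF is_pmf_J[OF U]]) auto
  also have "\<dots> = (\<Sum>s\<in>UNIV. J U s * log 2 (u s / w s) - J U s * log 2 (v s / w s))"
  proof (intro sum.cong refl)
    fix s
    show "J U s * log 2 (u s / v s) = J U s * log 2 (u s / w s) - J U s * log 2 (v s / w s)"
    proof (cases "J U s = 0")
      case False
      then show ?thesis using pos'[of s] J_nonneg[of s]
        by (simp add: order.strict_iff_order log_divide_pos flip: right_diff_distrib)
    qed simp
  qed
  finally show ?thesis by (simp add: EJ_def sum_subtractf)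
qed

text \<open>The difference of the two sides is I(V_1;Y|V_0); for the eavesdropper this is the rate
  T_1, which has to be nonnegative.\<close>

lemma EJ_D0_le_D1: "EJ U (D0 U) \<le> EJ U (D1 U)"
proof -
  let ?v = "\<lambda>(q, a, b, c, y). kap0 U a y" and ?u = "\<lambda>(q, a, b, c, y). kap1 U a b y"
    and ?w = "\<lambda>(q, a, b, c, y). outQ U q y"
  have "(\<Sum>s\<in>UNIV. J U s * (?v s / ?u s))
    = (\<Sum>q\<in>UNIV. \<Sum>a\<in>UNIV. \<Sum>b\<in>UNIV. \<Sum>c\<in>UNIV. \<Sum>y\<in>UNIV.
        pq q * (k q a * (p12 a b c * kap U a b c y * (kap0 U a y / kap1 U a b y))))"
    by (simp add: sum_5 J_def mult.assoc)
  also have "\<dots> = (\<Sum>q\<in>UNIV. pq q * (\<Sum>a\<in>UNIV. k q a * (\<Sum>b\<in>UNIV. \<Sum>y\<in>UNIV.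
      p1 a b * kap1 U a b y * (kap0 U a y / kap1 U a b y))))"
    unfolding p1_kap1[symmetric] sum_distrib_left sum_distrib_right
    by (simp only: sum.swap[of _ "UNIV :: 'y set" "UNIV :: 'c set"])
  also have "\<dots> \<le> (\<Sum>q\<in>UNIV. pq q * (\<Sum>a\<in>UNIV. k q a * (\<Sum>b\<in>UNIV. \<Sum>y\<in>UNIV. p1 a b * kap0 U a y)))"
    by (intro sum_mono mult_left_mono) (auto simp: kap0_nonneg)
  also have "\<dots> = (\<Sum>q\<in>UNIV. pq q * (\<Sum>a\<in>UNIV. k q a * (\<Sum>b\<in>UNIV. p1 a b)))"
    by (simp add: sum_kap0 flip: sum_distrib_left)
  also have "\<dots> = 1" using is_pmfD(3)[OF k] is_pmfD(3)[OF pq] by (simp add: p1_def sum_p12)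
  finally have "EJ U (\<lambda>s. log 2 (?v s / ?w s)) \<le> EJ U (\<lambda>s. log 2 (?u s / ?w s))"
    using positive[of U, OF U] by (intro EJ_log_ratio_mono) auto
  then show ?thesis by (simp add: EJ_def D0_def D1_def case_prod_unfold)
qed

lemma EJ_D0_le_D2: "EJ U (D0 U) \<le> EJ U (D2 U)"
proof -
  let ?v = "\<lambda>(q, a, b, c, y). kap0 U a y" and ?u = "\<lambda>(q, a, b, c, y). kap2 U a c y"
    and ?w = "\<lambda>(q, a, b, c, y). outQ U q y"
  have "(\<Sum>s\<in>UNIV. J U s * (?v s / ?u s))
    = (\<Sum>q\<in>UNIV. \<Sum>a\<in>UNIV. \<Sum>b\<in>UNIV. \<Sum>c\<in>UNIV. \<Sum>y\<in>UNIV.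
        pq q * (k q a * (p12 a b c * kap U a b c y * (kap0 U a y / kap2 U a c y))))"
    by (simp add: sum_5 J_def mult.assoc)
  also have "\<dots> = (\<Sum>q\<in>UNIV. pq q * (\<Sum>a\<in>UNIV. k q a * (\<Sum>c\<in>UNIV. \<Sum>y\<in>UNIV.
      p2 a c * kap2 U a c y * (kap0 U a y / kap2 U a c y))))"
    unfolding p2_kap2[symmetric] sum_distrib_left sum_distrib_right
    by (simp only: sum.swap[of _ "UNIV :: 'c set" "UNIV :: 'b set"] sum.swap[of _ "UNIV :: 'y set" "UNIV :: 'b set"])
  also have "\<dots> \<le> (\<Sum>q\<in>UNIV. pq q * (\<Sum>a\<in>UNIV. k q a * (\<Sum>c\<in>UNIV. \<Sum>y\<in>UNIV. p2 a c * kap0 U a y)))"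
    by (intro sum_mono mult_left_mono) (auto simp: kap0_nonneg)
  also have "\<dots> = (\<Sum>q\<in>UNIV. pq q * (\<Sum>a\<in>UNIV. k q a * (\<Sum>c\<in>UNIV. p2 a c)))"
    by (simp add: sum_kap0 flip: sum_distrib_left)
  also have "\<dots> = 1"
  proof -
    have "(\<Sum>c\<in>UNIV. p2 a c) = 1" for a unfolding p2_def by (subst sum.swap) (rule sum_p12)
    then show ?thesis using is_pmfD(3)[OF k] is_pmfD(3)[OF pq] by simp
  qed
  finally have "EJ U (\<lambda>s. log 2 (?v s / ?w s)) \<le> EJ U (\<lambda>s. log 2 (?u s / ?w s))"
    using positive[of U, OF U] by (intro EJ_log_ratio_mono) auto
  then show ?thesis by (simp add: EJ_def D0_def D2_def case_prod_unfold)
qed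

abbreviation (input) tQ :: "'q \<times> 'a \<times> 'b \<times> 'c \<times> 'y \<Rightarrow> 'q" where "tQ \<equiv> \<lambda>t. fst t"
abbreviation (input) t0 :: "'q \<times> 'a \<times> 'b \<times> 'c \<times> 'y \<Rightarrow> 'a" where "t0 \<equiv> \<lambda>t. fst (snd t)"
abbreviation (input) t1 :: "'q \<times> 'a \<times> 'b \<times> 'c \<times> 'y \<Rightarrow> 'b" where "t1 \<equiv> \<lambda>t. fst (snd (snd t))"
abbreviation (input) t2 :: "'q \<times> 'a \<times> 'b \<times> 'c \<times> 'y \<Rightarrow> 'c" where "t2 \<equiv> \<lambda>t. fst (snd (snd (snd t)))"
abbreviation (input) tY :: "'q \<times> 'a \<times> 'b \<times> 'c \<times> 'y \<Rightarrow> 'y" where "tY \<equiv> \<lambda>t. snd (snd (snd (snd t)))"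

text \<open>Each marginal in question fixes some of the five coordinates and leaves the others free,
  so the fibre of \<open>f\<close> is a box and the sum over it can be nested.\<close>

lemma marg_J:
  assumes "{t. f t = f s} = B0 \<times> B1 \<times> B2 \<times> B3 \<times> B4"
  shows "marg UNIV (J U) f s = (\<Sum>q\<in>B0. \<Sum>a\<in>B1. pq q * k q a *
    (\<Sum>b\<in>B2. \<Sum>c\<in>B3. p12 a b c * (\<Sum>y\<in>B4. kap U a b c y)))"
  unfolding marg_def using assms
  by (simp add: J_def sum.cartesian_product' sum_distrib_left mult.assoc)

lemma marg_01YQ: "marg UNIV (J U) (\<lambda>t. ((t0 t, t1 t), tY t, tQ t)) (q, a, b, c, y)
    = pq q * k q a * (p1 a b * kap1 U a b y)"
  by (subst marg_J[of _ _ "{q}" "{a}" "{b}" UNIV "{y}"])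
    (auto simp: p1_kap1)

lemma marg_02YQ: "marg UNIV (J U) (\<lambda>t. ((t0 t, t2 t), tY t, tQ t)) (q, a, b, c, y)
    = pq q * k q a * (p2 a c * kap2 U a c y)"
  by (subst marg_J[of _ _ "{q}" "{a}" UNIV "{c}" "{y}"])
    (auto simp: p2_kap2)

lemma marg_01Q: "marg UNIV (J U) (\<lambda>t. ((t0 t, t1 t), tQ t)) (q, a, b, c, y) = pq q * k q a * p1 a b"
  by (subst marg_J[of _ _ "{q}" "{a}" "{b}" UNIV UNIV])
    (auto simp: sum_kap[OF U] p1_def)

lemma marg_02Q: "marg UNIV (J U) (\<lambda>t. ((t0 t, t2 t), tQ t)) (q, a, b, c, y) = pq q * k q a * p2 a c"
  by (subst marg_J[of _ _ "{q}" "{a}" UNIV "{c}" UNIV])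
    (auto simp: sum_kap[OF U] p2_def)

lemma marg_YQ: "marg UNIV (J U) (\<lambda>t. (tY t, tQ t)) (q, a, b, c, y) = pq q * outQ U q y"
  by (subst marg_J[of _ _ "{q}" UNIV UNIV UNIV "{y}"])
    (auto simp: outQ_def kap0_def sum_distrib_left mult.assoc)

lemma marg_Q: "marg UNIV (J U) tQ (q, a, b, c, y) = pq q"
  using is_pmfD(3)[OF k]
  by (subst marg_J[of _ _ "{q}" UNIV UNIV UNIV UNIV])
    (auto simp: sum_kap[OF U] sum_p12 simp flip: sum_distrib_left)

definition pv0 :: "'a \<Rightarrow> real" where "pv0 a = (\<Sum>q\<in>UNIV. pq q * k q a)"

lemma marg_12Y0: "marg UNIV (J U) (\<lambda>t. ((t1 t, t2 t), tY t, t0 t)) (q, a, b, c, y)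
    = pv0 a * (p12 a b c * kap U a b c y)"
  by (subst marg_J[of _ _ UNIV "{a}" "{b}" "{c}" "{y}"])
    (auto simp: pv0_def sum_distrib_right)

lemma marg_120: "marg UNIV (J U) (\<lambda>t. ((t1 t, t2 t), t0 t)) (q, a, b, c, y) = pv0 a * p12 a b c"
  by (subst marg_J[of _ _ UNIV "{a}" "{b}" "{c}" UNIV])
    (auto simp: pv0_def sum_distrib_right sum_kap[OF U])

lemma marg_1_2_0: "marg UNIV (J U) (\<lambda>t. (t1 t, t2 t, t0 t)) (q, a, b, c, y) = pv0 a * p12 a b c"
  by (subst marg_J[of _ _ UNIV "{a}" "{b}" "{c}" UNIV])
    (auto simp: pv0_def sum_distrib_right sum_kap[OF U])

lemma marg_1Y0: "marg UNIV (J U) (\<lambda>t. (t1 t, tY t, t0 t)) (q, a, b, c, y) = pv0 a * (p1 a b * kap1 U a b y)"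
  by (subst marg_J[of _ _ UNIV "{a}" "{b}" UNIV "{y}"])
    (auto simp: pv0_def p1_kap1 sum_distrib_right)

lemma marg_2Y0: "marg UNIV (J U) (\<lambda>t. (t2 t, tY t, t0 t)) (q, a, b, c, y) = pv0 a * (p2 a c * kap2 U a c y)"
  by (subst marg_J[of _ _ UNIV "{a}" UNIV "{c}" "{y}"])
    (auto simp: pv0_def p2_kap2 sum_distrib_right)

lemma marg_10: "marg UNIV (J U) (\<lambda>t. (t1 t, t0 t)) (q, a, b, c, y) = pv0 a * p1 a b"
  by (subst marg_J[of _ _ UNIV "{a}" "{b}" UNIV UNIV])
    (auto simp: pv0_def p1_def[symmetric] sum_distrib_right sum_kap[OF U])

lemma marg_20: "marg UNIV (J U) (\<lambda>t. (t2 t, t0 t)) (q, a, b, c, y) = pv0 a * p2 a c"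
  by (subst marg_J[of _ _ UNIV "{a}" UNIV "{c}" UNIV])
    (auto simp: pv0_def p2_def[symmetric] sum_distrib_right sum_kap[OF U])

lemma marg_Y0: "marg UNIV (J U) (\<lambda>t. (tY t, t0 t)) (q, a, b, c, y) = pv0 a * kap0 U a y"
  by (subst marg_J[of _ _ UNIV "{a}" UNIV UNIV "{y}"])
    (auto simp: pv0_def kap0_def[symmetric] sum_distrib_right)

lemma marg_0: "marg UNIV (J U) t0 (q, a, b, c, y) = pv0 a"
  by (subst marg_J[of _ _ UNIV "{a}" UNIV UNIV UNIV])
    (auto simp: pv0_def sum_p12 sum_kap[OF U])

lemma positive_J:
  assumes "0 < J U (q, a, b, c, y)"
  shows "0 < pq q" "0 < k q a" "0 < p12 a b c" "0 < p1 a b" "0 < p2 a c" "0 < pv0 a"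
proof -
  have "pq q \<noteq> 0 \<and> k q a \<noteq> 0 \<and> p12 a b c \<noteq> 0" using assms by (auto simp: J_def)
  then show p: "0 < pq q" "0 < k q a" "0 < p12 a b c"
    using nonneg(1)[of q] nonneg(2)[of q a] nonneg(3)[of a b c]
    by (auto simp only: order.strict_iff_order)
  have "0 < ratio a b c" using positive(2)[of U, OF U assms] .
  then have "p1 a b \<noteq> 0" "p2 a c \<noteq> 0" by (auto simp: ratio_def)
  then show "0 < p1 a b" "0 < p2 a c" by (auto simp: order.strict_iff_order)
  have "pq q * k q a \<le> pv0 a" unfolding pv0_def by (intro member_le_sum[of q _ "\<lambda>q. pq q * k q a"]) auto
  then show "0 < pv0 a" using p by (meson mult_pos_pos order_less_le_trans)
qed

lemma cmi_eq_EJ: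
  assumes "\<And>q a b c y. 0 < J U (q, a, b, c, y) \<Longrightarrow>
    log 2 (marg UNIV (J U) (\<lambda>t. (f t, g t, h t)) (q, a, b, c, y) * marg UNIV (J U) h (q, a, b, c, y) /
      (marg UNIV (J U) (\<lambda>t. (f t, h t)) (q, a, b, c, y) * marg UNIV (J U) (\<lambda>t. (g t, h t)) (q, a, b, c, y)))
    = d (q, a, b, c, y)"
  shows "cmi UNIV (J U) f g h = EJ U d"
  unfolding cmi_def EJ_def
proof (intro sum.cong refl)
  fix s :: "'q \<times> 'a \<times> 'b \<times> 'c \<times> 'y"
  obtain q a b c y where s: "s = (q, a, b, c, y)" by (cases s)
  show "J U s * log 2 (marg UNIV (J U) (\<lambda>t. (f t, g t, h t)) s * marg UNIV (J U) h s /
      (marg UNIV (J U) (\<lambda>t. (f t, h t)) s * marg UNIV (J U) (\<lambda>t. (g t, h t)) s)) = J U s * d s"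
    using assms[of q a b c y] J_nonneg[of s] s by (cases "J U s = 0") (auto simp: order.strict_iff_order)
qed

lemma cmi_01_Y_Q: "cmi UNIV (J U) (\<lambda>t. (t0 t, t1 t)) tY tQ = EJ U (D1 U)"
proof (rule cmi_eq_EJ, goal_cases)
  case (1 q a b c y)
  then show ?case using positive_J[OF 1] by (simp add: marg_01YQ marg_01Q marg_YQ marg_Q D1_def)
qed

lemma cmi_02_Y_Q: "cmi UNIV (J U) (\<lambda>t. (t0 t, t2 t)) tY tQ = EJ U (D2 U)"
proof (rule cmi_eq_EJ, goal_cases)
  case (1 q a b c y)
  then show ?case using positive_J[OF 1] by (simp add: marg_02YQ marg_02Q marg_YQ marg_Q D2_def)
qed

lemma EJ_add: "EJ U f + EJ U g = EJ U (\<lambda>s. f s + g s)"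
  by (simp add: EJ_def distrib_left sum.distrib)
lemma EJ_diff: "EJ U f - EJ U g = EJ U (\<lambda>s. f s - g s)"
  by (simp add: EJ_def right_diff_distrib sum_subtractf)

lemma cmi_1_Y_0: "cmi UNIV (J U) t1 tY t0 = EJ U (D1 U) - EJ U (D0 U)"
  unfolding EJ_diff
proof (rule cmi_eq_EJ, goal_cases)
  case (1 q a b c y)
  then show ?case using positive_J[OF 1] positive[of U, OF U 1]
    by (simp add: marg_1Y0 marg_10 marg_Y0 marg_0 D1_def D0_def log_divide_pos log_mult_pos)
qed

lemma cmi_2_Y_0: "cmi UNIV (J U) t2 tY t0 = EJ U (D2 U) - EJ U (D0 U)"
  unfolding EJ_diff
proof (rule cmi_eq_EJ, goal_cases)
  case (1 q a b c y)
  then show ?case using positive_J[OF 1] positive[of U, OF U 1]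
    by (simp add: marg_2Y0 marg_20 marg_Y0 marg_0 D2_def D0_def log_divide_pos log_mult_pos)
qed

text \<open>On the support of \<open>J\<close>, log (\<open>kap / kap0\<close>) + log
  \<open>ratio\<close> = \<open>D12 - D0\<close>: the extra factor in \<open>D12\<close> is the
  density of I(V_1;V_2|V_0). The sum of these two informations is what the hypothesis of the theorem
  bounds.\<close>

lemma cmi_12_Y_0: "cmi UNIV (J U) (\<lambda>t. (t1 t, t2 t)) tY t0 + cmi UNIV (J U) t1 t2 t0
    = EJ U (D12 U) - EJ U (D0 U)"
proof -
  have "cmi UNIV (J U) (\<lambda>t. (t1 t, t2 t)) tY t0
    = EJ U (\<lambda>(q, a, b, c, y). log 2 (kap U a b c y / kap0 U a y))"
  proof (rule cmi_eq_EJ, goal_cases)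
    case (1 q a b c y)
    then show ?case using positive_J[OF 1] by (simp add: marg_12Y0 marg_120 marg_Y0 marg_0)
  qed
  moreover have "cmi UNIV (J U) t1 t2 t0 = EJ U (\<lambda>s. D12 U s - D0 U s
      - (case s of (q, a, b, c, y) \<Rightarrow> log 2 (kap U a b c y / kap0 U a y)))"
  proof (rule cmi_eq_EJ, goal_cases)
    case (1 q a b c y)
    have "0 < pv0 a" "0 < ratio a b c" using positive_J[OF 1] positive[of U, OF U 1] by auto
    then show ?case using positive[of U, OF U 1]
      by (simp add: marg_1_2_0 marg_10 marg_20 marg_0 D12_def D0_def log_divide_pos log_mult_pos)
        (simp add: ratio_def)
  qed
  ultimately show ?thesis by (simp add: EJ_diff EJ_add)
qed

end

end

section \<open>Achievability\<close>

lemma avg_error_nonneg: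
  assumes "\<And>m. m \<in> Ms \<Longrightarrow> is_pmf Y (P m)"
  shows "0 \<le> avg_error Ms Y P dec"
  unfolding avg_error_def using is_pmfD(2)[OF assms]
  by (intro divide_nonneg_nonneg sum_nonneg mult_nonneg_nonneg) auto

lemma avg_div_nonneg:
  assumes "\<And>m. m \<in> Ms \<Longrightarrow> is_pmf Z (P m)" "is_pmf Z Q"
    and "\<And>m z. m \<in> Ms \<Longrightarrow> z \<in> Z \<Longrightarrow> 0 < P m z \<Longrightarrow> 0 < Q z"
  shows "0 \<le> avg_div Ms Z P Q"
  unfolding avg_div_def using is_pmfD[OF assms(2)] assms
  by (intro divide_nonneg_nonneg sum_nonneg divergence_nonneg) auto

lemma achievableI:
  fixes W :: "'x::finite \<Rightarrow> 'y1::finite \<times> 'y2::finite \<times> 'z::finite \<Rightarrow> real"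
  assumes W: "dmc W" and lim: "\<epsilon> \<longlonglongrightarrow> 0"
    and codes: "\<And>n. 0 < n \<Longrightarrow> has_code (msgs n R) (lists_n n) (lists_n n) (lists_n n) (lists_n n)
      (prod_kernel n (margin1 W)) (prod_kernel n (margin2 W)) (prod_kernel n (margin3 W)) (1 / n) (\<epsilon> n)"
  shows "achievable W R"
proof -
  have "\<exists>enc dec1 dec2. is_encoder n R enc \<and> (0 < n \<longrightarrow>
      0 \<le> err_prob W n R enc dec1 dec2 \<and> err_prob W n R enc dec1 dec2 \<le> \<epsilon> n
      \<and> R - \<epsilon> n \<le> equivocation W n R enc / n)" for n
  proof (cases "n = 0")
    case True
    \<comment> \<open>At block length 0 there is only the empty word; the limits ignore this
      code.\<close>
    have "is_encoder n R (\<lambda>m xs. of_bool (xs = []))"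
      unfolding True by (simp add: is_encoder_def lists_n_0)
    then show ?thesis using True by blast
  next
    case False
    then have n: "0 < n" by simp
    obtain enc dec1 dec2 Q where c: "\<forall>m\<in>msgs n R. is_pmf (lists_n n) (enc m)" "is_pmf (lists_n n) Q"
      "\<forall>m\<in>msgs n R. \<forall>z\<in>lists_n n. 0 < block_out n enc (margin3 W) m z \<longrightarrow> 0 < Q z"
      "avg_error (msgs n R) (lists_n n) (block_out n enc (margin1 W)) dec1
        + avg_error (msgs n R) (lists_n n) (block_out n enc (margin2 W)) dec2
        + 1 / n * avg_div (msgs n R) (lists_n n) (block_out n enc (margin3 W)) Q
      \<le> \<epsilon> n"
      using codes[OF n] unfolding has_code_def by (elim exE conjE)
    \<comment> \<open>\<open>is_encoder\<close> asks for nonnegativity on all lists,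
      \<open>has_code\<close> only on those of length \<open>n\<close>. Extension by 0 leaves the
      output laws unchanged.\<close>
    define enc' where "enc' m xs = (if xs \<in> lists_n n then enc m xs else 0)" for m xs
    have through: "through (lists_n n) enc' V = through (lists_n n) enc V"
      for V :: "'x list \<Rightarrow> 'y list \<Rightarrow> real"
      by (intro ext) (simp add: through_def enc'_def)
    have enc': "is_pmf (lists_n n) (enc' m)" if "m \<in> msgs n R" for m
      using is_pmfD[OF c(1)[rule_format, OF that]] by (simp add: is_pmf_def enc'_def)
    have E: "is_encoder n R enc'"
      using is_pmfD(2)[OF c(1)[rule_format]] is_pmfD(3)[OF enc'] by (auto simp: is_encoder_def enc'_def)
    have pm: "is_pmf (lists_n n) (block_out n enc V m)"
      if "m \<in> msgs n R" "\<And>x. is_pmf UNIV (V x)" for V :: "'x \<Rightarrow> 'y::finite \<Rightarrow> real" and m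
      using that c(1) by (intro is_pmf_through is_pmf_prod_kernel) auto
    have e: "0 \<le> avg_error (msgs n R) (lists_n n) (block_out n enc (margin1 W)) dec1"
      "0 \<le> avg_error (msgs n R) (lists_n n) (block_out n enc (margin2 W)) dec2"
      by (intro avg_error_nonneg pm is_pmf_margins[OF W]; assumption)+
    have "0 \<le> avg_div (msgs n R) (lists_n n) (block_out n enc (margin3 W)) Q"
      using c(2,3) by (intro avg_div_nonneg pm is_pmf_margins[OF W]) auto
    then have d: "0 \<le> 1 / n * avg_div (msgs n R) (lists_n n) (block_out n enc (margin3 W)) Q"
      by simp
    have "err_prob W n R enc' dec1 dec2
      \<le> avg_error (msgs n R) (lists_n n) (block_out n enc' (margin1 W)) dec1
      + avg_error (msgs n R) (lists_n n) (block_out n enc' (margin2 W)) dec2"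
      by (rule err_prob_le(2)[OF W enc'])
    then have "err_prob W n R enc' dec1 dec2 \<le> \<epsilon> n"
      using c(4) d unfolding through by linarith
    moreover have "0 \<le> err_prob W n R enc' dec1 dec2" by (rule err_prob_le(1)[OF W enc'])
    moreover have "R - \<epsilon> n \<le> equivocation W n R enc' / n"
    proof -
      have "n * R - avg_div (msgs n R) (lists_n n) (block_out n enc (margin3 W)) Q
        \<le> equivocation W n R enc'"
      proof -
        have "log 2 (num_msgs n R) - avg_div (msgs n R) (lists_n n) (block_out n enc' (margin3 W)) Q
          \<le> equivocation W n R enc'"
          by (rule equivocation_ge[OF W enc' c(2)]) (use c(3) in \<open>auto simp: through\<close>)
        then show ?thesis using log_num_msgs[of n R] unfolding through by linarith
      qed
      then have "(n * R - avg_div (msgs n R) (lists_n n) (block_out n enc (margin3 W)) Q) / n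
        \<le> equivocation W n R enc' / n" by (intro divide_right_mono) auto
      then have "R - 1 / n * avg_div (msgs n R) (lists_n n) (block_out n enc (margin3 W)) Q
        \<le> equivocation W n R enc' / n" using n by (simp add: diff_divide_distrib)
      then show ?thesis using c(4) e by linarith
    qed
    ultimately show ?thesis using E by blast
  qed
  then obtain enc dec1 dec2 where *: "\<And>n. is_encoder n R (enc n)"
    "\<And>n. 0 < n \<Longrightarrow> 0 \<le> err_prob W n R (enc n) (dec1 n) (dec2 n)"
    "\<And>n. 0 < n \<Longrightarrow> err_prob W n R (enc n) (dec1 n) (dec2 n) \<le> \<epsilon> n"
    "\<And>n. 0 < n \<Longrightarrow> R - \<epsilon> n \<le> equivocation W n R (enc n) / n" by metis
  have ev: "eventually (\<lambda>n. 0 < (n::nat)) sequentially" by (rule eventually_gt_at_top)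
  have "(\<lambda>n. err_prob W n R (enc n) (dec1 n) (dec2 n)) \<longlonglongrightarrow> 0"
    by (rule tendsto_sandwich[OF _ _ tendsto_const lim]; use ev in eventually_elim) (use * in auto)
  moreover have "ereal R \<le> liminf (\<lambda>n. ereal (equivocation W n R (enc n) / real n))"
  proof -
    have "(\<lambda>n. R - \<epsilon> n) \<longlonglongrightarrow> R - 0" by (intro tendsto_intros lim)
    then have "(\<lambda>n. ereal (R - \<epsilon> n)) \<longlonglongrightarrow> ereal R" by simp
    from lim_imp_Liminf[OF trivial_limit_sequentially this]
    have "ereal R = liminf (\<lambda>n. ereal (R - \<epsilon> n))" by (rule sym)
    also have "\<dots> \<le> liminf (\<lambda>n. ereal (equivocation W n R (enc n) / real n))"
      by (rule Liminf_mono; use ev in eventually_elim) (use * in auto)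
    finally show ?thesis .
  qed
  ultimately show ?thesis unfolding achievable_def using *(1) by blast
qed

text \<open>One message and one constant codeword: no error, and with its own output law as
  reference no divergence. This puts the capacity at 0 or above, which settles the theorem when its
  lower bound is not positive.\<close>

lemma achievable_0:
  fixes W :: "'x::finite \<Rightarrow> 'y1::finite \<times> 'y2::finite \<times> 'z::finite \<Rightarrow> real"
  assumes W: "dmc W"
  shows "achievable W 0"
proof (rule achievableI[OF W, of "\<lambda>_. 0"])
  fix n :: nat
  define enc :: "nat \<Rightarrow> 'x list \<Rightarrow> real" where "enc m xs = of_bool (xs = replicate n undefined)" for m xs
  have M: "msgs n 0 = {1}" by (simp add: msgs_def num_msgs_def)
  have "replicate n undefined \<in> (lists_n n :: 'x list set)" by (simp add: lists_n_def)
  then have e: "is_pmf (lists_n n) (enc m)" for m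
    by (auto simp: is_pmf_def enc_def of_bool_def sum.If_cases Int_absorb1 Collect_conj_eq)
  let ?P = "block_out n enc (margin3 W)"
  have P: "is_pmf (lists_n n) (?P m)" for m
    by (intro is_pmf_through e is_pmf_prod_kernel is_pmf_margins[OF W])
  have div: "avg_div {1} (lists_n n) ?P (?P 1) = 0"
    by (auto simp: avg_div_def intro!: sum.neutral)
  have err: "avg_error {1} (lists_n n) P (\<lambda>_. Some 1) = 0" for P :: "nat \<Rightarrow> 'y::finite list \<Rightarrow> real"
    by (simp add: avg_error_def)
  show "has_code (msgs n 0) (lists_n n) (lists_n n) (lists_n n) (lists_n n)
      (prod_kernel n (margin1 W)) (prod_kernel n (margin2 W)) (prod_kernel n (margin3 W)) (1 / n) 0"
    unfolding M has_code_def using e P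
    by (intro exI[of _ enc] exI[of _ "\<lambda>_. Some 1"] exI[of _ "?P 1"] conjI) (simp_all only: div err, auto)
qed auto

text \<open>The fibre is a box in each case: Q, V_0, V_1, V_2 and one output are fixed, X and the
  other two outputs are free, so \<open>W\<close> collapses to a marginal channel.\<close>

lemma push_aux_joint:
  fixes W :: "'x::finite \<Rightarrow> ('y1::finite \<times> 'y2::finite \<times> 'z::finite) \<Rightarrow> real"
    and pqv0 :: "('q::finite \<times> 'v0::finite) \<Rightarrow> real"
    and pv :: "'v0 \<Rightarrow> ('v1::finite \<times> 'v2::finite) \<Rightarrow> real"
    and px :: "('v1 \<times> 'v2 \<times> 'v0) \<Rightarrow> 'x \<Rightarrow> real"
  assumes "memoryless pq k (\<lambda>a b c. pv a (b, c)) (\<lambda>a b c. px (b, c, a))"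
    and pqk: "\<And>q a. pq q * k q a = pqv0 (q, a)"
  shows "push (aux_joint pqv0 pv px W) (\<lambda>s. (rvQ s, rvV0 s, rvV1 s, rvV2 s, rvY1 s))
      = memoryless.J pq k (\<lambda>a b c. pv a (b, c)) (\<lambda>a b c. px (b, c, a)) (margin1 W)"
    and "push (aux_joint pqv0 pv px W) (\<lambda>s. (rvQ s, rvV0 s, rvV1 s, rvV2 s, rvY2 s))
      = memoryless.J pq k (\<lambda>a b c. pv a (b, c)) (\<lambda>a b c. px (b, c, a)) (margin2 W)"
    and "push (aux_joint pqv0 pv px W) (\<lambda>s. (rvQ s, rvV0 s, rvV1 s, rvV2 s, rvZ s))
      = memoryless.J pq k (\<lambda>a b c. pv a (b, c)) (\<lambda>a b c. px (b, c, a)) (margin3 W)"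
proof -
  interpret memoryless pq k "\<lambda>a b c. pv a (b, c)" "\<lambda>a b c. px (b, c, a)" by fact
  have push_eq: "push (aux_joint pqv0 pv px W) \<pi> = J U"
    if "\<And>q a b c y. \<exists>A1 A2 A3. {s. \<pi> s = (q, a, b, c, y)}
        = {q} \<times> {a} \<times> {b} \<times> {c} \<times> UNIV \<times> A1 y \<times> A2 y \<times> A3 y
      \<and> (\<forall>x. U x y = (\<Sum>y1\<in>A1 y. \<Sum>y2\<in>A2 y. \<Sum>z\<in>A3 y. W x (y1, y2, z)))"
    for \<pi> :: "('q, 'v0, 'v1, 'v2, 'x, 'y1, 'y2, 'z) aux_outcome \<Rightarrow> 'q \<times> 'v0 \<times> 'v1 \<times> 'v2 \<times> 'y"
      and U :: "'x \<Rightarrow> 'y \<Rightarrow> real"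
  proof
    fix t :: "'q \<times> 'v0 \<times> 'v1 \<times> 'v2 \<times> 'y"
    obtain q a b c y where t: "t = (q, a, b, c, y)" by (cases t)
    from that[of q a b c y] obtain A1 A2 A3 where S: "{s. \<pi> s = (q, a, b, c, y)}
        = {q} \<times> {a} \<times> {b} \<times> {c} \<times> UNIV \<times> A1 y \<times> A2 y \<times> A3 y"
      and UW: "\<And>x. U x y = (\<Sum>y1\<in>A1 y. \<Sum>y2\<in>A2 y. \<Sum>z\<in>A3 y. W x (y1, y2, z))"
      by blast
    show "push (aux_joint pqv0 pv px W) \<pi> t = J U t"
      unfolding push_def t S
      by (simp add: sum.cartesian_product' aux_joint_def J_def pqk kap_def UW sum_distrib_left mult.assoc
          del: UNIV_Times_UNIV)
  qed
  note defs = rvQ_def rvV0_def rvV1_def rvV2_def rvY1_def rvY2_def rvZ_def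
  show "push (aux_joint pqv0 pv px W) (\<lambda>s. (rvQ s, rvV0 s, rvV1 s, rvV2 s, rvY1 s)) = J (margin1 W)"
    by (intro push_eq, rule exI[of _ "\<lambda>y. {y}"], rule exI[of _ "\<lambda>_. UNIV"], rule exI[of _ "\<lambda>_. UNIV"])
      (auto simp: defs margin1_def)
  show "push (aux_joint pqv0 pv px W) (\<lambda>s. (rvQ s, rvV0 s, rvV1 s, rvV2 s, rvY2 s)) = J (margin2 W)"
    by (intro push_eq, rule exI[of _ "\<lambda>_. UNIV"], rule exI[of _ "\<lambda>y. {y}"], rule exI[of _ "\<lambda>_. UNIV"])
      (auto simp: defs margin2_def)
  show "push (aux_joint pqv0 pv px W) (\<lambda>s. (rvQ s, rvV0 s, rvV1 s, rvV2 s, rvZ s)) = J (margin3 W)"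
    by (intro push_eq, rule exI[of _ "\<lambda>_. UNIV"], rule exI[of _ "\<lambda>_. UNIV"], rule exI[of _ "\<lambda>y. {y}"])
      (auto simp: defs margin3_def)
qed

theorem theorem1:
  fixes W :: "'x::finite \<Rightarrow> ('y1::finite \<times> 'y2::finite \<times> 'z::finite) \<Rightarrow> real"
    and pqv0 :: "('q::finite \<times> 'v0::finite) \<Rightarrow> real"
    and pv :: "'v0 \<Rightarrow> ('v1::finite \<times> 'v2::finite) \<Rightarrow> real"
    and px :: "('v1 \<times> 'v2 \<times> 'v0) \<Rightarrow> 'x \<Rightarrow> real"
  assumes "dmc W"
    and "pmf_on pqv0"
    and "\<forall>v0. pmf_on (pv v0)"
    and "\<forall>v. pmf_on (px v)"
    and "cmi UNIV (aux_joint pqv0 pv px W) (\<lambda>s. (rvV1 s, rvV2 s)) rvZ rvV0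
         \<le> cmi UNIV (aux_joint pqv0 pv px W) rvV1 rvZ rvV0
           + cmi UNIV (aux_joint pqv0 pv px W) rvV2 rvZ rvV0
           - cmi UNIV (aux_joint pqv0 pv px W) rvV1 rvV2 rvV0"
  shows "ereal (min
           (cmi UNIV (aux_joint pqv0 pv px W) (\<lambda>s. (rvV0 s, rvV1 s)) rvY1 rvQ
            - cmi UNIV (aux_joint pqv0 pv px W) (\<lambda>s. (rvV0 s, rvV1 s)) rvZ rvQ)
           (cmi UNIV (aux_joint pqv0 pv px W) (\<lambda>s. (rvV0 s, rvV2 s)) rvY2 rvQ
            - cmi UNIV (aux_joint pqv0 pv px W) (\<lambda>s. (rvV0 s, rvV2 s)) rvZ rvQ))
         \<le> secrecy_capacity W"
proof -
  let ?A = "aux_joint pqv0 pv px W"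
  define pq where "pq q = (\<Sum>a\<in>UNIV. pqv0 (q, a))" for q
  \<comment> \<open>where \<open>p(q) = 0\<close> the conditional law is irrelevant, but it has to be a pmf\<close>
  define k where "k q a = (if pq q = 0 then of_bool (a = undefined) else pqv0 (q, a) / pq q)" for q a
  have P0: "0 \<le> pqv0 s" for s using assms(2) unfolding pmf_on_def by blast
  have pqk: "pq q * k q a = pqv0 (q, a)" for q a
  proof (cases "pq q = 0")
    case True
    then have "pqv0 (q, a) = 0" using P0 by (auto simp: pq_def sum_nonneg_eq_0_iff)
    then show ?thesis using True by simp
  qed (simp add: k_def)
  have ml: "memoryless pq k (\<lambda>a b c. pv a (b, c)) (\<lambda>a b c. px (b, c, a))"
  proof
    show "is_pmf UNIV pq"
      using assms(2) P0 by (auto simp: is_pmf_def pmf_on_def pq_def sum.cartesian_product'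
          simp flip: UNIV_Times_UNIV intro!: sum_nonneg)
    show "is_pmf UNIV (k q)" for q
    proof (cases "pq q = 0")
      case False
      have "0 \<le> pq q" unfolding pq_def by (intro sum_nonneg P0)
      moreover have "(\<Sum>a\<in>UNIV. pqv0 (q, a) / pq q) = 1"
        using False by (simp add: pq_def flip: sum_divide_distrib)
      ultimately show ?thesis using False P0 by (simp add: is_pmf_def k_def)
    qed (simp add: is_pmf_def k_def of_bool_def)
    show "is_pmf UNIV (\<lambda>(b, c). pv a (b, c))" for a using assms(3) by (simp add: pmf_on_is_pmf)
    show "is_pmf UNIV (px (b, c, a))" for a b c using assms(4) by (simp add: pmf_on_is_pmf)
  qed
  interpret memoryless pq k "\<lambda>a b c. pv a (b, c)" "\<lambda>a b c. px (b, c, a)" by (rule ml)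
  note push = push_aux_joint[OF ml pqk, where W = W]
  note m = is_pmf_margins[OF assms(1)]
  note c1 = cmi_push[of ?A _ "\<lambda>s. (rvQ s, rvV0 s, rvV1 s, rvV2 s, rvY1 s)", unfolded push(1)]
  note c2 = cmi_push[of ?A _ "\<lambda>s. (rvQ s, rvV0 s, rvV1 s, rvV2 s, rvY2 s)", unfolded push(2)]
  note c3 = cmi_push[of ?A _ "\<lambda>s. (rvQ s, rvV0 s, rvV1 s, rvV2 s, rvZ s)", unfolded push(3)]
  let ?t0 = "\<lambda>t. fst (snd t)" and ?t1 = "\<lambda>t. fst (snd (snd t))" and ?t2 = "\<lambda>t. fst (snd (snd (snd t)))"
    and ?tY = "\<lambda>t. snd (snd (snd (snd t)))"
  have e1: "cmi UNIV ?A (\<lambda>s. (rvV0 s, rvV1 s)) rvY1 rvQ = EJ (margin1 W) (D1 (margin1 W))"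
    using c1[of "\<lambda>t. (?t0 t, ?t1 t)" ?tY fst] by (simp add: cmi_01_Y_Q[OF m(1)])
  have e2: "cmi UNIV ?A (\<lambda>s. (rvV0 s, rvV2 s)) rvY2 rvQ = EJ (margin2 W) (D2 (margin2 W))"
    using c2[of "\<lambda>t. (?t0 t, ?t2 t)" ?tY fst] by (simp add: cmi_02_Y_Q[OF m(2)])
  let ?Z = "margin3 W"
  have z1: "cmi UNIV ?A (\<lambda>s. (rvV0 s, rvV1 s)) rvZ rvQ = EJ ?Z (D1 ?Z)"
    using c3[of "\<lambda>t. (?t0 t, ?t1 t)" ?tY fst] by (simp add: cmi_01_Y_Q[OF m(3)])
  have z2: "cmi UNIV ?A (\<lambda>s. (rvV0 s, rvV2 s)) rvZ rvQ = EJ ?Z (D2 ?Z)"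
    using c3[of "\<lambda>t. (?t0 t, ?t2 t)" ?tY fst] by (simp add: cmi_02_Y_Q[OF m(3)])
  have z3: "cmi UNIV ?A rvV1 rvZ rvV0 = EJ ?Z (D1 ?Z) - EJ ?Z (D0 ?Z)"
    using c3[of ?t1 ?tY ?t0] by (simp add: cmi_1_Y_0[OF m(3)])
  have z4: "cmi UNIV ?A rvV2 rvZ rvV0 = EJ ?Z (D2 ?Z) - EJ ?Z (D0 ?Z)"
    using c3[of ?t2 ?tY ?t0] by (simp add: cmi_2_Y_0[OF m(3)])
  have z5: "cmi UNIV ?A (\<lambda>s. (rvV1 s, rvV2 s)) rvZ rvV0 + cmi UNIV ?A rvV1 rvV2 rvV0
      = EJ ?Z (D12 ?Z) - EJ ?Z (D0 ?Z)"
    using c3[of "\<lambda>t. (?t1 t, ?t2 t)" ?tY ?t0] c3[of ?t1 ?t2 ?t0] by (simp add: cmi_12_Y_0[OF m(3)])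
  define x where "x = min (EJ (margin1 W) (D1 (margin1 W)) - EJ ?Z (D1 ?Z))
    (EJ (margin2 W) (D2 (margin2 W)) - EJ ?Z (D2 ?Z))"
  have ach: "achievable W R" if R: "0 \<le> R" "R < x" for R
  proof -
    \<comment> \<open>\<open>?T0 + ?T1\<close> and \<open>?T0 + ?T2\<close> are the informations
      I(V_0,V_j;Z|Q) subtracted in \<open>x\<close>, so \<open>R < x\<close> yields both packing
      conditions.\<close>
    let ?T0 = "EJ ?Z (D0 ?Z)" and ?T1 = "EJ ?Z (D1 ?Z) - EJ ?Z (D0 ?Z)" and ?T2 = "EJ ?Z (D2 ?Z) - EJ ?Z (D0 ?Z)"
    have T: "0 \<le> ?T0" "0 \<le> ?T1" "0 \<le> ?T2"
      using EJ_D0_nonneg[OF m(3)] EJ_D0_le_D1[OF m(3)] EJ_D0_le_D2[OF m(3)] by auto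
    \<comment> \<open>The first three hold with equality. The fourth is the hypothesis of the
      theorem with I(V_1;V_2|V_0) moved to the left, where \<open>z5\<close> evaluates the
      sum.\<close>
    have cov: "?T0 \<le> ?T0" "EJ ?Z (D1 ?Z) \<le> ?T0 + ?T1" "EJ ?Z (D2 ?Z) \<le> ?T0 + ?T2"
      "EJ ?Z (D12 ?Z) \<le> ?T0 + ?T1 + ?T2"
      using assms(5) z3 z4 z5 by auto
    have pack: "R + ?T0 + ?T1 < EJ (margin1 W) (D1 (margin1 W))"
      "R + ?T0 + ?T2 < EJ (margin2 W) (D2 (margin2 W))"
      using R(2) by (auto simp: x_def)
    show ?thesis
      by (rule good_codes[OF m R(1) T cov pack]) (rule achievableI[OF assms(1)])
  qed
  have "ereal x \<le> secrecy_capacity W"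
  proof (rule ccontr)
    assume "\<not> ?thesis"
    then have lt: "secrecy_capacity W < ereal x" by simp
    have up: "ereal R \<le> secrecy_capacity W" if "achievable W R" for R
      unfolding secrecy_capacity_def using that by (intro Sup_upper) auto
    \<comment> \<open>A rate strictly between the capacity and \<open>x\<close>. It is positive
      because the rate 0 is achievable, so \<open>ach\<close> applies.\<close>
    obtain R where R: "secrecy_capacity W < ereal R" "ereal R < ereal x"
      using ereal_dense2[OF lt] by blast
    have "ereal 0 \<le> secrecy_capacity W" by (rule up[OF achievable_0[OF assms(1)]])
    then have "ereal 0 < ereal R" using R(1) by (rule order_le_less_trans)
    then have "achievable W R" using R(2) by (intro ach) auto
    then show False using up R(1) by (simp add: leD)
  qed
  then show ?thesis unfolding e1 e2 z1 z2 x_def .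
qed

end
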